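(* Let $p\geq 5$ be a prime and let $G$ be a finite $p$-group. Then the following conditions are equivalent: (1) $G$ is powerful; (2) $d(G)=\log_p\left(|\Omega_1(G)|\right)$.
   Context: For an odd prime $p$, a finite $p$-group $G$ is called powerful if $[G,G]\leq G^p$, where $G^p$ denotes the subgroup generated by all $p$-th powers of elements of $G$. $d(G)$ denotes the minimal number of generators of $G$. $\Omega_1(G)$ denotes the subgroup of $G$ generated by the elements of order $p$. *)

theory Defs
  imports Complex_Main "HOL-Algebra.Algebra"
begin

definition finite_p_group :: "nat \<Rightarrow> ('a, 'b) monoid_scheme \<Rightarrow> bool" where
  "finite_p_group p G \<longleftrightarrow> group G \<and> finite (carrier G) \<and> (\<exists>n::nat. order G = p ^ n)"

definition power_subgroup :: "nat \<Rightarrow> ('a, 'b) monoid_scheme \<Rightarrow> 'a set" where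
  "power_subgroup p G = generate G {x [^]\<^bsub>G\<^esub> p | x. x \<in> carrier G}"

(* The appropriate notion for odd p only; for p = 2 one requires [G,G] \<le> G^4 instead. *)
definition powerful :: "nat \<Rightarrow> ('a, 'b) monoid_scheme \<Rightarrow> bool" where
  "powerful p G \<longleftrightarrow> derived G (carrier G) \<subseteq> power_subgroup p G"

(* The LEAST is attained whenever G is finitely generated, in particular when G is finite. *)
definition min_generators :: "('a, 'b) monoid_scheme \<Rightarrow> nat" where
  "min_generators G =
     (LEAST n. \<exists>S \<subseteq> carrier G. finite S \<and> card S = n \<and> generate G S = carrier G)"

definition Omega_1 :: "nat \<Rightarrow> ('a, 'b) monoid_scheme \<Rightarrow> 'a set" where
  "Omega_1 p G = generate G {x \<in> carrier G. group.ord G x = p}"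

end

theory Submission
  imports Defs
begin

text \<open>Write \<open>\<lambda>(H) = H\<^sup>p \<gamma>\<^sub>3(H)\<close>. The heart of the proof is the inequality
  \<open>|G : \<lambda>(G)| \<le> |\<Omega>\<^sub>1(G)|\<close>, which holds for every finite \<open>p\<close>-group with \<open>p \<ge> 5\<close>. It follows Laffey's
  treatment of \<open>d\<close>-maximal groups: replace \<open>G\<close> by a subgroup \<open>H\<close> of least order with
  \<open>|H : \<lambda>(H)| \<ge> |G : \<lambda>(G)|\<close>. If \<open>\<lambda>(H)\<close> were not central, then in a quotient where \<open>[\<lambda>(H), H]\<close> has
  order \<open>p\<close> the centralizer \<open>L\<close> of \<open>\<lambda>(H)\<close> would satisfy \<open>\<lambda>(L) \<subseteq> \<lambda>(H) \<inter> Z(H)\<close>, so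
  \<open>|L : \<lambda>(L)| \<ge> |H : \<lambda>(H)|\<close>, against minimality. Hence \<open>\<lambda>(H)\<close> is central and \<open>x \<mapsto> x\<^sup>p\<close> is a
  homomorphism \<open>H \<rightarrow> \<lambda>(H)\<close>.

  If \<open>d(G) = log\<^sub>p |\<Omega>\<^sub>1(G)|\<close>, then \<open>|G : \<Phi>(G)| = |\<Omega>\<^sub>1(G)|\<close> forces \<open>\<Phi>(G) = \<lambda>(G)\<close>, and by nilpotency
  \<open>G' \<le> G\<^sup>p\<close>. Conversely, if \<open>G\<close> is powerful, then \<open>\<Phi>(G) = G\<^sup>p \<supseteq> \<lambda>(G)\<close>, and the opposite inequality
  \<open>|\<Omega>\<^sub>1(G)| \<le> |G : G\<^sup>p|\<close> holds because \<open>\<Omega>\<^sub>1(G)\<close> has exponent \<open>p\<close>, which is proved by induction on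
  quotients together with \<open>[\<Omega>\<^sub>1(G) \<inter> G\<^sup>p, \<Omega>\<^sub>1(G)] = 1\<close>.\<close>

section \<open>Collection formulas and quotients\<close>

text \<open>The corrections in the power formulas carry exponents \<open>p choose 2\<close> and
  \<open>p choose 3\<close>. Both are divisible by \<open>p\<close> once \<open>p \<ge> 5\<close>,
  whereas \<open>3 choose 3 = 1\<close>. A device used again and again: if
  \<open>h x h\<^sup>-1 = x c\<close> and the collected power \<open>(x c)\<^sup>p\<close> reduces
  to \<open>x\<^sup>p\<close>, then \<open>h\<close> commutes with \<open>x\<^sup>p\<close>.
  Centrality of powers is thus a matter of computing \<open>(x c)\<^sup>p\<close>. The comparison of
  \<open>L\<close> with \<open>H\<close> is a pairing argument: in the chosen quotient, commutation
  of \<open>H\<close> with \<open>\<lambda>(H)\<close> takes at most \<open>p\<close> values, so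
  \<open>|H : L|\<close> is at most the index of \<open>\<lambda>(H) \<inter> Z(H)\<close> in
  \<open>\<lambda>(H)\<close>. One obstacle shapes the statements: a subgroup is again a group over
  the same type, a quotient is not. Minimal and maximal choices are therefore made among subgroups
  of one fixed group, and facts about quotients are pulled back to it. Indices are compared as
  products of orders, without division.\<close>

definition commutator :: "('a, 'b) monoid_scheme \<Rightarrow> 'a \<Rightarrow> 'a \<Rightarrow> 'a" where
  "commutator G x y = x \<otimes>\<^bsub>G\<^esub> y \<otimes>\<^bsub>G\<^esub> inv\<^bsub>G\<^esub> x \<otimes>\<^bsub>G\<^esub> inv\<^bsub>G\<^esub> y"

context group
begin

lemma inv_mult_cancel [simp]:
  "x \<in> carrier G \<Longrightarrow> y \<in> carrier G \<Longrightarrow> inv x \<otimes> (x \<otimes> y) = y"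
  "x \<in> carrier G \<Longrightarrow> y \<in> carrier G \<Longrightarrow> x \<otimes> (inv x \<otimes> y) = y"
  by (simp_all flip: m_assoc)

lemma commutator_closed [simp, intro]:
  "x \<in> carrier G \<Longrightarrow> y \<in> carrier G \<Longrightarrow> commutator G x y \<in> carrier G"
  by (simp add: commutator_def)

lemma mult_eq_commutator_mult:
  assumes "x \<in> carrier G" "y \<in> carrier G"
  shows "x \<otimes> y = commutator G x y \<otimes> (y \<otimes> x)"
  using assms by (simp add: commutator_def m_assoc)

text \<open>The source of the letters \<open>c\<close>, \<open>d\<close>, \<open>e\<close> in later
  computations: \<open>c = commutator G (inv x) g\<close> is the element with
  \<open>g \<otimes> x \<otimes> inv g = x \<otimes> c\<close>, and most of the others arise by
  repeating this with \<open>c\<close> or \<open>d\<close> in the place of \<open>x\<close>.\<close>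

lemma conj_eq_mult_commutator:
  assumes "x \<in> carrier G" "g \<in> carrier G"
  shows "g \<otimes> x = x \<otimes> commutator G (inv x) g \<otimes> g"
  using assms by (simp add: commutator_def m_assoc)

lemma commutator_eq_one_iff:
  assumes "x \<in> carrier G" "y \<in> carrier G"
  shows "commutator G x y = \<one> \<longleftrightarrow> x \<otimes> y = y \<otimes> x"
proof
  assume "commutator G x y = \<one>"
  then show "x \<otimes> y = y \<otimes> x" using mult_eq_commutator_mult[OF assms] assms by simp
next
  assume "x \<otimes> y = y \<otimes> x"
  then show "commutator G x y = \<one>" using assms by (simp add: commutator_def m_assoc)
qed

lemma inv_commutator:
  assumes "x \<in> carrier G" "y \<in> carrier G"
  shows "inv (commutator G x y) = commutator G y x"
  using assms by (simp add: commutator_def m_assoc inv_mult_group)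

lemma commute_inv:
  assumes "x \<in> carrier G" "y \<in> carrier G" "x \<otimes> y = y \<otimes> x"
  shows "x \<otimes> inv y = inv y \<otimes> x"
  by (metis assms inv_closed inv_solve_left m_assoc m_closed inv_solve_right)

lemma commute_mult:
  assumes "x \<in> carrier G" "y \<in> carrier G" "z \<in> carrier G" "x \<otimes> y = y \<otimes> x" "x \<otimes> z = z \<otimes> x"
  shows "x \<otimes> (y \<otimes> z) = (y \<otimes> z) \<otimes> x"
  by (metis assms m_assoc)

lemma commute_pow:
  assumes "x \<in> carrier G" "y \<in> carrier G" "x \<otimes> y = y \<otimes> x"
  shows "x \<otimes> y [^] (n::nat) = y [^] n \<otimes> x"
  using assms by (metis group_commutes_pow)

lemma subgroup_commuting:
  assumes "S \<subseteq> carrier G"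
  shows "subgroup {x \<in> carrier G. \<forall>y\<in>S. x \<otimes> y = y \<otimes> x} G"
proof (rule subgroupI)
  show "inv a \<in> {x \<in> carrier G. \<forall>y\<in>S. x \<otimes> y = y \<otimes> x}"
    if "a \<in> {x \<in> carrier G. \<forall>y\<in>S. x \<otimes> y = y \<otimes> x}" for a
    using that assms by (auto intro!: commute_inv[symmetric])
  show "a \<otimes> b \<in> {x \<in> carrier G. \<forall>y\<in>S. x \<otimes> y = y \<otimes> x}"
    if "a \<in> {x \<in> carrier G. \<forall>y\<in>S. x \<otimes> y = y \<otimes> x}" "b \<in> {x \<in> carrier G. \<forall>y\<in>S. x \<otimes> y = y \<otimes> x}" for a b
    using that assms by (auto intro!: commute_mult[symmetric])
  have "\<one> \<in> {x \<in> carrier G. \<forall>y\<in>S. x \<otimes> y = y \<otimes> x}" using assms by auto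
  then show "{x \<in> carrier G. \<forall>y\<in>S. x \<otimes> y = y \<otimes> x} \<noteq> {}" by blast
qed auto

lemma conj_pow:
  assumes "x \<in> carrier G" "g \<in> carrier G"
  shows "(g \<otimes> x \<otimes> inv g) [^] (n::nat) = g \<otimes> x [^] n \<otimes> inv g"
  using assms by (induction n) (simp_all add: m_assoc)


lemma commute_pow_pow:
  assumes "x \<in> carrier G" "y \<in> carrier G" "x \<otimes> y = y \<otimes> x"
  shows "x [^] (m::nat) \<otimes> y [^] (n::nat) = y [^] n \<otimes> x [^] m"
  using assms by (metis commute_pow nat_pow_closed)

lemma pow_mult_conj_class2:
  assumes car: "x \<in> carrier G" "c \<in> carrier G" "e \<in> carrier G"
    and cx: "c \<otimes> x = x \<otimes> c \<otimes> e" and e: "e \<otimes> c = c \<otimes> e"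
  shows "c [^] (n::nat) \<otimes> x = x \<otimes> c [^] n \<otimes> e [^] n"
proof (induction n)
  case (Suc n)
  have "c [^] Suc n \<otimes> x = c [^] n \<otimes> x \<otimes> (c \<otimes> e)"
    using car cx by (simp add: m_assoc)
  also have "\<dots> = x \<otimes> c [^] n \<otimes> (e [^] n \<otimes> c) \<otimes> e"
    using car Suc by (simp add: m_assoc)
  also have "e [^] n \<otimes> c = c \<otimes> e [^] n"
    using car e by (metis commute_pow)
  finally show ?case using car by (simp add: m_assoc)
qed (use car in auto)

text \<open>Conjugation by \<open>y\<close> sends \<open>x\<close> to \<open>x c\<close>,
  \<open>c\<close> to \<open>c d\<close>, \<open>d\<close> to \<open>d e\<close> and fixes
  \<open>e\<close>. On the abelian group generated by \<open>c\<close>, \<open>d\<close>,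
  \<open>e\<close> it is unipotent, and the binomial coefficients are the entries of its
  \<open>n\<close>-th power; the induction is Pascal's rule.\<close>

lemma conj_pow_class3:
  assumes car: "x \<in> carrier G" "y \<in> carrier G" "c \<in> carrier G" "d \<in> carrier G" "e \<in> carrier G"
    and yx: "y \<otimes> x = x \<otimes> c \<otimes> y" and yc: "y \<otimes> c = c \<otimes> d \<otimes> y" and yd: "y \<otimes> d = d \<otimes> e \<otimes> y"
    and cd: "c \<otimes> d = d \<otimes> c" and ec: "e \<otimes> c = c \<otimes> e" and ed: "e \<otimes> d = d \<otimes> e" and ey: "e \<otimes> y = y \<otimes> e"
  shows "y [^] (n::nat) \<otimes> x = x \<otimes> c [^] n \<otimes> d [^] (n choose 2) \<otimes> e [^] (n choose 3) \<otimes> y [^] n"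
proof (induction n)
  case (Suc n)
  have ch: "Suc n choose 2 = n + (n choose 2)" "Suc n choose 3 = (n choose 2) + (n choose 3)"
    by (simp_all add: numeral_2_eq_2 numeral_3_eq_3)
  have conj: "y \<otimes> u [^] k = (u \<otimes> v) [^] k \<otimes> y"
    if "y \<otimes> u = u \<otimes> v \<otimes> y" "u \<in> carrier G" "v \<in> carrier G" for u v and k :: nat
  proof -
    have "y \<otimes> u \<otimes> inv y = u \<otimes> v" using that car by (simp add: m_assoc)
    then have "(u \<otimes> v) [^] k = y \<otimes> u [^] k \<otimes> inv y" using that car conj_pow by metis
    then show ?thesis using that car by (simp add: m_assoc)
  qed
  let ?k = "n choose 2" and ?l = "n choose 3"
  have "y [^] Suc n \<otimes> x = y \<otimes> (y [^] n \<otimes> x)"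
    using car by (metis m_assoc nat_pow_Suc2 nat_pow_closed)
  also have "\<dots> = (y \<otimes> x) \<otimes> c [^] n \<otimes> d [^] ?k \<otimes> e [^] ?l \<otimes> y [^] n"
    using car by (simp add: Suc m_assoc)
  also have "\<dots> = x \<otimes> c \<otimes> (y \<otimes> c [^] n) \<otimes> d [^] ?k \<otimes> e [^] ?l \<otimes> y [^] n"
    using car by (simp add: yx m_assoc)
  also have "\<dots> = x \<otimes> c \<otimes> (c \<otimes> d) [^] n \<otimes> (y \<otimes> d [^] ?k) \<otimes> e [^] ?l \<otimes> y [^] n"
    using car by (simp add: conj[OF yc] m_assoc)
  also have "\<dots> = x \<otimes> c \<otimes> (c \<otimes> d) [^] n \<otimes> (d \<otimes> e) [^] ?k \<otimes> (y \<otimes> e [^] ?l) \<otimes> y [^] n"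
    using car by (simp add: conj[OF yd] m_assoc)
  also have "y \<otimes> e [^] ?l = e [^] ?l \<otimes> y"
    using car ey by (metis commute_pow)
  also have "(c \<otimes> d) [^] n = c [^] n \<otimes> d [^] n"
    using car cd by (metis pow_mult_distrib)
  also have "(d \<otimes> e) [^] ?k = d [^] ?k \<otimes> e [^] ?k"
    using car ed by (metis pow_mult_distrib)
  finally have "y [^] Suc n \<otimes> x =
      x \<otimes> (c \<otimes> c [^] n) \<otimes> (d [^] n \<otimes> d [^] ?k) \<otimes> (e [^] ?k \<otimes> e [^] ?l) \<otimes> (y \<otimes> y [^] n)"
    using car by (simp add: m_assoc)
  then show ?case
    using car by (simp only: ch nat_pow_mult flip: nat_pow_Suc2)
qed (use car in \<open>auto simp: numeral_2_eq_2 numeral_3_eq_3\<close>)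

text \<open>Collected from \<open>(x y)\<^sup>n = x\<^sub>0 x\<^sub>1 \<dots> x\<^bsub>n - 1\<^esub> y\<^sup>n\<close>, where
  \<open>x\<^sub>i = y\<^sup>i x y\<^bsup>-i\<^esup> = x c\<^sup>i d\<^bsup>i choose 2\<^esup>\<close>.\<close>

lemma pow_mult_class3:
  assumes car: "x \<in> carrier G" "y \<in> carrier G" "c \<in> carrier G" "d \<in> carrier G" "e \<in> carrier G"
    and yx: "y \<otimes> x = x \<otimes> c \<otimes> y" and yc: "y \<otimes> c = c \<otimes> d \<otimes> y" and cx: "c \<otimes> x = x \<otimes> c \<otimes> e"
    and d: "d \<otimes> x = x \<otimes> d" "d \<otimes> y = y \<otimes> d" "d \<otimes> c = c \<otimes> d"
    and e: "e \<otimes> x = x \<otimes> e" "e \<otimes> c = c \<otimes> e" "d \<otimes> e = e \<otimes> d"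
  shows "(x \<otimes> y) [^] (n::nat) = x [^] n \<otimes> c [^] (n choose 2) \<otimes> (d \<otimes> e) [^] (n choose 3) \<otimes> y [^] n"
proof (induction n)
  case (Suc n)
  have ch: "Suc n choose 2 = (n choose 2) + n" "Suc n choose 3 = (n choose 3) + (n choose 2)"
    by (simp_all add: numeral_2_eq_2 numeral_3_eq_3)
  let ?k = "n choose 2" and ?l = "n choose 3"
  have de: "(d \<otimes> e) \<otimes> u = u \<otimes> (d \<otimes> e)" if "u = x \<or> u = c" for u
    using that car d e by (metis commute_mult)
  \<comment> \<open>Here \<open>y\<close> fixes \<open>d\<close>, so the preceding formula applies
    with \<open>\<one>\<close> in the place of \<open>e\<close>.\<close>
  have yn: "y [^] n \<otimes> x = x \<otimes> c [^] n \<otimes> d [^] ?k \<otimes> y [^] n"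
  proof -
    have "y \<otimes> d = d \<otimes> \<one> \<otimes> y" "c \<otimes> d = d \<otimes> c" using car d by auto
    then have "y [^] n \<otimes> x = x \<otimes> c [^] n \<otimes> d [^] ?k \<otimes> \<one> [^] ?l \<otimes> y [^] n"
      using car yx yc by (intro conj_pow_class3) auto
    then show ?thesis using car by simp
  qed
  \<comment> \<open>The new \<open>x\<close> travels to the left: crossing \<open>y [^] n\<close> it
    leaves \<open>c [^] n\<close> and \<open>d [^] (n choose 2)\<close>, crossing the powers of
    \<open>c\<close> it leaves \<open>e [^] (n choose 2)\<close>. Pascal's rule adds these to the
    old exponents.\<close>
  have "(x \<otimes> y) [^] Suc n = x [^] n \<otimes> c [^] ?k \<otimes> (d \<otimes> e) [^] ?l \<otimes> (y [^] n \<otimes> x) \<otimes> y"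
    using car by (simp add: Suc m_assoc)
  also have "\<dots> = x [^] n \<otimes> c [^] ?k \<otimes> ((d \<otimes> e) [^] ?l \<otimes> x) \<otimes> c [^] n \<otimes> d [^] ?k \<otimes> y [^] Suc n"
    using car by (simp add: yn m_assoc)
  also have "(d \<otimes> e) [^] ?l \<otimes> x = x \<otimes> (d \<otimes> e) [^] ?l"
    using car de by (metis commute_pow m_closed)
  also have "x [^] n \<otimes> c [^] ?k \<otimes> (x \<otimes> (d \<otimes> e) [^] ?l) \<otimes> c [^] n \<otimes> d [^] ?k \<otimes> y [^] Suc n
    = x [^] n \<otimes> (c [^] ?k \<otimes> x) \<otimes> ((d \<otimes> e) [^] ?l \<otimes> c [^] n) \<otimes> d [^] ?k \<otimes> y [^] Suc n"
    using car by (simp add: m_assoc)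
  also have "c [^] ?k \<otimes> x = x \<otimes> c [^] ?k \<otimes> e [^] ?k"
    using car cx e by (intro pow_mult_conj_class2) auto
  also have "(d \<otimes> e) [^] ?l \<otimes> c [^] n = c [^] n \<otimes> (d \<otimes> e) [^] ?l"
    using car de by (metis commute_pow_pow m_closed)
  also have "x [^] n \<otimes> (x \<otimes> c [^] ?k \<otimes> e [^] ?k) \<otimes> (c [^] n \<otimes> (d \<otimes> e) [^] ?l) \<otimes> d [^] ?k \<otimes> y [^] Suc n
    = x [^] Suc n \<otimes> c [^] ?k \<otimes> (e [^] ?k \<otimes> c [^] n) \<otimes> ((d \<otimes> e) [^] ?l \<otimes> d [^] ?k) \<otimes> y [^] Suc n"
    using car by (simp add: m_assoc)
  also have "e [^] ?k \<otimes> c [^] n = c [^] n \<otimes> e [^] ?k"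
    using car e by (metis commute_pow_pow)
  also have "(d \<otimes> e) [^] ?l \<otimes> d [^] ?k = d [^] ?k \<otimes> (d \<otimes> e) [^] ?l"
  proof -
    have "d \<otimes> (d \<otimes> e) = (d \<otimes> e) \<otimes> d" using car e by (metis m_assoc)
    then show ?thesis using car by (metis commute_pow_pow m_closed)
  qed
  also have "x [^] Suc n \<otimes> c [^] ?k \<otimes> (c [^] n \<otimes> e [^] ?k) \<otimes> (d [^] ?k \<otimes> (d \<otimes> e) [^] ?l) \<otimes> y [^] Suc n
    = x [^] Suc n \<otimes> (c [^] ?k \<otimes> c [^] n) \<otimes> ((e [^] ?k \<otimes> d [^] ?k) \<otimes> (d \<otimes> e) [^] ?l) \<otimes> y [^] Suc n"
    using car by (simp add: m_assoc del: nat_pow_Suc)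
  also have "e [^] ?k \<otimes> d [^] ?k = (d \<otimes> e) [^] ?k"
    using car e by (metis commute_pow_pow pow_mult_distrib)
  finally show ?case
    using car by (simp add: ch nat_pow_mult m_assoc add.commute[of "n choose 3"] del: nat_pow_Suc)
qed (use car in \<open>auto simp: numeral_2_eq_2 numeral_3_eq_3\<close>)

text \<open>The case of the preceding formula in which \<open>d\<close> and \<open>e\<close> are
  trivial.\<close>

lemma pow_mult_class2:
  assumes car: "x \<in> carrier G" "y \<in> carrier G" "c \<in> carrier G"
    and yx: "y \<otimes> x = x \<otimes> y \<otimes> c" and c: "c \<otimes> x = x \<otimes> c" "c \<otimes> y = y \<otimes> c"
  shows "(x \<otimes> y) [^] (n::nat) = x [^] n \<otimes> y [^] n \<otimes> c [^] (n choose 2)"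
proof -
  have "(x \<otimes> y) [^] n = x [^] n \<otimes> c [^] (n choose 2) \<otimes> (\<one> \<otimes> \<one>) [^] (n choose 3) \<otimes> y [^] n"
    using car yx c by (intro pow_mult_class3) (auto simp: m_assoc)
  moreover have "c [^] (n choose 2) \<otimes> y [^] n = y [^] n \<otimes> c [^] (n choose 2)"
    using car c by (metis commute_pow_pow)
  ultimately show ?thesis using car by (simp add: m_assoc)
qed

lemma pow_eq_one_dvd:
  assumes "x \<in> carrier G" "x [^] (m::nat) = \<one>" "m dvd n"
  shows "x [^] n = \<one>"
  using assms by (auto elim!: dvdE simp flip: nat_pow_pow)

end

text \<open>The source of the bound \<open>p \<ge> 5\<close>: for \<open>p = 3\<close> the second
  divisibility fails.\<close>

lemma prime_dvd_choose_two_three: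
  assumes "Factorial_Ring.prime (p::nat)" "p \<ge> 5"
  shows "p dvd p choose 2" "p dvd p choose 3"
  using assms by (auto intro!: dvd_choose_prime)

section \<open>Commutators, cosets and counting in quotient groups\<close>

lemma (in group_hom) hom_commutator:
  "x \<in> carrier G \<Longrightarrow> y \<in> carrier G \<Longrightarrow> h (commutator G x y) = commutator H (h x) (h y)"
  by (simp add: commutator_def)

text \<open>Products of cosets stay abstract instead of unfolding to products of sets, so that the
  group laws of the quotient remain applicable.\<close>

declare mult_FactGroup [simp del] one_FactGroup [simp del]

context normal
begin

lemma Mod_group_hom: "group_hom G (G Mod H) (\<lambda>x. H #> x)"
  by (intro group_hom.intro group_hom_axioms.intro r_coset_hom_Mod factorgroup_is_group is_group)

lemma coset_eq_one_iff: "x \<in> carrier G \<Longrightarrow> H #> x = \<one>\<^bsub>G Mod H\<^esub> \<longleftrightarrow> x \<in> H"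
  unfolding one_FactGroup using coset_join1 coset_join2 subgroup_axioms subset by (metis is_subgroup)

lemma coset_eq_iff:
  assumes "x \<in> carrier G" "y \<in> carrier G"
  shows "H #> x = H #> y \<longleftrightarrow> inv x \<otimes> y \<in> H"
proof -
  interpret h: group_hom G "G Mod H" "\<lambda>x. H #> x" by (rule Mod_group_hom)
  have "inv x \<otimes> y \<in> H \<longleftrightarrow> H #> (inv x \<otimes> y) = \<one>\<^bsub>G Mod H\<^esub>"
    using assms coset_eq_one_iff[of "inv x \<otimes> y"] by simp
  also have "H #> (inv x \<otimes> y) = inv\<^bsub>G Mod H\<^esub> (H #> x) \<otimes>\<^bsub>G Mod H\<^esub> (H #> y)"
    using assms h.hom_mult[of "inv x" y] h.hom_inv[of x] by simp
  also have "\<dots> = \<one>\<^bsub>G Mod H\<^esub> \<longleftrightarrow> H #> x = H #> y"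
    using assms h.H.inv_equality[of "inv\<^bsub>G Mod H\<^esub> (H #> x)" "H #> y"] h.H.l_inv[of "H #> x"]
    by (metis h.H.inv_closed h.H.inv_inv h.H.l_cancel h.hom_closed)
  finally show ?thesis by simp
qed

lemma commutator_mem_iff:
  assumes "x \<in> carrier G" "y \<in> carrier G"
  shows "commutator G x y \<in> H \<longleftrightarrow>
    (H #> x) \<otimes>\<^bsub>G Mod H\<^esub> (H #> y) = (H #> y) \<otimes>\<^bsub>G Mod H\<^esub> (H #> x)"
proof -
  interpret h: group_hom G "G Mod H" "\<lambda>x. H #> x" by (rule Mod_group_hom)
  show ?thesis
    using assms h.hom_commutator[of x y] coset_eq_one_iff[of "commutator G x y"]
      h.H.commutator_eq_one_iff[of "H #> x" "H #> y"] by simp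
qed

lemma card_coset_preimage:
  assumes "finite (carrier G)" "U \<subseteq> carrier (G Mod H)"
  shows "card {x \<in> carrier G. H #> x \<in> U} = card H * card U"
proof -
  have U: "U \<subseteq> rcosets H" using assms by (simp add: FactGroup_def)
  have "{x \<in> carrier G. H #> x \<in> U} = \<Union> U"
  proof safe
    fix x assume "x \<in> carrier G" "H #> x \<in> U"
    then show "x \<in> \<Union> U" using rcos_self is_subgroup by blast
  next
    fix x V assume x: "x \<in> V" "V \<in> U"
    then obtain y where y: "y \<in> carrier G" "V = H #> y" using U by (auto simp: RCOSETS_def)
    then show "x \<in> carrier G" using x by (meson rcosI r_coset_subset_G subset subsetD)
    show "H #> x \<in> U" using x y repr_independence is_subgroup by metis
  qed
  moreover have "card H * card U = card (\<Union> U)"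
  proof (rule card_partition)
    show fin: "finite (\<Union> U)" using U assms rcosets_part_G[OF is_subgroup] by (metis Union_mono finite_subset)
    show "finite U" using fin by (rule finite_UnionD)
    show "card c = card H" if "c \<in> U" for c
      using that U assms card_rcosets_equal[of c H] subset by (metis subsetD)
    show "c1 \<inter> c2 = {}" if "c1 \<in> U" "c2 \<in> U" "c1 \<noteq> c2" for c1 c2
      using that U rcos_disjoint[OF is_subgroup] by (meson pairwiseD disjnt_def subsetD)
  qed
  ultimately show ?thesis by simp
qed

end

section \<open>Orders of subgroups and quotients of finite p-groups\<close>

locale p_group = group G for G (structure) + fixes p :: nat
  assumes prime_p: "Factorial_Ring.prime p" and fin: "finite (carrier G)"
    and order_prime_power: "\<exists>n. order G = p ^ n"
begin

lemma finite_subgroup [simp]: "subgroup H G \<Longrightarrow> finite H"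
  using fin finite_subset subgroup.subset by blast

lemma card_subgroup:
  assumes "subgroup H G"
  shows "\<exists>n. card H = p ^ n"
proof -
  have "card H dvd order G" using lagrange[OF assms] by (metis dvd_triv_right)
  then show ?thesis using order_prime_power prime_p divides_primepow_nat by metis
qed

lemma p_group_subgroup:
  assumes "subgroup H G"
  shows "p_group (G\<lparr>carrier := H\<rparr>) p"
  using assms card_subgroup prime_p fin
  by (intro p_group.intro p_group_axioms.intro)
     (auto simp: order_def subgroup.subgroup_is_group intro: finite_subset subgroup.subset)

lemma p_group_Mod:
  assumes "N \<lhd> G"
  shows "p_group (G Mod N) p"
proof -
  interpret N: normal N G by (fact assms)
  interpret h: group_hom G "G Mod N" "\<lambda>x. N #> x" by (rule N.Mod_group_hom)
  have "order (G Mod N) * card N = order G"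
    using lagrange[OF N.is_subgroup] by (simp add: order_def FactGroup_def)
  then have "order (G Mod N) dvd order G" by (metis dvd_triv_left)
  then have "\<exists>n. order (G Mod N) = p ^ n" using order_prime_power prime_p divides_primepow_nat by metis
  moreover have "finite (carrier (G Mod N))" using fin by (simp add: carrier_FactGroup)
  ultimately show ?thesis using prime_p
    by (intro p_group.intro p_group_axioms.intro h.H.is_group)
qed

lemma card_psubset_subgroup:
  assumes "subgroup H G" "subgroup K G" "H \<subset> K"
  shows "p * card H \<le> card K"
proof -
  obtain a b where ab: "card H = p ^ a" "card K = p ^ b" using assms card_subgroup by meson
  have "card H < card K" using assms by (simp add: psubset_card_mono)
  then have "a < b" using ab prime_p by (metis nat_power_less_imp_less prime_gt_0_nat)
  then have "p ^ Suc a \<le> p ^ b" using prime_ge_1_nat[OF prime_p] by (intro power_increasing) auto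
  then show ?thesis using ab by simp
qed

end

section \<open>Central elements modulo normal subgroups\<close>

context group
begin

lemma commutator_in_normal:
  assumes "N \<lhd> G" "x \<in> carrier G" "y \<in> carrier G" "x \<in> N \<or> y \<in> N"
  shows "commutator G x y \<in> N"
proof -
  interpret N: normal N G by (fact assms)
  show ?thesis
  proof (cases "x \<in> N")
    case True
    then have "x \<otimes> (y \<otimes> inv x \<otimes> inv y) \<in> N"
      using assms N.inv_op_closed2 by blast
    then show ?thesis using assms by (simp add: commutator_def m_assoc)
  next
    case False
    then have "(x \<otimes> y \<otimes> inv x) \<otimes> inv y \<in> N"
      using assms N.inv_op_closed2 by blast
    then show ?thesis using assms by (simp add: commutator_def)
  qed
qed

lemma conj_in_subgroup:
  assumes "subgroup U G" "x \<in> carrier G" "a \<in> U" "commutator G x a \<in> U"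
  shows "x \<otimes> a \<otimes> inv x \<in> U"
proof -
  have a: "a \<in> carrier G" using subgroup.mem_carrier[OF assms(1,3)] .
  have "commutator G x a \<otimes> a \<in> U" using subgroup.m_closed[OF assms(1,4,3)] .
  then show ?thesis using assms(2) a by (simp add: commutator_def m_assoc)
qed

lemma subgroup_pow_closed:
  assumes "subgroup U G" "x \<in> U"
  shows "x [^] (n::nat) \<in> U"
proof -
  interpret U: subgroup U G by (fact assms)
  show ?thesis using assms(2) by (induction n) auto
qed

text \<open>The subgroup generated by \<open>U\<close> and \<open>x\<close>. Since \<open>x\<close>
  normalizes \<open>U\<close> and some positive power of \<open>x\<close> lies in \<open>U\<close>,
  natural exponents suffice, and exponents below \<open>k\<close> already give every
  element.\<close>

lemma adjoin_normalizing:
  assumes U: "subgroup U G" and x: "x \<in> carrier G" "x [^] k \<in> U" "k > (0::nat)"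
    and norm: "\<And>a. a \<in> U \<Longrightarrow> x \<otimes> a \<otimes> inv x \<in> U"
  shows "subgroup {a \<otimes> x [^] (i::nat) |a i. a \<in> U} G" (is "subgroup ?Y G")
    and "finite U \<Longrightarrow> card {a \<otimes> x [^] (i::nat) |a i. a \<in> U} \<le> k * card U"
    and "U \<subseteq> {a \<otimes> x [^] (i::nat) |a i. a \<in> U}"
    and "x \<in> {a \<otimes> x [^] (i::nat) |a i. a \<in> U}"
proof -
  interpret U: subgroup U G by (fact U)
  have normi: "x [^] i \<otimes> a \<otimes> inv (x [^] i) \<in> U" if "a \<in> U" for a and i :: nat
    using that
  proof (induction i arbitrary: a)
    case (Suc i)
    then have "x [^] i \<otimes> (x \<otimes> a \<otimes> inv x) \<otimes> inv (x [^] i) \<in> U" using norm by blast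
    then show ?case using x Suc.prems by (simp add: m_assoc inv_mult_group)
  qed simp
  have move: "x [^] i \<otimes> a = (x [^] i \<otimes> a \<otimes> inv (x [^] i)) \<otimes> x [^] i" if "a \<in> U" for a and i :: nat
    using that x by (simp add: m_assoc)
  show "subgroup ?Y G"
  proof (rule subgroupI)
    show "?Y \<subseteq> carrier G" using x by auto
    show "?Y \<noteq> {}" using U.one_closed by blast
  next
    fix u v assume "u \<in> ?Y" "v \<in> ?Y"
    then obtain a b i j where uv: "a \<in> U" "b \<in> U" "u = a \<otimes> x [^] (i::nat)" "v = b \<otimes> x [^] (j::nat)" by blast
    have "u \<otimes> v = a \<otimes> (x [^] i \<otimes> b) \<otimes> x [^] j" using uv x by (simp add: m_assoc)
    also have "\<dots> = a \<otimes> (x [^] i \<otimes> b \<otimes> inv (x [^] i)) \<otimes> x [^] (i + j)"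
      using uv x by (subst move) (simp_all add: m_assoc flip: nat_pow_mult)
    finally show "u \<otimes> v \<in> ?Y" using uv normi by blast
  next
    fix u assume "u \<in> ?Y"
    then obtain a i where u: "a \<in> U" "u = a \<otimes> x [^] (i::nat)" by blast
    \<comment> \<open>The inverse of \<open>x [^] i\<close> gets the natural exponent
      \<open>(k - 1) * i\<close>, at the cost of the factor \<open>x [^] (k * i)\<close>, which lies
      in \<open>U\<close>.\<close>
    have "x [^] (k * i) = x [^] i \<otimes> x [^] ((k - 1) * i)"
      using x by (simp add: nat_pow_mult algebra_simps)
    then have "inv (x [^] i) = x [^] ((k - 1) * i) \<otimes> inv (x [^] (k * i))"
      using x by (simp add: inv_mult_group flip: m_assoc)
    moreover have w: "x [^] (k * i) \<in> U"
      using x subgroup_pow_closed[OF U] by (metis nat_pow_pow)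
    ultimately have "inv u = x [^] ((k - 1) * i) \<otimes> (inv (x [^] (k * i)) \<otimes> inv a)"
      using u x by (simp add: inv_mult_group m_assoc)
    moreover have v: "inv (x [^] (k * i)) \<otimes> inv a \<in> U" using u w by blast
    ultimately have "inv u = (x [^] ((k - 1) * i) \<otimes> (inv (x [^] (k * i)) \<otimes> inv a) \<otimes> inv (x [^] ((k - 1) * i)))
        \<otimes> x [^] ((k - 1) * i)"
      using move by (metis (no_types, lifting))
    then show "inv u \<in> ?Y" using normi[OF v] by blast
  qed
  show "U \<subseteq> ?Y"
  proof
    fix a assume "a \<in> U"
    then have "a = a \<otimes> x [^] (0::nat)" by simp
    then show "a \<in> ?Y" using \<open>a \<in> U\<close> by blast
  qed
  have "x = \<one> \<otimes> x [^] (1::nat)" using x by simp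
  then show "x \<in> ?Y" using U.one_closed by blast
  assume fin: "finite U"
  have "?Y \<subseteq> (\<lambda>(a, i). a \<otimes> x [^] i) ` (U \<times> {..<k})"
  proof clarify
    fix a and i :: nat assume a: "a \<in> U"
    have "x [^] i = x [^] (k * (i div k)) \<otimes> x [^] (i mod k)" using x by (simp add: nat_pow_mult)
    moreover have "x [^] (k * (i div k)) \<in> U"
      using x subgroup_pow_closed[OF U] by (metis nat_pow_pow)
    ultimately have "a \<otimes> x [^] i = (a \<otimes> x [^] (k * (i div k))) \<otimes> x [^] (i mod k)"
        "a \<otimes> x [^] (k * (i div k)) \<in> U"
      using a x by (auto simp: m_assoc)
    then show "a \<otimes> x [^] i \<in> (\<lambda>(a, i). a \<otimes> x [^] i) ` (U \<times> {..<k})"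
      using x(3) by (intro image_eqI[of _ _ "(a \<otimes> x [^] (k * (i div k)), i mod k)"]) auto
  qed
  then have "card ?Y \<le> card (U \<times> {..<k})"
    by (rule surj_card_le[rotated]) (use fin in auto)
  then show "card ?Y \<le> k * card U" by (simp add: card_cartesian_product mult.commute)
qed

end

context p_group
begin

lemma p_pos [simp]: "p > 0"
  using prime_p by (simp add: prime_gt_0_nat)

lemma dvd_card_subgroup:
  assumes "subgroup K G" "K \<noteq> {\<one>}"
  shows "p dvd card K"
proof -
  have "{\<one>} \<subset> K" using assms subgroup.one_closed by blast
  then have "card {\<one>} < card K" using assms finite_subgroup by (intro psubset_card_mono)
  moreover obtain n where "card K = p ^ n" using assms card_subgroup by blast
  ultimately show ?thesis by (cases n) auto
qed

text \<open>The class equation on \<open>K\<close>: conjugacy classes have \<open>p\<close>-power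
  order, so if \<open>\<one>\<close> were the only singleton class, \<open>p\<close> would divide
  both \<open>card K\<close> and \<open>card K - 1\<close>.\<close>

lemma normal_meets_center:
  assumes K: "K \<lhd> G" "K \<noteq> {\<one>}"
  obtains z where "z \<in> K" "z \<noteq> \<one>" "z [^] p = \<one>" "\<And>g. g \<in> carrier G \<Longrightarrow> g \<otimes> z = z \<otimes> g"
proof -
  interpret K: normal K G by (fact K)
  define cl where "cl = (\<lambda>x. (\<lambda>g. g \<otimes> x \<otimes> inv g) ` carrier G)"
  have finK: "finite K" using finite_subgroup K.is_subgroup by blast
  have sub: "cl x \<subseteq> K" if "x \<in> K" for x using that K.inv_op_closed2 by (auto simp: cl_def)
  have refl: "x \<in> cl x" if "x \<in> K" for x
    using that unfolding cl_def by (intro image_eqI[of _ _ \<one>]) auto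
  have eq: "cl y = cl x" if "x \<in> K" "y \<in> cl x" for x y
  proof -
    obtain h where h: "h \<in> carrier G" "y = h \<otimes> x \<otimes> inv h" using \<open>y \<in> cl x\<close> unfolding cl_def by (rule imageE)
    have x: "x \<in> carrier G" using that by simp
    have "g \<otimes> y \<otimes> inv g = (g \<otimes> h) \<otimes> x \<otimes> inv (g \<otimes> h)" if "g \<in> carrier G" for g
      using that h x by (simp add: m_assoc inv_mult_group)
    then have 1: "cl y \<subseteq> cl x" using h by (auto simp: cl_def)
    have "g \<otimes> x \<otimes> inv g = (g \<otimes> inv h) \<otimes> y \<otimes> inv (g \<otimes> inv h)" if "g \<in> carrier G" for g
      using that h x by (simp add: m_assoc inv_mult_group)
    moreover have "g \<otimes> inv h \<in> carrier G" if "g \<in> carrier G" for g using that h by simp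
    ultimately have "cl x \<subseteq> cl y" unfolding cl_def by (metis (no_types, lifting) image_eqI image_subsetI)
    with 1 show ?thesis by blast
  qed
  have dvd: "p dvd card (cl x)" if "x \<in> K" "card (cl x) \<noteq> 1" for x
  proof -
    interpret act: group_action G "carrier G" "\<lambda>g. (\<lambda>h \<in> carrier G. g \<otimes> h \<otimes> (inv g))"
      by (rule action_by_conjugation)
    have x: "x \<in> carrier G" using that by simp
    have "orbit G (\<lambda>g. (\<lambda>h \<in> carrier G. g \<otimes> h \<otimes> (inv g))) x = cl x"
      unfolding orbit_def restrict_apply'[OF x] cl_def by blast
    then have "order G = card (cl x) * card (stabilizer G (\<lambda>g. (\<lambda>h \<in> carrier G. g \<otimes> h \<otimes> (inv g))) x)"
      using act.orbit_stabilizer_theorem[OF x] by simp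
    then have "card (cl x) dvd order G" by (rule dvdI)
    moreover obtain n where "order G = p ^ n" using order_prime_power by blast
    ultimately obtain k where k: "card (cl x) = p ^ k"
      using divides_primepow_nat[OF prime_p] by auto
    have "k \<noteq> 0" using that(2) unfolding k by (intro notI) simp
    then show ?thesis unfolding k by simp
  qed
  have "\<exists>z\<in>K. z \<noteq> \<one> \<and> card (cl z) = 1"
  proof (rule ccontr)
    assume "\<not> ?thesis"
    then have neq: "card (cl z) \<noteq> 1" if "z \<in> K" "z \<noteq> \<one>" for z using that by blast
    let ?K = "K - {\<one>}"
    have one: "\<one> \<notin> cl z" if "z \<in> ?K" for z
    proof
      assume "\<one> \<in> cl z"
      then have "cl z = cl \<one>" using eq that by blast
      moreover have "cl \<one> = {\<one>}" by (auto simp: cl_def)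
      ultimately show False using refl that by blast
    qed
    have "\<Union> (cl ` ?K) = ?K" using sub refl one by blast
    moreover have "p dvd card (\<Union> (cl ` ?K))"
    proof (rule dvd_partition)
      show "finite (\<Union> (cl ` ?K))" using finK calculation by simp
      show "\<forall>c\<in>cl ` ?K. p dvd card c" using dvd neq by blast
      show "\<forall>c1\<in>cl ` ?K. \<forall>c2\<in>cl ` ?K. c1 \<noteq> c2 \<longrightarrow> c1 \<inter> c2 = {}" using eq by blast
    qed
    ultimately have "p dvd card K - 1"
      using finK K.one_closed by (simp add: card_Diff_singleton)
    moreover have "p dvd card K" using dvd_card_subgroup K K.is_subgroup by blast
    moreover have "card K \<ge> 1" using finK K.one_closed by (metis card_0_eq empty_iff less_one not_le)
    ultimately have "p dvd 1" by (metis dvd_diffD1)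
    then show False using prime_p by (simp add: prime_nat_iff)
  qed
  then obtain y where y: "y \<in> K" "y \<noteq> \<one>" "card (cl y) = 1" by blast
  have ycar: "y \<in> carrier G" using y by simp
  have "cl y = {y}" using y refl by (metis card_1_singletonE singletonD)
  then have "g \<otimes> y \<otimes> inv g = y" if "g \<in> carrier G" for g using that unfolding cl_def by blast
  then have cent: "g \<otimes> y = y \<otimes> g" if "g \<in> carrier G" for g
    using that ycar by (metis inv_solve_right m_closed)
  \<comment> \<open>The last nontrivial member of the sequence \<open>y\<close>,
    \<open>y [^] p\<close>, \<open>y [^] (p ^ 2)\<close>, ... has trivial \<open>p\<close>-th power
    and is still central.\<close>
  define k where "k = (LEAST k. y [^] (p ^ k) = \<one>)"
  have ex: "\<exists>k. y [^] (p ^ k) = \<one>"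
    using order_prime_power pow_order_eq_1[OF ycar] by metis
  then have k: "y [^] (p ^ k) = \<one>" unfolding k_def by (rule LeastI_ex)
  have "k \<noteq> 0" using k y ycar by (intro notI) simp
  then obtain j where j: "k = Suc j" by (cases k) auto
  show thesis
  proof (rule that[of "y [^] (p ^ j)"])
    show "y [^] (p ^ j) \<in> K" using y subgroup_pow_closed K.is_subgroup by blast
    show "y [^] (p ^ j) \<noteq> \<one>" using j not_less_Least[of j "\<lambda>k. y [^] (p ^ k) = \<one>"] k_def by auto
    show "(y [^] (p ^ j)) [^] p = \<one>" using k j ycar by (simp add: nat_pow_pow mult.commute)
    show "g \<otimes> y [^] (p ^ j) = y [^] (p ^ j) \<otimes> g" if "g \<in> carrier G" for g
      using that ycar cent by (metis commute_pow)
  qed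
qed

text \<open>A central element of order \<open>p\<close> in the image of \<open>A\<close> in
  \<open>G Mod N\<close>, lifted to \<open>G\<close>. Centrality is kept as membership of
  commutators in \<open>N\<close>, which needs no quotient to state.\<close>

lemma central_mod_normal:
  assumes "N \<lhd> G" "A \<lhd> G" "\<not> A \<subseteq> N"
  obtains z where "z \<in> A" "z \<notin> N" "z [^] p \<in> N" "\<And>g. g \<in> carrier G \<Longrightarrow> commutator G z g \<in> N"
proof -
  interpret N: normal N G by (fact assms)
  interpret A: normal A G by (fact assms)
  interpret h: group_hom G "G Mod N" "\<lambda>x. N #> x" by (rule N.Mod_group_hom)
  interpret Q: p_group "G Mod N" p by (rule p_group_Mod[OF assms(1)])
  have surj: "(\<lambda>x. N #> x) ` carrier G = carrier (G Mod N)" by (simp add: carrier_FactGroup)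
  have "(\<lambda>x. N #> x) ` A \<lhd> G Mod N"
    by (rule A.surj_hom_normal_subgroup[OF h.group_hom_axioms surj])
  moreover have "(\<lambda>x. N #> x) ` A \<noteq> {\<one>\<^bsub>G Mod N\<^esub>}"
    using assms(3) N.coset_eq_one_iff A.mem_carrier by (metis image_eqI singletonD subsetI)
  ultimately obtain w where w: "w \<in> (\<lambda>x. N #> x) ` A" "w \<noteq> \<one>\<^bsub>G Mod N\<^esub>" "w [^]\<^bsub>G Mod N\<^esub> p = \<one>\<^bsub>G Mod N\<^esub>"
    "\<And>g. g \<in> carrier (G Mod N) \<Longrightarrow> g \<otimes>\<^bsub>G Mod N\<^esub> w = w \<otimes>\<^bsub>G Mod N\<^esub> g"
    using Q.normal_meets_center by metis
  then obtain z where z: "z \<in> A" "w = N #> z" by blast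
  have zc: "z \<in> carrier G" using z by simp
  show thesis
  proof (rule that[OF z(1)])
    show "z \<notin> N" using w z zc N.coset_eq_one_iff by auto
    have "N #> (z [^] p) = \<one>\<^bsub>G Mod N\<^esub>" using w z zc h.hom_nat_pow[of z p] by simp
    then show "z [^] p \<in> N" using zc N.coset_eq_one_iff by simp
    fix g assume g: "g \<in> carrier G"
    show "commutator G z g \<in> N" using w(4)[of "N #> g"] z zc g N.commutator_mem_iff by simp
  qed
qed

text \<open>Normality comes from \<open>g z g\<^sup>-1 = [z, g]\<^sup>-1 z\<close>, whose first
  factor lies in \<open>N\<close>.\<close>

lemma adjoin_central_normal:
  assumes N: "N \<lhd> G" and z: "z \<in> carrier G" "z [^] p \<in> N" "\<And>g. g \<in> carrier G \<Longrightarrow> commutator G z g \<in> N"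
  shows "{a \<otimes> z [^] (i::nat) |a i. a \<in> N} \<lhd> G" (is "?Y \<lhd> G")
proof -
  interpret N: normal N G by (fact N)
  have norm: "z \<otimes> a \<otimes> inv z \<in> N" if "a \<in> N" for a using that z N.inv_op_closed2 by simp
  note Y = adjoin_normalizing[OF N.is_subgroup z(1,2) p_pos norm]
  show ?thesis
  proof (rule normal_invI[OF Y(1)])
    fix g u assume g: "g \<in> carrier G" and "u \<in> ?Y"
    then obtain a i where u: "a \<in> N" "u = a \<otimes> z [^] (i::nat)" by blast
    have "inv (commutator G z g) \<in> N" using z g by simp
    then have "inv (commutator G z g) \<otimes> z [^] (1::nat) \<in> ?Y" by blast
    then have "g \<otimes> z \<otimes> inv g \<in> ?Y"
      using g z by (simp add: inv_commutator) (simp add: commutator_def m_assoc)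
    then have "g \<otimes> z [^] i \<otimes> inv g \<in> ?Y" unfolding conj_pow[OF z(1) g, symmetric] using subgroup_pow_closed[OF Y(1)] by blast
    moreover have "g \<otimes> a \<otimes> inv g \<in> ?Y" using Y(3) u g N.inv_op_closed2 by blast
    ultimately have "(g \<otimes> a \<otimes> inv g) \<otimes> (g \<otimes> z [^] i \<otimes> inv g) \<in> ?Y"
      using subgroup.m_closed[OF Y(1)] by blast
    moreover have "(g \<otimes> a \<otimes> inv g) \<otimes> (g \<otimes> z [^] i \<otimes> inv g) = g \<otimes> u \<otimes> inv g"
      using g z u by (simp add: m_assoc)
    ultimately show "g \<otimes> u \<otimes> inv g \<in> ?Y" by simp
  qed
qed

lemma obtain_maximal_card:
  assumes "P U" "\<And>U. P U \<Longrightarrow> U \<subseteq> carrier G"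
  obtains M where "P M" "\<And>U. P U \<Longrightarrow> M \<subseteq> U \<Longrightarrow> U = M"
proof -
  have "{U. P U} \<subseteq> Pow (carrier G)" using assms(2) by blast
  then have "finite {U. P U}" using fin finite_subset by (metis finite_Pow_iff)
  moreover have "{U. P U} \<noteq> {}" using assms(1) by blast
  ultimately obtain M where "M \<in> {U. P U}" "\<forall>U\<in>{U. P U}. M \<subseteq> U \<longrightarrow> M = U"
    using finite_has_maximal by meson
  then show thesis using that by blast
qed

text \<open>Modulo a normal subgroup maximal with respect to not containing \<open>A\<close>, the subgroup \<open>A\<close> becomes
  central of order \<open>p\<close>.\<close>

lemma obtain_normal_avoiding:
  assumes A: "A \<lhd> G" and B: "B \<lhd> G" and AB: "\<not> A \<subseteq> B"
  obtains N z where "N \<lhd> G" "B \<subseteq> N" "\<not> A \<subseteq> N" "z \<in> A" "z \<notin> N" "z [^] p \<in> N"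
    "\<And>a g. a \<in> A \<Longrightarrow> g \<in> carrier G \<Longrightarrow> commutator G a g \<in> N"
    "\<And>a. a \<in> A \<Longrightarrow> \<exists>n\<in>N. \<exists>i::nat. a = n \<otimes> z [^] i"
proof -
  obtain N where N: "N \<lhd> G \<and> B \<subseteq> N \<and> \<not> A \<subseteq> N"
    "\<And>U. U \<lhd> G \<and> B \<subseteq> U \<and> \<not> A \<subseteq> U \<Longrightarrow> N \<subseteq> U \<Longrightarrow> U = N"
  proof (rule obtain_maximal_card[of "\<lambda>U. U \<lhd> G \<and> B \<subseteq> U \<and> \<not> A \<subseteq> U" B])
    show "B \<lhd> G \<and> B \<subseteq> B \<and> \<not> A \<subseteq> B" using B AB by simp
    show "U \<subseteq> carrier G" if "U \<lhd> G \<and> B \<subseteq> U \<and> \<not> A \<subseteq> U" for U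
      using that normal_imp_subgroup subgroup.subset by metis
  qed blast
  interpret N: normal N G using N by blast
  interpret A: normal A G by (fact A)
  obtain z where z: "z \<in> A" "z \<notin> N" "z [^] p \<in> N" "\<And>g. g \<in> carrier G \<Longrightarrow> commutator G z g \<in> N"
    using central_mod_normal[OF _ A] N by metis
  let ?Y = "{a \<otimes> z [^] (i::nat) |a i. a \<in> N}"
  have norm: "z \<otimes> a \<otimes> inv z \<in> N" if "a \<in> N" for a using that z N.inv_op_closed2 by simp
  have zc: "z \<in> carrier G" using z by simp
  note Y = adjoin_normalizing[OF N.is_subgroup zc z(3) p_pos norm]
  \<comment> \<open>The normal subgroup generated by \<open>N\<close> and \<open>z\<close> is
    strictly larger than \<open>N\<close>, so by maximality it contains \<open>A\<close>: modulo
    \<open>N\<close>, all of \<open>A\<close> consists of powers of the central element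
    \<open>z\<close>.\<close>
  have "?Y \<lhd> G" by (rule adjoin_central_normal[OF N.normal_axioms zc z(3,4)])
  moreover have "?Y \<noteq> N" using Y(4) z(2) by metis
  ultimately have AY: "A \<subseteq> ?Y" using N(2)[OF _ Y(3)] N(1) Y(3) by (meson order_trans)
  show thesis
  proof (rule that[of N z])
    fix a g assume ag: "a \<in> A" "g \<in> carrier G"
    then obtain n i where n: "n \<in> N" "a = n \<otimes> z [^] (i::nat)" using AY by blast
    interpret h: group_hom G "G Mod N" "\<lambda>x. N #> x" by (rule N.Mod_group_hom)
    have cen: "(N #> z) \<otimes>\<^bsub>G Mod N\<^esub> (N #> g) = (N #> g) \<otimes>\<^bsub>G Mod N\<^esub> (N #> z)"
      using N.commutator_mem_iff zc ag z(4) by blast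
    have "N #> a = (N #> z) [^]\<^bsub>G Mod N\<^esub> i"
      using n zc N.coset_eq_one_iff h.hom_mult[of n "z [^] i"] h.hom_nat_pow[of z i] h.H.l_one
      by (metis N.mem_carrier h.hom_closed nat_pow_closed)
    then have "(N #> a) \<otimes>\<^bsub>G Mod N\<^esub> (N #> g) = (N #> g) \<otimes>\<^bsub>G Mod N\<^esub> (N #> a)"
      using cen zc ag h.H.commute_pow by (metis h.hom_closed)
    then show "commutator G a g \<in> N" using N.commutator_mem_iff ag by simp
  next
    show "\<exists>n\<in>N. \<exists>i::nat. a = n \<otimes> z [^] i" if "a \<in> A" for a using that AY by blast
  qed (use N(1) z(1-3) in simp_all)
qed

end

section \<open>The Frattini subgroup\<close>

context p_group
begin

text \<open>The description of the Frattini subgroup of a finite \<open>p\<close>-group as the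
  product of \<open>G\<^sup>p\<close> and \<open>G'\<close>. These generators are directly
  comparable with \<open>power_gamma3\<close> and the power subgroup; the link with maximal
  subgroups is \<open>frattini_subset_maximal\<close>.\<close>

definition frattini :: "'a set" where
  "frattini = generate G ({x [^] p |x. x \<in> carrier G} \<union>
     {commutator G x y |x y. x \<in> carrier G \<and> y \<in> carrier G})"

lemma subgroup_frattini: "subgroup frattini G"
  unfolding frattini_def by (rule generate_is_subgroup) auto

lemma pow_p_in_frattini: "x \<in> carrier G \<Longrightarrow> x [^] p \<in> frattini"
  unfolding frattini_def by (rule generate.incl) blast

lemma commutator_in_frattini: "x \<in> carrier G \<Longrightarrow> y \<in> carrier G \<Longrightarrow> commutator G x y \<in> frattini"
  unfolding frattini_def by (rule generate.incl) blast

text \<open>Let \<open>N\<close> be maximal among the normal subgroups of \<open>G\<close> inside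
  \<open>M\<close>, and \<open>z\<close> central of order \<open>p\<close> modulo \<open>N\<close>.
  Then \<open>z \<notin> M\<close> by the choice of \<open>N\<close>, yet \<open>z\<close>
  normalizes \<open>M\<close>, so \<open>M\<close> and \<open>z\<close> generate \<open>G\<close>.
  Hence \<open>M\<close> is normal with a quotient generated by the image of \<open>z\<close>, whose
  \<open>p\<close>-th power is trivial.\<close>

lemma frattini_subset_maximal:
  assumes M: "subgroup M G" "M \<noteq> carrier G"
    and max: "\<And>H. subgroup H G \<Longrightarrow> M \<subseteq> H \<Longrightarrow> H = M \<or> H = carrier G"
  shows "frattini \<subseteq> M"
proof -
  interpret M: subgroup M G by (fact M)
  obtain N where N: "N \<lhd> G \<and> N \<subseteq> M" "\<And>U. U \<lhd> G \<and> U \<subseteq> M \<Longrightarrow> N \<subseteq> U \<Longrightarrow> U = N"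
  proof (rule obtain_maximal_card[of "\<lambda>U. U \<lhd> G \<and> U \<subseteq> M" "{\<one>}"])
    show "{\<one>} \<lhd> G \<and> {\<one>} \<subseteq> M" using one_is_normal by simp
    show "U \<subseteq> carrier G" if "U \<lhd> G \<and> U \<subseteq> M" for U using that M.subset by blast
  qed blast
  interpret N: normal N G using N by blast
  have "\<not> carrier G \<subseteq> N" using N(1) M M.subset by blast
  then obtain z where z: "z \<in> carrier G" "z \<notin> N" "z [^] p \<in> N"
      "\<And>g. g \<in> carrier G \<Longrightarrow> commutator G z g \<in> N"
    using central_mod_normal[OF N.normal_axioms normal_self] by metis
  have norm: "z \<otimes> a \<otimes> inv z \<in> N" if "a \<in> N" for a using that z(1) N.inv_op_closed2 by simp
  note Y = adjoin_normalizing[OF N.is_subgroup z(1,3) p_pos norm]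
  have "z \<notin> M"
  proof
    assume "z \<in> M"
    then have "{a \<otimes> z [^] (i::nat) |a i. a \<in> N} \<subseteq> M"
      using N(1) subgroup_pow_closed[OF M(1)] by auto
    with adjoin_central_normal[OF N.normal_axioms z(1,3,4)]
    have "{a \<otimes> z [^] (i::nat) |a i. a \<in> N} = N"
      by (intro N(2)[OF conjI Y(3)])
    then show False using Y(4) z(2) by simp
  qed
  have zp: "z [^] p \<in> M" using z(3) N(1) by (meson subsetD)
  have normM: "z \<otimes> a \<otimes> inv z \<in> M" if "a \<in> M" for a
  proof -
    have "commutator G z a \<in> N" using z(4) M.mem_carrier[OF that] by blast
    then have "commutator G z a \<in> M" using N(1) by blast
    then show ?thesis by (rule conj_in_subgroup[OF M(1) z(1) that])
  qed
  note W = adjoin_normalizing[OF M(1) z(1) zp p_pos normM]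
  have carG: "carrier G = {a \<otimes> z [^] (i::nat) |a i. a \<in> M}"
    using max[OF W(1,3)] W(4) \<open>z \<notin> M\<close> by auto
  have "M \<lhd> G"
  proof (rule normal_invI[OF M(1)])
    have zi: "z [^] i \<otimes> h \<otimes> inv (z [^] i) \<in> M" if "h \<in> M" for h and i :: nat
      using that
    proof (induction i arbitrary: h)
      case (Suc i)
      then have "z [^] i \<otimes> (z \<otimes> h \<otimes> inv z) \<otimes> inv (z [^] i) \<in> M" using normM by blast
      then show ?case using z(1) Suc.prems by (simp add: m_assoc inv_mult_group)
    qed simp
    fix x h assume "x \<in> carrier G" and h: "h \<in> M"
    then obtain a i where a: "a \<in> M" "x = a \<otimes> z [^] (i::nat)" unfolding carG by blast
    have "a \<otimes> (z [^] i \<otimes> h \<otimes> inv (z [^] i)) \<otimes> inv a \<in> M" using a h zi by blast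
    then show "x \<otimes> h \<otimes> inv x \<in> M" using a z(1) h by (simp add: m_assoc inv_mult_group)
  qed
  then interpret M: normal M G .
  interpret h: group_hom G "G Mod M" "\<lambda>x. M #> x" by (rule M.Mod_group_hom)
  have pw: "\<exists>i::nat. M #> x = (M #> z) [^]\<^bsub>G Mod M\<^esub> i" if x: "x \<in> carrier G" for x
  proof -
    obtain a i where a: "a \<in> M" "x = a \<otimes> z [^] (i::nat)" using x unfolding carG by blast
    then have "M #> x = (M #> a) \<otimes>\<^bsub>G Mod M\<^esub> (M #> z) [^]\<^bsub>G Mod M\<^esub> i"
      using z(1) by (simp add: h.hom_nat_pow)
    also have "M #> a = \<one>\<^bsub>G Mod M\<^esub>" using a M.coset_eq_one_iff by simp
    finally show ?thesis using z(1) by auto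
  qed
  have zz: "(M #> z) \<in> carrier (G Mod M)" using z(1) by simp
  show ?thesis unfolding frattini_def
  proof (rule generate_subgroup_incl[OF _ M(1)], safe)
    fix x assume x: "x \<in> carrier G"
    then obtain i :: nat where i: "M #> x = (M #> z) [^]\<^bsub>G Mod M\<^esub> i" using pw by blast
    have "M #> (z [^] p) = \<one>\<^bsub>G Mod M\<^esub>" using zp z(1) M.coset_eq_one_iff by simp
    then have "(M #> z) [^]\<^bsub>G Mod M\<^esub> p = \<one>\<^bsub>G Mod M\<^esub>" using z(1) by (simp add: h.hom_nat_pow)
    then have "M #> (x [^] p) = \<one>\<^bsub>G Mod M\<^esub>"
      using x i zz by (simp add: h.hom_nat_pow h.H.nat_pow_pow h.H.pow_eq_one_dvd)
    then show "x [^] p \<in> M" using x M.coset_eq_one_iff by simp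
  next
    fix x y assume xy: "x \<in> carrier G" "y \<in> carrier G"
    obtain i j :: nat where "M #> x = (M #> z) [^]\<^bsub>G Mod M\<^esub> i" "M #> y = (M #> z) [^]\<^bsub>G Mod M\<^esub> j"
      using pw xy by metis
    then show "commutator G x y \<in> M"
      using xy zz M.commutator_mem_iff by (simp add: h.H.nat_pow_mult add.commute)
  qed
qed

lemma generate_frattini_nongenerator:
  assumes S: "S \<subseteq> carrier G" and gen: "generate G (S \<union> frattini) = carrier G"
  shows "generate G S = carrier G"
proof (rule ccontr)
  assume ne: "generate G S \<noteq> carrier G"
  obtain M where M: "subgroup M G \<and> M \<noteq> carrier G \<and> generate G S \<subseteq> M"
    "\<And>U. subgroup U G \<and> U \<noteq> carrier G \<and> generate G S \<subseteq> U \<Longrightarrow> M \<subseteq> U \<Longrightarrow> U = M"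
  proof (rule obtain_maximal_card[of "\<lambda>U. subgroup U G \<and> U \<noteq> carrier G \<and> generate G S \<subseteq> U" "generate G S"])
    show "subgroup (generate G S) G \<and> generate G S \<noteq> carrier G \<and> generate G S \<subseteq> generate G S"
      using ne generate_is_subgroup[OF S] by simp
    show "U \<subseteq> carrier G" if "subgroup U G \<and> U \<noteq> carrier G \<and> generate G S \<subseteq> U" for U
      using that subgroup.subset by metis
  qed blast
  have "frattini \<subseteq> M"
    using M by (intro frattini_subset_maximal) (blast, blast, meson order_trans)
  moreover have "S \<subseteq> M" using M(1) generate.incl by (metis subsetI subsetD)
  ultimately have "generate G (S \<union> frattini) \<subseteq> M"
    using M(1) by (intro generate_subgroup_incl) auto
  then show False using gen M(1) subgroup.subset by blast
qed

lemma conj_in_supergroup_frattini: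
  assumes "subgroup H G" "frattini \<subseteq> H" "x \<in> carrier G" "a \<in> H"
  shows "x \<otimes> a \<otimes> inv x \<in> H"
  using assms commutator_in_frattini subgroup.mem_carrier[OF assms(1)]
  by (intro conj_in_subgroup) auto

text \<open>Each generator raises the order at most by the factor \<open>p\<close>:
  \<open>frattini\<close> contains its \<open>p\<close>-th power, and every subgroup above
  \<open>frattini\<close> is normalized by it.\<close>

lemma card_generate_frattini_le:
  assumes "finite S" "S \<subseteq> carrier G"
  shows "card (generate G (S \<union> frattini)) \<le> p ^ card S * card frattini"
  using assms
proof (induction S)
  case empty
  have "generate G frattini \<subseteq> frattini" using generate_subgroup_incl subgroup_frattini by simp
  then show ?case using subgroup_frattini by (simp add: card_mono)
next
  case (insert x S)
  let ?H = "generate G (S \<union> frattini)"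
  have car: "S \<union> frattini \<subseteq> carrier G" "x \<in> carrier G"
    using insert.prems subgroup.subset[OF subgroup_frattini] by auto
  have H: "subgroup ?H G" using generate_is_subgroup[OF car(1)] .
  have fH: "frattini \<subseteq> ?H" "S \<subseteq> ?H" using generate.incl[of _ "S \<union> frattini" G] by auto
  have "x [^] p \<in> ?H" using fH pow_p_in_frattini car by blast
  note Y = adjoin_normalizing[OF H car(2) this p_pos conj_in_supergroup_frattini[OF H fH(1) car(2)]]
  let ?Y = "{a \<otimes> x [^] (i::nat) |a i. a \<in> ?H}"
  have "insert x S \<union> frattini \<subseteq> ?Y" using Y(3,4) fH by (meson Un_least insert_subset order_trans)
  then have "generate G (insert x S \<union> frattini) \<subseteq> ?Y" using Y(1) by (rule generate_subgroup_incl)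
  then have "card (generate G (insert x S \<union> frattini)) \<le> p * card ?H"
    using Y(2) H finite_subgroup[OF Y(1)] card_mono le_trans finite_subgroup by meson
  also have "\<dots> \<le> p * (p ^ card S * card frattini)" using insert by simp
  finally show ?case using insert by simp
qed

lemma obtain_generators:
  obtains S where "finite S" "S \<subseteq> carrier G" "generate G S = carrier G"
    "p ^ card S * card frattini \<le> order G"
proof -
  let ?P = "\<lambda>U. \<exists>S. finite S \<and> S \<subseteq> carrier G \<and> U = generate G (S \<union> frattini) \<and> p ^ card S * card frattini \<le> card U"
  have fc: "frattini \<subseteq> carrier G" using subgroup.subset[OF subgroup_frattini] .
  have "card frattini \<le> card (generate G frattini)"
    using finite_subgroup[OF generate_is_subgroup[OF fc]] by (intro card_mono) (auto intro: generate.incl)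
  then have "?P (generate G ({} \<union> frattini))" by (intro exI[of _ "{}"]) simp
  then obtain M where M: "?P M" "\<And>U. ?P U \<Longrightarrow> M \<subseteq> U \<Longrightarrow> U = M"
  proof (rule obtain_maximal_card[of ?P])
    fix U assume "?P U"
    then show "U \<subseteq> carrier G" using fc generate_incl by (metis Un_least)
  qed blast
  obtain S where S: "finite S" "S \<subseteq> carrier G" "M = generate G (S \<union> frattini)" "p ^ card S * card frattini \<le> card M"
    using M(1) by blast
  have Msub: "subgroup M G" unfolding S(3) by (rule generate_is_subgroup) (use S(2) fc in blast)
  have "M = carrier G"
  proof (rule ccontr)
    assume "M \<noteq> carrier G"
    then obtain x where x: "x \<in> carrier G" "x \<notin> M" using subgroup.subset[OF Msub] by blast
    let ?U = "generate G (insert x S \<union> frattini)"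
    have U: "subgroup ?U G" by (rule generate_is_subgroup) (use x S(2) fc in blast)
    have sub: "M \<subseteq> ?U" unfolding S(3) by (rule mono_generate) blast
    have "x \<in> ?U" by (rule generate.incl) blast
    then have "M \<subset> ?U" using sub x(2) by blast
    then have "p * card M \<le> card ?U" using card_psubset_subgroup[OF Msub U] by blast
    moreover have "x \<notin> S" using x(2) unfolding S(3) by (meson UnI1 generate.incl)
    then have "card (insert x S) = Suc (card S)" using S(1) by simp
    moreover have "p * (p ^ card S * card frattini) \<le> p * card M" using S(4) by simp
    ultimately have "p ^ card (insert x S) * card frattini \<le> card ?U"
      by (metis le_trans mult.assoc power_Suc)
    moreover have "finite (insert x S)" "insert x S \<subseteq> carrier G" using S x by auto
    ultimately have "?P ?U" by blast
    then show False using M(2) sub \<open>M \<subset> ?U\<close> by blast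
  qed
  moreover have "generate G S = carrier G"
    using generate_frattini_nongenerator[OF S(2)] S(3) calculation by argo
  ultimately show thesis using that S by (simp add: order_def)
qed

text \<open>A generating set of least size bounds \<open>order G\<close> from above by
  \<open>card_generate_frattini_le\<close>; the set from \<open>obtain_generators\<close>, which is
  no smaller, bounds it from below.\<close>

theorem burnside_basis: "p ^ min_generators G * card frattini = order G"
proof -
  let ?Q = "\<lambda>n. \<exists>S\<subseteq>carrier G. finite S \<and> card S = n \<and> generate G S = carrier G"
  obtain S where S: "finite S" "S \<subseteq> carrier G" "generate G S = carrier G"
    "p ^ card S * card frattini \<le> order G"
    by (rule obtain_generators)
  then have Q: "?Q (card S)" by blast
  have "?Q (min_generators G)" unfolding min_generators_def by (rule LeastI[of ?Q, OF Q])
  then obtain T where T: "T \<subseteq> carrier G" "finite T" "card T = min_generators G" "generate G T = carrier G"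
    by blast
  have "carrier G \<subseteq> generate G (T \<union> frattini)" using T(4) mono_generate[of T "T \<union> frattini"] by blast
  moreover have "subgroup (generate G (T \<union> frattini)) G"
    using T(1) subgroup.subset[OF subgroup_frattini] by (intro generate_is_subgroup) blast
  ultimately have "order G \<le> card (generate G (T \<union> frattini))"
    unfolding order_def using finite_subgroup card_mono by blast
  also have "\<dots> \<le> p ^ min_generators G * card frattini"
    using card_generate_frattini_le[OF T(2,1)] T(3) by simp
  finally have 1: "order G \<le> p ^ min_generators G * card frattini" .
  have "min_generators G \<le> card S" unfolding min_generators_def by (rule Least_le) (rule Q)
  then have "p ^ min_generators G * card frattini \<le> p ^ card S * card frattini"
    using prime_ge_1_nat[OF prime_p] by (simp add: power_increasing)
  with 1 S(4) show ?thesis by (meson le_antisym le_trans)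
qed

end

section \<open>The subgroup generated by powers and triple commutators\<close>

lemma card_le_fibres:
  assumes "finite A" "finite B" "f ` A \<subseteq> B" "\<And>b. b \<in> B \<Longrightarrow> card {a \<in> A. f a = b} \<le> k"
  shows "card A \<le> k * card B"
proof -
  have "A = (\<Union>b\<in>B. {a \<in> A. f a = b})" using assms(3) by auto
  then have "card A \<le> (\<Sum>b\<in>B. card {a \<in> A. f a = b})" using card_UN_le[OF assms(2)] by metis
  also have "\<dots> \<le> of_nat (card B) * k" using assms(4) by (intro sum_bounded_above) auto
  finally show ?thesis by (simp add: mult.commute)
qed

text \<open>For a subgroup \<open>H\<close> this is \<open>H\<^sup>p \<gamma>\<^sub>3(H)\<close>.\<close>

definition power_gamma3 :: "nat \<Rightarrow> ('a, 'b) monoid_scheme \<Rightarrow> 'a set \<Rightarrow> 'a set" where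
  "power_gamma3 p G H = generate G ({x [^]\<^bsub>G\<^esub> p |x. x \<in> H} \<union>
     {commutator G (commutator G x y) z |x y z. x \<in> H \<and> y \<in> H \<and> z \<in> H})"

lemma (in normal) card_image_coset:
  assumes "finite (carrier G)" "subgroup S G" "H \<subseteq> S"
  shows "card S = card H * card ((\<lambda>x. H #> x) ` S)"
proof -
  have sub: "(\<lambda>x. H #> x) ` S \<subseteq> carrier (G Mod H)"
    using subgroup.subset[OF assms(2)] by (auto simp: carrier_FactGroup)
  have "{x \<in> carrier G. H #> x \<in> (\<lambda>x. H #> x) ` S} = S"
  proof safe
    fix x y assume xy: "x \<in> carrier G" "y \<in> S" "H #> x = H #> y"
    have y: "y \<in> carrier G" using xy subgroup.subset[OF assms(2)] by blast
    have "inv y \<otimes> x \<in> H" using coset_eq_iff[of y x] xy y by simp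
    then have "y \<otimes> (inv y \<otimes> x) \<in> S"
      using subgroup.m_closed[OF assms(2) xy(2), of "inv y \<otimes> x"] assms(3) by blast
    then show "x \<in> S" using xy y by simp
  qed (use subgroup.subset[OF assms(2)] in auto)
  then show ?thesis using card_coset_preimage[OF assms(1) sub] by simp
qed

context group
begin

lemma conj_commutator:
  assumes "x \<in> carrier G" "y \<in> carrier G" "g \<in> carrier G"
  shows "g \<otimes> commutator G x y \<otimes> inv g = commutator G (g \<otimes> x \<otimes> inv g) (g \<otimes> y \<otimes> inv g)"
  using assms by (simp add: commutator_def m_assoc inv_mult_group)

lemma power_gamma3_gens:
  assumes "H \<subseteq> carrier G"
  shows "{x [^] (p::nat) |x. x \<in> H} \<union> {commutator G (commutator G x y) z |x y z. x \<in> H \<and> y \<in> H \<and> z \<in> H} \<subseteq> carrier G"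
  using assms by blast

lemma subgroup_power_gamma3: "H \<subseteq> carrier G \<Longrightarrow> subgroup (power_gamma3 p G H) G"
  unfolding power_gamma3_def by (rule generate_is_subgroup) (rule power_gamma3_gens)

lemma power_gamma3_subset:
  assumes "subgroup U G" "\<And>x. x \<in> H \<Longrightarrow> x [^] p \<in> U"
    "\<And>x y z. x \<in> H \<Longrightarrow> y \<in> H \<Longrightarrow> z \<in> H \<Longrightarrow> commutator G (commutator G x y) z \<in> U"
  shows "power_gamma3 p G H \<subseteq> U"
  unfolding power_gamma3_def by (rule generate_subgroup_incl[OF _ assms(1)]) (use assms(2,3) in blast)

lemma pow_in_power_gamma3: "x \<in> H \<Longrightarrow> x [^] p \<in> power_gamma3 p G H"
  unfolding power_gamma3_def by (rule generate.incl) blast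

lemma commutator_in_power_gamma3:
  "x \<in> H \<Longrightarrow> y \<in> H \<Longrightarrow> z \<in> H \<Longrightarrow> commutator G (commutator G x y) z \<in> power_gamma3 p G H"
  unfolding power_gamma3_def by (rule generate.incl) blast

lemma power_gamma3_normal: "power_gamma3 p G (carrier G) \<lhd> G"
  unfolding power_gamma3_def
proof (rule normal_generateI)
  fix h g assume g: "g \<in> carrier G"
  let ?S = "{x [^] p |x. x \<in> carrier G} \<union>
    {commutator G (commutator G x y) z |x y z. x \<in> carrier G \<and> y \<in> carrier G \<and> z \<in> carrier G}"
  assume "h \<in> ?S"
  then consider x where "x \<in> carrier G" "h = x [^] p"
    | x y z where "x \<in> carrier G" "y \<in> carrier G" "z \<in> carrier G" "h = commutator G (commutator G x y) z"
    by blast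
  then show "g \<otimes> h \<otimes> inv g \<in> ?S"
  proof cases
    case 1
    then have "g \<otimes> h \<otimes> inv g = (g \<otimes> x \<otimes> inv g) [^] p" "g \<otimes> x \<otimes> inv g \<in> carrier G"
      using g by (simp_all add: conj_pow)
    then show ?thesis by blast
  next
    case 2
    then have "g \<otimes> h \<otimes> inv g
        = commutator G (commutator G (g \<otimes> x \<otimes> inv g) (g \<otimes> y \<otimes> inv g)) (g \<otimes> z \<otimes> inv g)"
      using g by (simp add: conj_commutator)
    moreover have "g \<otimes> u \<otimes> inv g \<in> carrier G" if "u \<in> carrier G" for u using g that by simp
    ultimately show ?thesis using 2 by blast
  qed
qed (rule power_gamma3_gens, simp)

end

context p_group
begin

text \<open>Adding one element to \<open>U\<close> multiplies its order by at least \<open>p\<close> and divides the order of its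
  centralizer by at most \<open>card B \<le> p\<close>.\<close>

lemma card_centralizer_le:
  assumes A: "subgroup A G" and R: "R = {x \<in> A. \<forall>y\<in>carrier G. x \<otimes> y = y \<otimes> x}"
    and B: "B \<subseteq> carrier G" "card B \<le> p" "\<And>l g. l \<in> A \<Longrightarrow> g \<in> carrier G \<Longrightarrow> commutator G l g \<in> B"
  shows "order G * card R \<le> card {x \<in> carrier G. \<forall>y\<in>A. x \<otimes> y = y \<otimes> x} * card A"
proof -
  define C where "C = (\<lambda>U. {x \<in> carrier G. \<forall>y\<in>U. x \<otimes> y = y \<otimes> x})"
  let ?P = "\<lambda>U. subgroup U G \<and> U \<subseteq> A \<and> order G * card R \<le> card (C U) * card U"
  have Acar: "A \<subseteq> carrier G" using subgroup.subset[OF A] .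
  have finB: "finite B" using B(1) fin by (rule finite_subset)
  have Csub: "subgroup (C U) G" if "U \<subseteq> carrier G" for U
    unfolding C_def by (rule subgroup_commuting[OF that])
  have "R = A \<inter> C (carrier G)" unfolding R C_def using Acar by blast
  then have "subgroup R G" using A Csub subgroups_Inter_pair by simp
  \<comment> \<open>The starting point \<open>U = R\<close> gives equality, because its centralizer
    is everything.\<close>
  moreover have "C R = carrier G" unfolding R C_def using Acar by auto
  ultimately have "?P R" unfolding R by (auto simp: order_def)
  then obtain U where U: "?P U" "\<And>W. ?P W \<Longrightarrow> U \<subseteq> W \<Longrightarrow> W = U"
  proof (rule obtain_maximal_card[of ?P])
    show "W \<subseteq> carrier G" if "?P W" for W using that Acar by blast
  qed blast
  have "U = A"
  proof (rule ccontr)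
    assume "U \<noteq> A"
    then obtain l where l: "l \<in> A" "l \<notin> U" using U(1) by blast
    have lc: "l \<in> carrier G" using l Acar by blast
    let ?W = "generate G (insert l U)"
    have ins: "insert l U \<subseteq> A" using l U(1) by blast
    have W: "subgroup ?W G" by (rule generate_is_subgroup) (use ins Acar in blast)
    have WA: "?W \<subseteq> A" by (rule generate_subgroup_incl[OF ins A])
    have UW: "insert l U \<subseteq> ?W" by (auto intro: generate.incl)
    then have pc: "p * card U \<le> card ?W" using U(1) W l(2) by (intro card_psubset_subgroup) auto
    let ?D = "C U \<inter> C {l}"
    have Uc: "U \<subseteq> carrier G" using U(1) Acar by blast
    have D: "subgroup ?D G" using Csub[OF Uc] Csub[of "{l}"] lc subgroups_Inter_pair by simp
    have "?D \<subseteq> C ?W"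
    proof
      fix x assume x: "x \<in> ?D"
      then have xc: "x \<in> carrier G" unfolding C_def by blast
      have "?W \<subseteq> {y \<in> carrier G. \<forall>x'\<in>{x}. y \<otimes> x' = x' \<otimes> y}"
        by (rule generate_subgroup_incl[OF _ subgroup_commuting])
           (use x xc lc Uc in \<open>auto simp: C_def\<close>)
      then show "x \<in> C ?W" using xc unfolding C_def by auto
    qed
    then have "card ?D \<le> card (C ?W)"
      using Csub[of ?W] W subgroup.subset by (intro card_mono finite_subgroup) blast+
    \<comment> \<open>Two elements of \<open>C U\<close> with the same commutator with
      \<open>l\<close> differ by an element commuting with \<open>l\<close>. So each fibre lies in a
      left coset of \<open>?D\<close>, and the values lie in \<open>B\<close>.\<close>
    moreover have "card (C U) \<le> card ?D * card B"
    proof (rule card_le_fibres[of _ _ "\<lambda>g. commutator G l g"])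
      show "finite (C U)" using Csub[OF Uc] by simp
      show "(\<lambda>g. commutator G l g) ` C U \<subseteq> B" using B(3) l(1) by (auto simp: C_def)
      fix b
      let ?F = "{g \<in> C U. commutator G l g = b}"
      show "card ?F \<le> card ?D"
      proof (cases "?F = {}")
        case False
        then obtain g where g: "g \<in> C U" "commutator G l g = b" by blast
        have gc: "g \<in> carrier G" using g unfolding C_def by blast
        have "(\<lambda>h. inv g \<otimes> h) ` ?F \<subseteq> ?D"
        proof (rule image_subsetI)
          fix h assume "h \<in> ?F"
          then have h: "h \<in> C U" "commutator G l h = commutator G l g" using g by auto
          have hc: "h \<in> carrier G" using h unfolding C_def by blast
          have "inv g \<otimes> h \<in> C U"
            using g h Csub[OF Uc] by (simp add: subgroup.m_closed subgroup.m_inv_closed)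
          moreover have "h \<otimes> inv l \<otimes> inv h = g \<otimes> inv l \<otimes> inv g"
            using h(2) lc gc hc by (simp add: commutator_def m_assoc)
          then have "inv g \<otimes> (h \<otimes> inv l \<otimes> inv h) \<otimes> h = inv g \<otimes> (g \<otimes> inv l \<otimes> inv g) \<otimes> h" by simp
          then have "(inv g \<otimes> h) \<otimes> inv l = inv l \<otimes> (inv g \<otimes> h)"
            using lc gc hc by (simp add: m_assoc)
          then have "(inv g \<otimes> h) \<otimes> l = l \<otimes> (inv g \<otimes> h)"
            using commute_inv[of "inv g \<otimes> h" "inv l"] lc gc hc by simp
          then have "inv g \<otimes> h \<in> C {l}" using lc gc hc by (simp add: C_def)
          ultimately show "inv g \<otimes> h \<in> ?D" by blast
        qed
        moreover have "inj_on (\<lambda>h. inv g \<otimes> h) ?F"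
          using gc by (intro inj_onI) (auto simp: C_def)
        ultimately show ?thesis using D by (intro card_inj_on_le[of "\<lambda>h. inv g \<otimes> h"]) auto
      next
        case True
        then show ?thesis by (simp only: card.empty)
      qed
    qed (rule finB)
    ultimately have "card (C U) \<le> card (C ?W) * p"
      using B(2) by (meson le_trans mult_le_mono)
    then have "card (C U) * card U \<le> card (C ?W) * p * card U" by simp
    also have "\<dots> \<le> card (C ?W) * card ?W" using pc by (simp add: mult.assoc)
    finally have "?P ?W" using U(1) W WA by linarith
    then have "?W = U" using U(2) UW by blast
    then show False using UW l(2) by blast
  qed
  then show ?thesis using U(1) unfolding C_def by blast
qed

text \<open>As \<open>h [^] p\<close> commutes with \<open>x\<close>, the conjugation formula for
  \<open>n = p\<close> leaves \<open>c [^] p \<otimes> d [^] (p choose 2) = \<one>\<close>.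
  Conjugating this relation by \<open>h\<close> multiplies it by \<open>d [^] p\<close>, which must
  then vanish, and with it \<open>d [^] (p choose 2)\<close>.\<close>

lemma commutator_pow_eq_one:
  assumes p5: "p \<ge> 5"
    and car: "x \<in> carrier G" "h \<in> carrier G" "c \<in> carrier G" "d \<in> carrier G" "e \<in> carrier G"
    and hx: "h \<otimes> x = x \<otimes> c \<otimes> h" and hc: "h \<otimes> c = c \<otimes> d \<otimes> h" and hd: "h \<otimes> d = d \<otimes> e \<otimes> h"
    and cd: "c \<otimes> d = d \<otimes> c" and ec: "e \<otimes> c = c \<otimes> e" and ed: "e \<otimes> d = d \<otimes> e" and eh: "e \<otimes> h = h \<otimes> e"
    and ep: "e [^] p = \<one>" and hp: "h [^] p \<otimes> x = x \<otimes> h [^] p"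
  shows "c [^] p = \<one>" "d [^] p = \<one>"
proof -
  note dvd = prime_dvd_choose_two_three[OF prime_p p5]
  have e2: "e [^] (p choose 2) = \<one>" "e [^] (p choose 3) = \<one>"
    using pow_eq_one_dvd[OF car(5) ep] dvd by auto
  have "x \<otimes> h [^] p = x \<otimes> c [^] p \<otimes> d [^] (p choose 2) \<otimes> e [^] (p choose 3) \<otimes> h [^] p"
    unfolding hp[symmetric] by (rule conj_pow_class3) fact+
  then have "x \<otimes> \<one> = x \<otimes> (c [^] p \<otimes> d [^] (p choose 2))"
    using car by (simp add: e2 flip: m_assoc)
  then have 1: "c [^] p \<otimes> d [^] (p choose 2) = \<one>" using car by (metis l_cancel m_closed nat_pow_closed one_closed)
  have conj: "h \<otimes> c \<otimes> inv h = c \<otimes> d" "h \<otimes> d \<otimes> inv h = d \<otimes> e" using car hc hd by (simp_all add: m_assoc)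
  have "h \<otimes> (c [^] p \<otimes> d [^] (p choose 2)) \<otimes> inv h = (h \<otimes> c [^] p \<otimes> inv h) \<otimes> (h \<otimes> d [^] (p choose 2) \<otimes> inv h)"
    using car by (simp add: m_assoc)
  also have "\<dots> = (c \<otimes> d) [^] p \<otimes> (d \<otimes> e) [^] (p choose 2)"
    using car conj by (simp flip: conj_pow)
  also have "(c \<otimes> d) [^] p = d [^] p \<otimes> c [^] p" using car cd by (metis pow_mult_distrib)
  also have "(d \<otimes> e) [^] (p choose 2) = d [^] (p choose 2)"
    using car ed e2 by (metis pow_mult_distrib nat_pow_closed r_one)
  finally have "\<one> = d [^] p \<otimes> (c [^] p \<otimes> d [^] (p choose 2))" using car 1 by (simp add: m_assoc)
  then show dp: "d [^] p = \<one>" using 1 car by simp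
  have "d [^] (p choose 2) = \<one>" using pow_eq_one_dvd[OF car(4) dp] dvd by auto
  then show "c [^] p = \<one>" using 1 car by simp
qed

text \<open>Moving \<open>c [^] p = \<one>\<close> across \<open>x\<close> produces
  \<open>f [^] p\<close>, hence the first claim. In the typical use \<open>x \<otimes> c\<close> is
  a conjugate of \<open>x\<close>, and the second claim says that the conjugating element commutes
  with \<open>x [^] p\<close>.\<close>

lemma pow_mult_eq_pow:
  assumes p5: "p \<ge> 5" and car: "x \<in> carrier G" "c \<in> carrier G" "f \<in> carrier G"
    and cx: "c \<otimes> x = x \<otimes> c \<otimes> f" and f: "f \<otimes> x = x \<otimes> f" "f \<otimes> c = c \<otimes> f" and cp: "c [^] p = \<one>"
  shows "f [^] p = \<one>" "(x \<otimes> c) [^] p = x [^] p"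
proof -
  have "c [^] p \<otimes> x = x \<otimes> c [^] p \<otimes> f [^] p" by (rule pow_mult_conj_class2) fact+
  then show fp: "f [^] p = \<one>" using car cp by simp
  have "f [^] (p choose 2) = \<one>"
    using pow_eq_one_dvd[OF car(3) fp] prime_dvd_choose_two_three[OF prime_p p5] by auto
  moreover have "(x \<otimes> c) [^] p = x [^] p \<otimes> c [^] p \<otimes> f [^] (p choose 2)"
    by (rule pow_mult_class2) fact+
  ultimately show "(x \<otimes> c) [^] p = x [^] p" using car cp by simp
qed

end

section \<open>The centralizer of a subgroup with few central commutators\<close>

context p_group
begin

text \<open>With \<open>b = [x, l]\<close> and \<open>c = [y, l]\<close> this is
  \<open>[x y, l] = [y, l] [x, l]\<close>.\<close>

lemma conj_cocycle_mult:
  assumes car: "x \<in> carrier G" "y \<in> carrier G" "l \<in> carrier G" "b \<in> carrier G" "c \<in> carrier G"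
    and "x \<otimes> l = b \<otimes> l \<otimes> x" "y \<otimes> l = c \<otimes> l \<otimes> y" "x \<otimes> c = c \<otimes> x"
  shows "(x \<otimes> y) \<otimes> l = c \<otimes> b \<otimes> l \<otimes> (x \<otimes> y)"
proof -
  have "(x \<otimes> y) \<otimes> l = (x \<otimes> c) \<otimes> l \<otimes> y" using car by (simp add: assms(7) m_assoc)
  also have "\<dots> = c \<otimes> (x \<otimes> l) \<otimes> y" using car by (simp add: assms(8) m_assoc)
  also have "\<dots> = c \<otimes> b \<otimes> l \<otimes> (x \<otimes> y)" using car by (simp add: assms(6) m_assoc)
  finally show ?thesis .
qed

text \<open>As \<open>B\<close> is central, the map \<open>(g, l) \<mapsto> [g, l] \<in> B\<close> is bilinear, hence commutators and
  \<open>p\<close>-th powers centralize \<open>power_gamma3\<close>.\<close>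

lemma central_step:
  fixes L
  defines "\<Lambda> \<equiv> power_gamma3 p G (carrier G)"
  defines "L \<equiv> {x \<in> carrier G. \<forall>y\<in>\<Lambda>. x \<otimes> y = y \<otimes> x}"
  assumes p5: "p \<ge> 5" and B: "B \<subseteq> carrier G" "card B \<le> p"
    and Bcent: "\<And>b g. b \<in> B \<Longrightarrow> g \<in> carrier G \<Longrightarrow> b \<otimes> g = g \<otimes> b" and Bexp: "\<And>b. b \<in> B \<Longrightarrow> b [^] p = \<one>"
    and comm: "\<And>l g. l \<in> \<Lambda> \<Longrightarrow> g \<in> carrier G \<Longrightarrow> commutator G l g \<in> B \<and> commutator G g l \<in> B"
  shows "order G * card (power_gamma3 p G L) \<le> card L * card \<Lambda>"
proof -
  have \<Lambda>n: "\<Lambda> \<lhd> G" unfolding \<Lambda>_def by (rule power_gamma3_normal)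
  interpret \<Lambda>: normal \<Lambda> G by (fact \<Lambda>n)
  have Ls: "subgroup L G" unfolding L_def by (rule subgroup_commuting) (rule \<Lambda>.subset)
  interpret L: subgroup L G by (fact Ls)
  have powL: "x [^] p \<in> \<Lambda>" if "x \<in> carrier G" for x
    unfolding \<Lambda>_def using that by (rule pow_in_power_gamma3)
  have commL: "commutator G (commutator G x y) z \<in> \<Lambda>"
    if "x \<in> carrier G" "y \<in> carrier G" "z \<in> carrier G" for x y z
    unfolding \<Lambda>_def using that by (rule commutator_in_power_gamma3)
  have move: "g \<otimes> l = commutator G g l \<otimes> l \<otimes> g" if "l \<in> \<Lambda>" "g \<in> carrier G" for l g
    using mult_eq_commutator_mult[of g l] that \<Lambda>.mem_carrier by (simp add: m_assoc)
  \<comment> \<open>For fixed \<open>l\<close> the map \<open>g \<mapsto> [g, l]\<close> is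
    multiplicative with values that commute with everything, so it kills commutators.\<close>
  have commC: "commutator G x y \<otimes> l = l \<otimes> commutator G x y"
    if l: "l \<in> \<Lambda>" and xy: "x \<in> carrier G" "y \<in> carrier G" for x y l
  proof -
    have lc: "l \<in> carrier G" using l by simp
    let ?b = "\<lambda>g. commutator G g l" and ?c = "commutator G x y"
    have b: "?b g \<in> B" "?b g \<in> carrier G" if "g \<in> carrier G" for g using comm[OF l that] that lc by auto
    have mul: "(g \<otimes> h) \<otimes> l = ?b h \<otimes> ?b g \<otimes> l \<otimes> (g \<otimes> h)" if "g \<in> carrier G" "h \<in> carrier G" for g h
      by (rule conj_cocycle_mult) (rule that lc b(2) move[OF l] Bcent[OF b(1), symmetric] | assumption)+
    have uniq: "u = v" if "u \<otimes> l \<otimes> g = v \<otimes> l \<otimes> g" "u \<in> carrier G" "v \<in> carrier G" "g \<in> carrier G" for u v g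
      using that lc by simp
    have mulb: "?b (g \<otimes> h) = ?b h \<otimes> ?b g" if "g \<in> carrier G" "h \<in> carrier G" for g h
    proof (rule uniq[of _ "g \<otimes> h"])
      show "?b (g \<otimes> h) \<otimes> l \<otimes> (g \<otimes> h) = ?b h \<otimes> ?b g \<otimes> l \<otimes> (g \<otimes> h)"
        using mul[OF that] move[OF l m_closed[OF that]] by argo
    qed (use that b(2) in auto)
    have "?b (x \<otimes> y) = ?b (?c \<otimes> (y \<otimes> x))" using mult_eq_commutator_mult[OF xy] by argo
    then have "?b y \<otimes> ?b x = (?b x \<otimes> ?b y) \<otimes> ?b ?c" using xy mulb by simp
    also have "?b x \<otimes> ?b y = ?b y \<otimes> ?b x" using Bcent b xy by blast
    finally have "?b ?c = \<one>" using b xy by simp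
    then show ?thesis using commutator_eq_one_iff[of ?c l] xy lc by simp
  qed
  \<comment> \<open>By the same multiplicativity \<open>[x\<^sup>n, l] = [x, l]\<^sup>n\<close>, and
    elements of \<open>B\<close> have trivial \<open>p\<close>-th power.\<close>
  have powC: "x [^] p \<otimes> l = l \<otimes> x [^] p" if l: "l \<in> \<Lambda>" and x: "x \<in> carrier G" for x l
  proof -
    have lc: "l \<in> carrier G" using l by simp
    let ?b = "commutator G x l"
    have b: "?b \<in> B" "?b \<in> carrier G" using comm[OF l x] x lc by auto
    have "x [^] n \<otimes> l = ?b [^] n \<otimes> l \<otimes> x [^] n" for n :: nat
    proof (induction n)
      case (Suc n)
      have "x \<otimes> ?b [^] n = ?b [^] n \<otimes> x" using Bcent b x by (metis commute_pow)
      then have "(x \<otimes> x [^] n) \<otimes> l = ?b [^] n \<otimes> ?b \<otimes> l \<otimes> (x \<otimes> x [^] n)"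
        by (intro conj_cocycle_mult) (rule x lc b(2) nat_pow_closed move[OF l x] Suc \<open>x \<otimes> ?b [^] n = ?b [^] n \<otimes> x\<close> Bcent[OF b(1), symmetric] | assumption)+
      then show ?case using x b nat_pow_Suc2 by simp
    qed (use lc in simp)
    from this[of p] show ?thesis using Bexp[OF b(1)] x lc by simp
  qed
  have LI: "x \<in> L" if "x \<in> carrier G" "\<And>l. l \<in> \<Lambda> \<Longrightarrow> x \<otimes> l = l \<otimes> x" for x
    unfolding L_def using that by blast
  have \<Lambda>L: "\<Lambda> \<subseteq> L"
  proof -
    have "power_gamma3 p G (carrier G) \<subseteq> L"
    proof (rule power_gamma3_subset[OF Ls])
      show "x [^] p \<in> L" if "x \<in> carrier G" for x using that powC by (intro LI) auto
      show "commutator G (commutator G x y) z \<in> L"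
        if "x \<in> carrier G" "y \<in> carrier G" "z \<in> carrier G" for x y z
        using that commC[of _ "commutator G x y" z] by (intro LI) auto
    qed
    then show ?thesis by (simp add: \<Lambda>_def)
  qed
  have Ll: "x \<otimes> l = l \<otimes> x" if "x \<in> L" "l \<in> \<Lambda>" for x l using that unfolding L_def by blast
  \<comment> \<open>Here \<open>h [^] p \<in> \<Lambda>\<close> commutes with
    \<open>x \<in> L\<close>, which forces \<open>c [^] p = \<one>\<close>; since
    \<open>x \<otimes> c\<close> is the conjugate of \<open>x\<close> by \<open>h\<close>, comparing
    \<open>p\<close>-th powers finishes.\<close>
  have pow_central: "h \<otimes> x [^] p = x [^] p \<otimes> h" if xL: "x \<in> L" and h: "h \<in> carrier G" for x h
  proof -
    define c where "c = commutator G (inv x) h"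
    define d where "d = commutator G (inv c) h"
    define e where "e = commutator G (inv d) h"
    define f where "f = commutator G (inv c) (inv x)"
    have x: "x \<in> carrier G" using xL by simp
    have c: "c \<in> carrier G" using x h by (simp add: c_def)
    have ic: "inv c = commutator G h (inv x)" using x h by (simp add: c_def inv_commutator)
    have d: "d \<in> \<Lambda>" unfolding d_def ic using x h by (intro commL) auto
    have f: "f \<in> \<Lambda>" unfolding f_def ic using x h by (intro commL) auto
    have e: "e \<in> B" unfolding e_def using comm d h by simp
    have car: "x \<in> carrier G" "h \<in> carrier G" "c \<in> carrier G" "d \<in> carrier G" "e \<in> carrier G" "f \<in> carrier G"
      using x h c d e f B by auto
    have cl: "c \<otimes> l = l \<otimes> c" if "l \<in> \<Lambda>" for l unfolding c_def using commC that x h by simp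
    have hx: "h \<otimes> x = x \<otimes> c \<otimes> h" unfolding c_def by (rule conj_eq_mult_commutator) (use car in auto)
    have cp: "c [^] p = \<one>"
    proof (rule commutator_pow_eq_one[OF p5 car(1-5) hx])
      show "h \<otimes> c = c \<otimes> d \<otimes> h" unfolding d_def by (rule conj_eq_mult_commutator) (use car in auto)
      show "h \<otimes> d = d \<otimes> e \<otimes> h" unfolding e_def by (rule conj_eq_mult_commutator) (use car in auto)
      show "c \<otimes> d = d \<otimes> c" using cl d by simp
      show "e \<otimes> c = c \<otimes> e" "e \<otimes> d = d \<otimes> e" "e \<otimes> h = h \<otimes> e" using Bcent e car by auto
      show "e [^] p = \<one>" using Bexp e by simp
      show "h [^] p \<otimes> x = x \<otimes> h [^] p" using Ll[OF xL powL[OF h]] by simp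
    qed
    have "(x \<otimes> c) [^] p = x [^] p"
    proof (rule pow_mult_eq_pow(2)[OF p5 car(1,3,6)])
      show "c \<otimes> x = x \<otimes> c \<otimes> f" using car by (simp add: f_def commutator_def m_assoc)
      show "f \<otimes> x = x \<otimes> f" using Ll xL f by simp
      show "f \<otimes> c = c \<otimes> f" using cl f by simp
    qed (rule cp)
    moreover have "x \<otimes> c = h \<otimes> x \<otimes> inv h" using hx car by (simp add: m_assoc)
    ultimately have "h \<otimes> x [^] p \<otimes> inv h = x [^] p" using conj_pow[OF x h, of p] by simp
    then show ?thesis using car by (metis inv_solve_right m_closed nat_pow_closed)
  qed
  have comm_central: "g \<otimes> commutator G (commutator G x y) z = commutator G (commutator G x y) z \<otimes> g"
    if xyz: "x \<in> L" "y \<in> L" "z \<in> L" and g: "g \<in> carrier G" for x y z g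
  proof -
    have car: "x \<in> carrier G" "y \<in> carrier G" "z \<in> carrier G" using xyz by auto
    \<comment> \<open>Commutators of \<open>G\<close> centralize commutators of \<open>L\<close>:
      conjugation by \<open>w\<close> multiplies \<open>x'\<close> and \<open>y'\<close> by triple
      commutators, which lie in \<open>\<Lambda>\<close>, commute with all of \<open>L\<close> and
      so drop out of \<open>[x', y']\<close>.\<close>
    have fix_comm: "w \<otimes> commutator G x' y' = commutator G x' y' \<otimes> w"
      if x'y': "x' \<in> L" "y' \<in> L" and w: "w = commutator G u v" "u \<in> carrier G" "v \<in> carrier G" for x' y' w u v
    proof -
      have car': "x' \<in> carrier G" "y' \<in> carrier G" "w \<in> carrier G" using x'y' w by auto
      have ex: "\<exists>l\<in>\<Lambda>. w \<otimes> t \<otimes> inv w = l \<otimes> t" if "t \<in> carrier G" for t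
        using that w by (intro bexI[of _ "commutator G w t"]) (auto simp: commL, simp add: commutator_def m_assoc)
      obtain l m where lm: "l \<in> \<Lambda>" "m \<in> \<Lambda>" "w \<otimes> x' \<otimes> inv w = l \<otimes> x'" "w \<otimes> y' \<otimes> inv w = m \<otimes> y'"
        using ex car' by metis
      have cl: "l \<in> carrier G" "m \<in> carrier G" using lm by auto
      have "w \<otimes> commutator G x' y' \<otimes> inv w = commutator G (l \<otimes> x') (m \<otimes> y')"
        using conj_commutator[of x' y' w] car' lm by simp
      also have "\<dots> = l \<otimes> x' \<otimes> (m \<otimes> y') \<otimes> (inv x' \<otimes> inv l) \<otimes> (inv y' \<otimes> inv m)"
        using cl car' by (simp add: commutator_def inv_mult_group)
      also have "\<dots> = commutator G x' y'"
      proof -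
        have lL: "l \<in> L" "m \<in> L" using lm \<Lambda>L by auto
        have 1: "l \<otimes> t = t \<otimes> l" "m \<otimes> t = t \<otimes> m" if "t \<in> L" for t using Ll[OF that] lm by auto
        have il: "inv l \<otimes> t = t \<otimes> inv l" "inv m \<otimes> t = t \<otimes> inv m" if "t \<in> L" for t
          using commute_inv[of t l] commute_inv[of t m] 1[OF that] that cl by auto
        have "l \<otimes> x' \<otimes> (m \<otimes> y') \<otimes> (inv x' \<otimes> inv l) \<otimes> (inv y' \<otimes> inv m)
          = l \<otimes> (x' \<otimes> m) \<otimes> y' \<otimes> inv x' \<otimes> (inv l \<otimes> (inv y' \<otimes> inv m))"
          using cl car' by (simp add: m_assoc)
        also have "x' \<otimes> m = m \<otimes> x'" using 1 x'y' by simp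
        also have "inv l \<otimes> (inv y' \<otimes> inv m) = (inv y' \<otimes> inv m) \<otimes> inv l" using il lL x'y' by simp
        also have "inv y' \<otimes> inv m = inv m \<otimes> inv y'" using il x'y' by simp
        also have "l \<otimes> (m \<otimes> x') \<otimes> y' \<otimes> inv x' \<otimes> (inv m \<otimes> inv y' \<otimes> inv l)
          = l \<otimes> (m \<otimes> (x' \<otimes> y' \<otimes> inv x') \<otimes> inv m) \<otimes> inv y' \<otimes> inv l"
          using cl car' by (simp add: m_assoc)
        also have "m \<otimes> (x' \<otimes> y' \<otimes> inv x') \<otimes> inv m = x' \<otimes> y' \<otimes> inv x'"
          using 1[of "x' \<otimes> y' \<otimes> inv x'"] x'y' cl car' by (simp add: m_assoc)
        also have "l \<otimes> (x' \<otimes> y' \<otimes> inv x') \<otimes> inv y' \<otimes> inv l = (l \<otimes> commutator G x' y') \<otimes> inv l"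
          using cl car' by (simp add: commutator_def m_assoc)
        also have "l \<otimes> commutator G x' y' = commutator G x' y' \<otimes> l"
          using 1[of "commutator G x' y'"] x'y' by (simp add: commutator_def)
        finally show ?thesis using cl car' il(2)[of "inv y'"] x'y' by (simp add: m_assoc)
      qed
      finally show ?thesis using car' by (metis commutator_closed inv_solve_right m_closed)
    qed
    let ?c = "commutator G x y"
    have conjL: "g \<otimes> t \<otimes> inv g \<in> L" if "t \<in> L" for t
    proof -
      have "(g \<otimes> t \<otimes> inv g) \<otimes> l = l \<otimes> (g \<otimes> t \<otimes> inv g)" if l: "l \<in> \<Lambda>" for l
      proof -
        have l': "inv g \<otimes> l \<otimes> g \<in> \<Lambda>" using l g \<Lambda>.inv_op_closed1 by simp
        have "(g \<otimes> t \<otimes> inv g) \<otimes> l = g \<otimes> (t \<otimes> (inv g \<otimes> l \<otimes> g)) \<otimes> inv g"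
          using \<open>t \<in> L\<close> g l by (simp add: m_assoc)
        also have "t \<otimes> (inv g \<otimes> l \<otimes> g) = (inv g \<otimes> l \<otimes> g) \<otimes> t" using Ll[OF \<open>t \<in> L\<close> l'] .
        finally show ?thesis using \<open>t \<in> L\<close> g l by (simp add: m_assoc)
      qed
      then show ?thesis using that g by (intro LI) auto
    qed
    have cL: "?c \<in> L" using xyz by (simp add: commutator_def)
    have cc: "?c \<in> carrier G" using car by simp
    define l where "l = commutator G g ?c"
    define w where "w = commutator G (inv z) g"
    have wc: "w \<in> carrier G" using car g by (simp add: w_def)
    have "inv l = commutator G ?c g" using g cc by (simp add: l_def inv_commutator)
    then have "inv l \<in> \<Lambda>" using commL car g by simp
    then have l: "l \<in> \<Lambda>" "l \<in> carrier G"
      using \<Lambda>.m_inv_closed[of "inv l"] g cc by (simp_all add: l_def)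
    define c' where "c' = g \<otimes> ?c \<otimes> inv g"
    have c': "c' = l \<otimes> ?c" "c' \<in> carrier G" using g cc by (simp_all add: c'_def l_def commutator_def m_assoc)
    have c'2: "c' = commutator G (g \<otimes> x \<otimes> inv g) (g \<otimes> y \<otimes> inv g)"
      unfolding c'_def using conj_commutator car g by simp
    have c'w: "w \<otimes> c' = c' \<otimes> w"
      unfolding c'2 by (rule fix_comm[OF _ _ w_def]) (use conjL xyz car g in auto)
    have z': "g \<otimes> z \<otimes> inv g = z \<otimes> w"
      using conj_eq_mult_commutator[of z g] car g by (simp add: w_def m_assoc)
    \<comment> \<open>Conjugation by \<open>g\<close> turns \<open>?c\<close> into
      \<open>l \<otimes> ?c\<close> and \<open>z\<close> into \<open>z \<otimes> w\<close>. The
      factor \<open>w\<close> cancels because it commutes with \<open>c'\<close>, a commutator of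
      elements of \<open>L\<close>; the factor \<open>l\<close> cancels because it centralizes
      \<open>L\<close>.\<close>
    have "g \<otimes> commutator G ?c z \<otimes> inv g = commutator G c' (z \<otimes> w)"
      using conj_commutator[of ?c z g] cc car g z' by (simp add: c'_def)
    also have "\<dots> = c' \<otimes> z \<otimes> (w \<otimes> inv c' \<otimes> inv w) \<otimes> inv z"
      using c' car wc by (simp add: commutator_def inv_mult_group m_assoc)
    also have "w \<otimes> inv c' = inv c' \<otimes> w" using commute_inv c'w c' wc by simp
    also have "c' \<otimes> z \<otimes> (inv c' \<otimes> w \<otimes> inv w) \<otimes> inv z = l \<otimes> (?c \<otimes> z \<otimes> inv ?c) \<otimes> inv l \<otimes> inv z"
      using c' car wc cc l by (simp add: inv_mult_group m_assoc)
    also have "l \<otimes> (?c \<otimes> z \<otimes> inv ?c) = (?c \<otimes> z \<otimes> inv ?c) \<otimes> l"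
      using Ll[OF _ l(1), of "?c \<otimes> z \<otimes> inv ?c"] cL xyz by simp
    also have "(?c \<otimes> z \<otimes> inv ?c) \<otimes> l \<otimes> inv l \<otimes> inv z = commutator G ?c z"
      using car cc l by (simp add: commutator_def m_assoc)
    finally show ?thesis using cc car g by (metis commutator_closed inv_solve_right m_closed)
  qed
  \<comment> \<open>The part of \<open>\<Lambda>\<close> that is central in \<open>G\<close>. It
    contains \<open>power_gamma3 p G L\<close>, and the pairing bound is stated with exactly this
    subgroup.\<close>
  define R where "R = {x \<in> \<Lambda>. \<forall>y\<in>carrier G. x \<otimes> y = y \<otimes> x}"
  have "R = \<Lambda> \<inter> {x \<in> carrier G. \<forall>y\<in>carrier G. x \<otimes> y = y \<otimes> x}" unfolding R_def by auto
  then have Rs: "subgroup R G"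
    using subgroups_Inter_pair \<Lambda>.is_subgroup subgroup_commuting[of "carrier G"] by simp
  have "power_gamma3 p G L \<subseteq> R"
  proof (rule power_gamma3_subset[OF Rs])
    show "x [^] p \<in> R" if "x \<in> L" for x using that powL pow_central[symmetric] unfolding R_def by simp
    show "commutator G (commutator G x y) z \<in> R" if "x \<in> L" "y \<in> L" "z \<in> L" for x y z
      using that commL comm_central[OF that, symmetric] unfolding R_def by simp
  qed
  then have "card (power_gamma3 p G L) \<le> card R" using Rs by (intro card_mono) auto
  then have "order G * card (power_gamma3 p G L) \<le> order G * card R" by simp
  also have "\<dots> \<le> card L * card \<Lambda>"
    unfolding L_def by (rule card_centralizer_le[OF \<Lambda>.is_subgroup R_def B]) (use comm in blast)
  finally show ?thesis .
qed

end

section \<open>Passage to quotients and subgroups, and the index inequality\<close>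

lemma (in group_hom) power_gamma3_img:
  assumes "S \<subseteq> carrier G"
  shows "power_gamma3 p H (h ` S) = h ` power_gamma3 p G S"
proof -
  let ?K = "{x [^] p |x. x \<in> S} \<union> {commutator G (commutator G x y) z |x y z. x \<in> S \<and> y \<in> S \<and> z \<in> S}"
  have c: "x \<in> S \<Longrightarrow> x \<in> carrier G" for x using assms by blast
  have K: "?K \<subseteq> carrier G" by (rule G.power_gamma3_gens[OF assms])
  have "{x [^]\<^bsub>H\<^esub> p |x. x \<in> h ` S} = h ` {x [^] p |x. x \<in> S}"
    using c hom_nat_pow by (auto simp: image_iff) (metis hom_nat_pow)+
  moreover have "{commutator H (commutator H x y) z |x y z. x \<in> h ` S \<and> y \<in> h ` S \<and> z \<in> h ` S}
      = h ` {commutator G (commutator G x y) z |x y z. x \<in> S \<and> y \<in> S \<and> z \<in> S}" (is "?A = h ` ?B")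
  proof (intro equalityI subsetI)
    have eq: "h (commutator G (commutator G x y) z) = commutator H (commutator H (h x) (h y)) (h z)"
      if "x \<in> S" "y \<in> S" "z \<in> S" for x y z using that c by (simp add: hom_commutator)
    fix u
    show "u \<in> h ` ?B" if u: "u \<in> ?A"
    proof -
      obtain x y z where x: "x \<in> S" "y \<in> S" "z \<in> S" "u = commutator H (commutator H (h x) (h y)) (h z)"
        using u by blast
      then have "u = h (commutator G (commutator G x y) z)" using eq by simp
      then show ?thesis using x by blast
    qed
    show "u \<in> ?A" if u: "u \<in> h ` ?B"
    proof -
      obtain x y z where x: "x \<in> S" "y \<in> S" "z \<in> S" "u = h (commutator G (commutator G x y) z)"
        using u by blast
      then have "u = commutator H (commutator H (h x) (h y)) (h z)" using eq by simp
      then show ?thesis using x by blast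
    qed
  qed
  ultimately show ?thesis
    unfolding power_gamma3_def using generate_img[OF K] by (simp add: image_Un)
qed

lemma (in group) commutators_with_normal:
  assumes "K \<lhd> G"
  shows "generate G {commutator G l g |l g. l \<in> K \<and> g \<in> carrier G} \<lhd> G"
proof (rule normal_generateI)
  interpret K: normal K G by (fact assms)
  show "{commutator G l g |l g. l \<in> K \<and> g \<in> carrier G} \<subseteq> carrier G" by auto
  fix h g assume g: "g \<in> carrier G" and "h \<in> {commutator G l g |l g. l \<in> K \<and> g \<in> carrier G}"
  then obtain l k where "l \<in> K" "k \<in> carrier G" "h = commutator G l k" by blast
  moreover from this have "g \<otimes> h \<otimes> inv g = commutator G (g \<otimes> l \<otimes> inv g) (g \<otimes> k \<otimes> inv g)"
    using g by (simp add: conj_commutator)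
  ultimately show "g \<otimes> h \<otimes> inv g \<in> {commutator G l g |l g. l \<in> K \<and> g \<in> carrier G}"
    using g K.inv_op_closed2 by blast
qed

lemma (in group) power_gamma3_consistent:
  assumes "subgroup H G" "S \<subseteq> H"
  shows "power_gamma3 p (G\<lparr>carrier := H\<rparr>) S = power_gamma3 p G S"
proof -
  interpret H: subgroup H G by (fact assms)
  have comm: "commutator (G\<lparr>carrier := H\<rparr>) x y = commutator G x y" if "x \<in> H" "y \<in> H" for x y
    using that assms(1) by (simp add: commutator_def)
  have cH: "commutator G x y \<in> H" if "x \<in> H" "y \<in> H" for x y
    using that by (simp add: commutator_def)
  have S: "x \<in> S \<Longrightarrow> x \<in> H" for x using assms(2) by blast
  have "{commutator (G\<lparr>carrier := H\<rparr>) (commutator (G\<lparr>carrier := H\<rparr>) x y) z |x y z. x \<in> S \<and> y \<in> S \<and> z \<in> S}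
      = {commutator G (commutator G x y) z |x y z. x \<in> S \<and> y \<in> S \<and> z \<in> S}"
    using S comm cH by (intro Collect_cong) metis
  moreover have "{x [^]\<^bsub>G\<lparr>carrier := H\<rparr>\<^esub> p |x. x \<in> S} = {x [^] p |x. x \<in> S}"
    by (simp flip: nat_pow_consistent)
  moreover have "{x [^] p |x. x \<in> S} \<union> {commutator G (commutator G x y) z |x y z. x \<in> S \<and> y \<in> S \<and> z \<in> S} \<subseteq> H"
    by (auto intro!: cH subgroup_pow_closed[OF assms(1)] intro: S)
  ultimately show ?thesis
    unfolding power_gamma3_def using generate_consistent[OF _ assms(1)] by simp
qed

context p_group
begin

text \<open>\<open>A\<close> is the subgroup \<open>[\<Lambda>, G]\<close>, nontrivial by
  assumption. In a quotient where it becomes central of order \<open>p\<close>,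
  \<open>central_step\<close> applies; \<open>L\<close> is the preimage of the centralizer found
  there, and it is proper because otherwise \<open>A\<close> would already vanish.\<close>

lemma noncentral_step:
  assumes p5: "p \<ge> 5"
    and nc: "l0 \<in> power_gamma3 p G (carrier G)" "g0 \<in> carrier G" "l0 \<otimes> g0 \<noteq> g0 \<otimes> l0"
  shows "\<exists>L. subgroup L G \<and> L \<noteq> carrier G \<and>
    order G * card (power_gamma3 p G L) \<le> card L * card (power_gamma3 p G (carrier G))"
proof -
  define \<Lambda> where "\<Lambda> = power_gamma3 p G (carrier G)"
  have "\<Lambda> \<lhd> G" unfolding \<Lambda>_def by (rule power_gamma3_normal)
  then interpret \<Lambda>: normal \<Lambda> G .
  let ?S = "{commutator G l g |l g. l \<in> \<Lambda> \<and> g \<in> carrier G}"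
  define A where "A = generate G ?S"
  have "A \<lhd> G" unfolding A_def by (rule commutators_with_normal[OF \<Lambda>.normal_axioms])
  then interpret A: normal A G .
  have Ag: "commutator G l g \<in> A" if "l \<in> \<Lambda>" "g \<in> carrier G" for l g
    unfolding A_def by (rule generate.incl) (use that in blast)
  have "?S \<subseteq> \<Lambda>" using commutator_in_normal[OF \<Lambda>.normal_axioms] by auto
  then have A\<Lambda>: "A \<subseteq> \<Lambda>" unfolding A_def by (rule generate_subgroup_incl) (rule \<Lambda>.is_subgroup)
  have "commutator G l0 g0 \<noteq> \<one>" using nc commutator_eq_one_iff \<Lambda>.mem_carrier \<Lambda>_def by simp
  then have nA: "\<not> A \<subseteq> {\<one>}" using Ag nc(1,2) \<Lambda>_def by blast
  obtain M z where M: "M \<lhd> G" "{\<one>} \<subseteq> M" "\<not> A \<subseteq> M" "z \<in> A" "z \<notin> M" "z [^] p \<in> M"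
    "\<And>a g. a \<in> A \<Longrightarrow> g \<in> carrier G \<Longrightarrow> commutator G a g \<in> M"
    "\<And>a. a \<in> A \<Longrightarrow> \<exists>n\<in>M. \<exists>i::nat. a = n \<otimes> z [^] i"
    by (rule obtain_normal_avoiding[OF A.normal_axioms one_is_normal nA]) blast
  \<comment> \<open>Intersecting with \<open>A\<close> keeps \<open>N\<close> inside
    \<open>\<Lambda>\<close>, so the order of \<open>\<Lambda>\<close> drops exactly by the factor
    \<open>card N\<close> in the quotient.\<close>
  define N where "N = M \<inter> A"
  have "N \<lhd> G" unfolding N_def using M(1) A.normal_axioms by (rule normal_subgroup_intersect)
  then interpret N: normal N G .
  interpret Q: p_group "G Mod N" p by (rule p_group_Mod[OF N.normal_axioms])
  interpret h: group_hom G "G Mod N" "\<lambda>x. N #> x" by (rule N.Mod_group_hom)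
  let ?h = "\<lambda>x. N #> x" and ?Q = "G Mod N"
  have zc: "z \<in> carrier G" using M(4) by simp
  have zp: "?h z [^]\<^bsub>?Q\<^esub> p = \<one>\<^bsub>?Q\<^esub>"
  proof -
    have "z [^] p \<in> N" unfolding N_def using M(4,6) subgroup_pow_closed[OF A.is_subgroup] by blast
    then have "?h (z [^] p) = \<one>\<^bsub>?Q\<^esub>" using zc N.coset_eq_one_iff by simp
    then show ?thesis using zc by (simp add: h.hom_nat_pow)
  qed
  have pwz: "\<exists>i::nat. ?h a = ?h z [^]\<^bsub>?Q\<^esub> i" if a: "a \<in> A" for a
  proof -
    obtain n i where n: "n \<in> M" "a = n \<otimes> z [^] (i::nat)" using M(8)[OF a] by blast
    have nc: "n \<in> carrier G" using n M(1) normal_imp_subgroup subgroup.mem_carrier by metis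
    have "n = a \<otimes> inv (z [^] i)" using n nc zc by (simp add: m_assoc)
    then have "n \<in> A" using a M(4) subgroup_pow_closed[OF A.is_subgroup M(4)] by simp
    then have "?h n = \<one>\<^bsub>?Q\<^esub>" using n nc N.coset_eq_one_iff by (simp add: N_def)
    then have "?h a = ?h z [^]\<^bsub>?Q\<^esub> i" using n nc zc by (simp add: h.hom_nat_pow)
    then show ?thesis ..
  qed
  have carQ: "?h ` carrier G = carrier ?Q" by (simp add: carrier_FactGroup)
  define B where "B = ?h ` A"
  have \<Lambda>Q: "power_gamma3 p ?Q (carrier ?Q) = ?h ` \<Lambda>"
    unfolding \<Lambda>_def carQ[symmetric] by (rule h.power_gamma3_img) simp
  define LQ where "LQ = {x \<in> carrier ?Q. \<forall>y\<in>power_gamma3 p ?Q (carrier ?Q). x \<otimes>\<^bsub>?Q\<^esub> y = y \<otimes>\<^bsub>?Q\<^esub> x}"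
  have step: "order ?Q * card (power_gamma3 p ?Q LQ) \<le> card LQ * card (power_gamma3 p ?Q (carrier ?Q))"
    unfolding LQ_def
  proof (rule Q.central_step[OF p5, where B = B])
    show "B \<subseteq> carrier ?Q" unfolding B_def using A.subset by auto
    have "B \<subseteq> (\<lambda>i. ?h z [^]\<^bsub>?Q\<^esub> i) ` {..<p}"
    proof
      fix b assume "b \<in> B"
      then obtain i :: nat where i: "b = ?h z [^]\<^bsub>?Q\<^esub> i" using pwz unfolding B_def by blast
      have "?h z [^]\<^bsub>?Q\<^esub> i = ?h z [^]\<^bsub>?Q\<^esub> (p * (i div p)) \<otimes>\<^bsub>?Q\<^esub> ?h z [^]\<^bsub>?Q\<^esub> (i mod p)"
        using zc by (simp add: Q.nat_pow_mult)
      also have "?h z [^]\<^bsub>?Q\<^esub> (p * (i div p)) = \<one>\<^bsub>?Q\<^esub>"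
        using zc zp Q.pow_eq_one_dvd by simp
      finally have "b = ?h z [^]\<^bsub>?Q\<^esub> (i mod p)" using i zc by simp
      then show "b \<in> (\<lambda>i. ?h z [^]\<^bsub>?Q\<^esub> i) ` {..<p}" by simp
    qed
    then have "card B \<le> card {..<p}" by (rule surj_card_le[rotated]) simp
    then show "card B \<le> p" by simp
    show "b \<otimes>\<^bsub>?Q\<^esub> g = g \<otimes>\<^bsub>?Q\<^esub> b" if "b \<in> B" "g \<in> carrier ?Q" for b g
    proof -
      obtain a g' where a: "a \<in> A" "b = ?h a" "g' \<in> carrier G" "g = ?h g'"
        using \<open>b \<in> B\<close> \<open>g \<in> carrier ?Q\<close> unfolding B_def carQ[symmetric] by blast
      have "commutator G a g' \<in> N"
        unfolding N_def using M(7) a commutator_in_normal[OF A.normal_axioms] A.mem_carrier by simp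
      then show ?thesis using a N.commutator_mem_iff by simp
    qed
    show "b [^]\<^bsub>?Q\<^esub> p = \<one>\<^bsub>?Q\<^esub>" if "b \<in> B" for b
    proof -
      obtain i :: nat where "b = ?h z [^]\<^bsub>?Q\<^esub> i" using pwz \<open>b \<in> B\<close> unfolding B_def by blast
      then show ?thesis using zc zp by (simp add: Q.nat_pow_pow Q.pow_eq_one_dvd)
    qed
    show "commutator ?Q l g \<in> B \<and> commutator ?Q g l \<in> B"
      if lg: "l \<in> power_gamma3 p ?Q (carrier ?Q)" "g \<in> carrier ?Q" for l g
    proof -
      obtain l' g' where l: "l' \<in> \<Lambda>" "l = ?h l'" "g' \<in> carrier G" "g = ?h g'"
        using lg(1)[unfolded \<Lambda>Q] lg(2)[folded carQ] by blast
      have "inv (commutator G l' g') \<in> A" using Ag l by simp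
      then have "commutator G g' l' \<in> A" using inv_commutator l by simp
      moreover have "commutator G l' g' \<in> A" using Ag l by simp
      moreover have "commutator ?Q l g = ?h (commutator G l' g')" "commutator ?Q g l = ?h (commutator G g' l')"
        using l by (simp_all add: h.hom_commutator)
      ultimately show ?thesis unfolding B_def by blast
    qed
  qed
  define L where "L = {x \<in> carrier G. ?h x \<in> LQ}"
  have LQs: "subgroup LQ ?Q"
    unfolding LQ_def by (rule Q.subgroup_commuting)
      (use normal_imp_subgroup[OF Q.power_gamma3_normal] subgroup.subset in blast)
  interpret LQ: subgroup LQ ?Q by (fact LQs)
  have Ls: "subgroup L G"
  proof (rule subgroupI)
    have "\<one> \<in> L" by (simp add: L_def)
    then show "L \<noteq> {}" by blast
  qed (auto simp: L_def)
  have "L \<noteq> carrier G"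
  proof
    assume "L = carrier G"
    then have LQ: "?h g \<in> LQ" if "g \<in> carrier G" for g using that unfolding L_def by blast
    have "commutator G l g \<in> N" if l: "l \<in> \<Lambda>" and g: "g \<in> carrier G" for l g
    proof -
      have "?h l \<in> power_gamma3 p ?Q (carrier ?Q)" unfolding \<Lambda>Q using l by blast
      then have "?h g \<otimes>\<^bsub>?Q\<^esub> ?h l = ?h l \<otimes>\<^bsub>?Q\<^esub> ?h g" using LQ[OF g] unfolding LQ_def by blast
      then show ?thesis using N.commutator_mem_iff[of l g] l g by simp
    qed
    then have "?S \<subseteq> N" by blast
    then have "A \<subseteq> N" unfolding A_def by (rule generate_subgroup_incl) (rule N.is_subgroup)
    then show False using M(3) unfolding N_def by blast
  qed
  moreover have "order G * card (power_gamma3 p G L) \<le> card L * card \<Lambda>"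
  proof -
    have c1: "order G = card N * order ?Q"
      unfolding order_def carQ[symmetric] using fin subgroup_self N.subset by (rule N.card_image_coset)
    have c2: "card L = card N * card LQ"
      unfolding L_def using fin LQ.subset by (rule N.card_coset_preimage)
    have c3: "card \<Lambda> = card N * card (power_gamma3 p ?Q (carrier ?Q))"
      unfolding \<Lambda>Q using fin \<Lambda>.is_subgroup by (rule N.card_image_coset) (use A\<Lambda> N_def in blast)
    have Lc: "L \<subseteq> carrier G" using subgroup.subset[OF Ls] .
    \<comment> \<open>An upper bound for this order is enough, since it stands on the smaller side
      of the inequality.\<close>
    have "power_gamma3 p G L \<subseteq> {x \<in> carrier G. ?h x \<in> power_gamma3 p ?Q LQ}"
    proof
      fix x assume x: "x \<in> power_gamma3 p G L"
      have "?h ` L \<subseteq> LQ" unfolding L_def by blast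
      have "?h x \<in> power_gamma3 p ?Q (?h ` L)" using x h.power_gamma3_img[OF Lc] by blast
      also have "\<dots> \<subseteq> power_gamma3 p ?Q LQ"
        unfolding power_gamma3_def using \<open>?h ` L \<subseteq> LQ\<close> by (intro Q.mono_generate) blast
      finally show "x \<in> {x \<in> carrier G. ?h x \<in> power_gamma3 p ?Q LQ}"
        using x subgroup.mem_carrier[OF subgroup_power_gamma3[OF Lc]] by blast
    qed
    then have "card (power_gamma3 p G L) \<le> card {x \<in> carrier G. ?h x \<in> power_gamma3 p ?Q LQ}"
      using fin by (intro card_mono) auto
    also have "\<dots> = card N * card (power_gamma3 p ?Q LQ)"
      using fin subgroup.subset[OF Q.subgroup_power_gamma3[OF LQ.subset]] by (rule N.card_coset_preimage)
    finally have "order G * card (power_gamma3 p G L)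
        \<le> (card N * order ?Q) * (card N * card (power_gamma3 p ?Q LQ))"
      unfolding c1 by (rule mult_le_mono2)
    also have "\<dots> = card N * card N * (order ?Q * card (power_gamma3 p ?Q LQ))" by simp
    also have "\<dots> \<le> card N * card N * (card LQ * card (power_gamma3 p ?Q (carrier ?Q)))"
      using step by (rule mult_le_mono2)
    finally show ?thesis unfolding c2 c3 by (simp add: mult_ac)
  qed
  ultimately show ?thesis using Ls unfolding \<Lambda>_def by blast
qed

text \<open>In the collection formula the elements \<open>c\<close>, \<open>d\<close>,
  \<open>e\<close> all have trivial \<open>p\<close>-th power: for \<open>c\<close> and
  \<open>d\<close> because \<open>y [^] p\<close> is central, then for \<open>e\<close> because
  \<open>c [^] p = \<one>\<close>. The exponents are divisible by \<open>p\<close>, so all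
  corrections vanish.\<close>

lemma central_pow_mult:
  assumes p5: "p \<ge> 5"
    and cent: "\<And>l g. l \<in> power_gamma3 p G (carrier G) \<Longrightarrow> g \<in> carrier G \<Longrightarrow> l \<otimes> g = g \<otimes> l"
    and xy: "x \<in> carrier G" "y \<in> carrier G"
  shows "(x \<otimes> y) [^] p = x [^] p \<otimes> y [^] p"
proof -
  define c where "c = commutator G (inv x) y"
  define d where "d = commutator G (inv c) y"
  define e where "e = commutator G (inv c) (inv x)"
  have c: "c \<in> carrier G" using xy by (simp add: c_def)
  have ic: "inv c = commutator G y (inv x)" using xy by (simp add: c_def inv_commutator)
  have d: "d \<in> power_gamma3 p G (carrier G)"
    unfolding d_def ic by (rule commutator_in_power_gamma3) (use xy in auto)
  have e: "e \<in> power_gamma3 p G (carrier G)"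
    unfolding e_def ic by (rule commutator_in_power_gamma3) (use xy in auto)
  have car: "x \<in> carrier G" "y \<in> carrier G" "c \<in> carrier G" "d \<in> carrier G" "e \<in> carrier G"
    using xy c by (auto simp: d_def e_def)
  have yx: "y \<otimes> x = x \<otimes> c \<otimes> y" unfolding c_def by (rule conj_eq_mult_commutator) (use car in auto)
  have yc: "y \<otimes> c = c \<otimes> d \<otimes> y" unfolding d_def by (rule conj_eq_mult_commutator) (use car in auto)
  have cx: "c \<otimes> x = x \<otimes> c \<otimes> e" using car by (simp add: e_def commutator_def m_assoc)
  have cd: "c [^] p = \<one>" "d [^] p = \<one>"
  proof -
    have "y \<otimes> d = d \<otimes> \<one> \<otimes> y" using cent[OF d car(2)] car by simp
    moreover have "c \<otimes> d = d \<otimes> c" using cent[OF d car(3)] by simp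
    moreover have "y [^] p \<otimes> x = x \<otimes> y [^] p" by (rule cent[OF pow_in_power_gamma3]) (use car in auto)
    ultimately show "c [^] p = \<one>" "d [^] p = \<one>"
      using commutator_pow_eq_one[OF p5 car(1-4) one_closed yx yc] car by simp_all
  qed
  have ep: "e [^] p = \<one>"
    by (rule pow_mult_eq_pow(1)[OF p5 car(1,3,5) cx]) (use cent[OF e] car cd in auto)
  have de: "d \<otimes> e = e \<otimes> d" using cent[OF d car(5)] .
  have "(d \<otimes> e) [^] p = \<one>" using pow_mult_distrib[OF de car(4,5)] cd ep by simp
  then have "(d \<otimes> e) [^] (p choose 3) = \<one>" "c [^] (p choose 2) = \<one>"
    using pow_eq_one_dvd[of "d \<otimes> e" p] pow_eq_one_dvd[of c p] car cd prime_dvd_choose_two_three[OF prime_p p5]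
    by simp_all
  moreover have "(x \<otimes> y) [^] p = x [^] p \<otimes> c [^] (p choose 2) \<otimes> (d \<otimes> e) [^] (p choose 3) \<otimes> y [^] p"
    by (rule pow_mult_class3[OF car yx yc cx]) (rule cent d e car de)+
  ultimately show ?thesis using car by simp
qed

text \<open>Now \<open>x \<mapsto> x [^] p\<close> is a homomorphism, so each nonempty fibre is a
  translate of the kernel.\<close>

lemma card_le_of_central:
  assumes p5: "p \<ge> 5"
    and cent: "\<And>l g. l \<in> power_gamma3 p G (carrier G) \<Longrightarrow> g \<in> carrier G \<Longrightarrow> l \<otimes> g = g \<otimes> l"
  shows "order G \<le> card {x \<in> carrier G. x [^] p = \<one>} * card (power_gamma3 p G (carrier G))"
  unfolding order_def
proof (rule card_le_fibres[of _ _ "\<lambda>x. x [^] p"])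
  show "finite (power_gamma3 p G (carrier G))" using subgroup_power_gamma3 by simp
  show "(\<lambda>x. x [^] p) ` carrier G \<subseteq> power_gamma3 p G (carrier G)" using pow_in_power_gamma3 by blast
  fix b
  let ?F = "{x \<in> carrier G. x [^] p = b}"
  show "card ?F \<le> card {x \<in> carrier G. x [^] p = \<one>}"
  proof (cases "?F = {}")
    case False
    then obtain g where g: "g \<in> carrier G" "g [^] p = b" by blast
    have "(\<lambda>x. inv g \<otimes> x) ` ?F \<subseteq> {x \<in> carrier G. x [^] p = \<one>}"
      using g central_pow_mult[OF p5 cent] by (auto simp: nat_pow_inv)
    moreover have "inj_on (\<lambda>x. inv g \<otimes> x) ?F" using g by (intro inj_onI) auto
    ultimately show ?thesis using fin by (intro card_inj_on_le[of "\<lambda>x. inv g \<otimes> x"]) auto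
  next
    case True
    then show ?thesis by (simp only: card.empty)
  qed
qed (rule fin)

lemma pow_eq_one_in_Omega_1:
  assumes "x \<in> carrier G" "x [^] p = \<one>"
  shows "x \<in> Omega_1 p G"
proof (cases "x = \<one>")
  case False
  have "ord x dvd p" using assms pow_eq_id by blast
  then have "ord x = p" using False assms ord_eq_1 prime_p by (metis prime_nat_iff)
  then show ?thesis unfolding Omega_1_def using assms by (intro generate.incl) simp
qed (simp add: Omega_1_def generate.one)

theorem order_le_card_Omega_1:
  assumes p5: "p \<ge> 5"
  shows "order G \<le> card (Omega_1 p G) * card (power_gamma3 p G (carrier G))"
proof -
  let ?Z = "power_gamma3 p G"
  let ?P = "\<lambda>U. subgroup U G \<and> order G * card (?Z U) \<le> card U * card (?Z (carrier G))"
  have "?P (carrier G)" using subgroup_self by (simp add: order_def)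
  \<comment> \<open>The property \<open>?P U\<close> is
    \<open>|G : \<lambda>(G)| \<le> |U : \<lambda>(U)|\<close> cleared of denominators.\<close>
  then obtain H where H: "?P H" "\<And>U. ?P U \<Longrightarrow> card H \<le> card U"
    using ex_has_least_nat[of ?P "carrier G" card] by blast
  interpret H: subgroup H G using H(1) by blast
  let ?H = "G\<lparr>carrier := H\<rparr>"
  interpret pH: p_group ?H p by (rule p_group_subgroup[OF H.is_subgroup])
  have cons: "power_gamma3 p ?H S = ?Z S" if "S \<subseteq> H" for S
    using power_gamma3_consistent[OF H.is_subgroup that] .
  have pos: "card (?Z H) > 0" "card H > 0"
    using subgroup.finite_imp_card_positive[OF _ fin] subgroup_power_gamma3[OF H.subset] H.is_subgroup by auto
  have cent: "l \<otimes> g = g \<otimes> l" if lg: "l \<in> ?Z H" "g \<in> H" for l g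
  proof (rule ccontr)
    assume "l \<otimes> g \<noteq> g \<otimes> l"
    then obtain L where L: "subgroup L ?H" "L \<noteq> H" "card H * card (power_gamma3 p ?H L) \<le> card L * card (?Z H)"
      using pH.noncentral_step[OF p5, of l g] lg cons[OF order_refl] by (auto simp: order_def)
    have LH: "L \<subseteq> H" using subgroup.subset[OF L(1)] by simp
    have Ls: "subgroup L G" using incl_subgroup[OF H.is_subgroup L(1)] .
    have "card H * card (?Z L) \<le> card L * card (?Z H)" using L(3) cons[OF LH] by simp
    \<comment> \<open>Multiplying the inequality for \<open>H\<close> in \<open>G\<close> by the one
      for \<open>L\<close> in \<open>H\<close> shows that \<open>L\<close> also satisfies
      \<open>?P\<close>, although it is smaller than \<open>H\<close>.\<close>
    then have "(order G * card (?Z H)) * (card H * card (?Z L)) \<le> (card H * card (?Z (carrier G))) * (card L * card (?Z H))"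
      using mult_le_mono[OF conjunct2[OF H(1)]] by blast
    then have "(card H * card (?Z H)) * (order G * card (?Z L)) \<le> (card H * card (?Z H)) * (card L * card (?Z (carrier G)))"
      by (simp add: mult_ac)
    then have "?P L" using pos Ls by simp
    then have "card H \<le> card L" using H(2) by blast
    moreover have "card L < card H" using LH L(2) H.is_subgroup finite_subgroup by (intro psubset_card_mono) blast+
    ultimately show False by simp
  qed
  have "order ?H \<le> card {x \<in> carrier ?H. x [^]\<^bsub>?H\<^esub> p = \<one>\<^bsub>?H\<^esub>} * card (power_gamma3 p ?H (carrier ?H))"
  proof (rule pH.card_le_of_central[OF p5])
    fix l g assume "l \<in> power_gamma3 p ?H (carrier ?H)" "g \<in> carrier ?H"
    then have "l \<otimes> g = g \<otimes> l" using cons[OF order_refl] by (intro cent) auto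
    then show "l \<otimes>\<^bsub>?H\<^esub> g = g \<otimes>\<^bsub>?H\<^esub> l" by simp
  qed
  then have "card H \<le> card {x \<in> H. x [^] p = \<one>} * card (?Z H)"
    using cons[OF order_refl] by (simp add: order_def flip: nat_pow_consistent)
  \<comment> \<open>The only link between \<open>H\<close> and \<open>G\<close> at this point:
    elements of \<open>H\<close> with trivial \<open>p\<close>-th power lie in
    \<open>\<Omega>\<^sub>1(G)\<close>.\<close>
  moreover have "card {x \<in> H. x [^] p = \<one>} \<le> card (Omega_1 p G)"
  proof (rule card_mono)
    have "subgroup (Omega_1 p G) G" unfolding Omega_1_def by (rule generate_is_subgroup) blast
    then show "finite (Omega_1 p G)" by simp
    show "{x \<in> H. x [^] p = \<one>} \<subseteq> Omega_1 p G" using pow_eq_one_in_Omega_1 by auto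
  qed
  ultimately have "card H \<le> card (Omega_1 p G) * card (?Z H)" by (meson le_trans mult_le_mono1)
  then have "card H * card (?Z (carrier G)) \<le> card (Omega_1 p G) * card (?Z H) * card (?Z (carrier G))"
    by (rule mult_le_mono1)
  with conjunct2[OF H(1)] have "order G * card (?Z H) \<le> card (Omega_1 p G) * card (?Z H) * card (?Z (carrier G))"
    by (rule le_trans)
  then have "order G * card (?Z H) \<le> (card (Omega_1 p G) * card (?Z (carrier G))) * card (?Z H)"
    by (simp only: mult_ac)
  then show ?thesis using pos by simp
qed

end

section \<open>Powerful groups\<close>

lemma (in normal) pow_mem_iff:
  assumes "x \<in> carrier G"
  shows "(H #> x) [^]\<^bsub>G Mod H\<^esub> (n::nat) = \<one>\<^bsub>G Mod H\<^esub> \<longleftrightarrow> x [^] n \<in> H"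
proof -
  interpret h: group_hom G "G Mod H" "\<lambda>x. H #> x" by (rule Mod_group_hom)
  show ?thesis using assms coset_eq_one_iff[of "x [^] n"] by (simp add: h.hom_nat_pow)
qed

lemma (in normal) subgroup_central_mod:
  "subgroup {x \<in> carrier G. \<forall>g\<in>carrier G. commutator G x g \<in> H} G"
proof -
  interpret h: group_hom G "G Mod H" "\<lambda>x. H #> x" by (rule Mod_group_hom)
  let ?C = "{x \<in> carrier (G Mod H). \<forall>y\<in>carrier (G Mod H). x \<otimes>\<^bsub>G Mod H\<^esub> y = y \<otimes>\<^bsub>G Mod H\<^esub> x}"
  have C: "subgroup ?C (G Mod H)" by (rule h.H.subgroup_commuting) simp
  have "subgroup {x \<in> carrier G. H #> x \<in> ?C} G"
    using factgroup_subgroup_union_subgroup[OF C] factgroup_subgroup_union_char[OF C] by simp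
  moreover have "{x \<in> carrier G. H #> x \<in> ?C} = {x \<in> carrier G. \<forall>g\<in>carrier G. commutator G x g \<in> H}"
    using commutator_mem_iff by (auto simp: carrier_FactGroup)
  ultimately show ?thesis by simp
qed

section \<open>The series of iterated power subgroups\<close>

context p_group
begin

text \<open>The iteration of \<open>K \<mapsto> K\<^sup>p\<close>, starting with \<open>G\<close>.
  For powerful \<open>G\<close> it is a central series each of whose later terms consists of the
  \<open>p\<close>-th powers of its predecessor.\<close>

primrec pow_series :: "nat \<Rightarrow> 'a set" where
  "pow_series 0 = carrier G"
| "pow_series (Suc k) = generate G {x [^] p |x. x \<in> pow_series k}"

declare pow_series.simps(2) [simp del]

lemma pow_series_normal: "pow_series k \<lhd> G"
proof (induction k)
  case 0
  then show ?case using normal_self by simp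
next
  case (Suc k)
  then interpret K: normal "pow_series k" G .
  show ?case unfolding pow_series.simps
  proof (rule normal_generateI)
    show "{x [^] p |x. x \<in> pow_series k} \<subseteq> carrier G" by auto
    fix h g assume g: "g \<in> carrier G" and "h \<in> {x [^] p |x. x \<in> pow_series k}"
    then obtain x where x: "x \<in> pow_series k" "h = x [^] p" by blast
    then have "g \<otimes> h \<otimes> inv g = (g \<otimes> x \<otimes> inv g) [^] p" using g by (simp add: conj_pow)
    then show "g \<otimes> h \<otimes> inv g \<in> {x [^] p |x. x \<in> pow_series k}" using x g K.inv_op_closed2 by blast
  qed
qed

lemma subgroup_pow_series: "subgroup (pow_series k) G"
  using pow_series_normal normal_imp_subgroup by blast

lemma pow_series_closed [simp, intro]:
  "x \<in> pow_series k \<Longrightarrow> x \<in> carrier G"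
  "x \<in> pow_series k \<Longrightarrow> inv x \<in> pow_series k"
  "x \<in> pow_series k \<Longrightarrow> y \<in> pow_series k \<Longrightarrow> x \<otimes> y \<in> pow_series k"
  "\<one> \<in> pow_series k"
  using subgroup_pow_series[of k]
  by (auto dest: subgroup.mem_carrier subgroup.m_inv_closed subgroup.m_closed subgroup.one_closed)

lemma pow_in_pow_series: "x \<in> pow_series k \<Longrightarrow> x [^] p \<in> pow_series (Suc k)"
  unfolding pow_series.simps by (rule generate.incl) blast

lemma pow_series_Suc_subset: "pow_series (Suc k) \<subseteq> pow_series k"
  unfolding pow_series.simps
  by (rule generate_subgroup_incl[OF _ subgroup_pow_series])
     (use subgroup_pow_closed[OF subgroup_pow_series] in blast)

lemma pow_series_antimono: "j \<le> k \<Longrightarrow> pow_series k \<subseteq> pow_series j"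
  by (rule lift_Suc_antimono_le[of pow_series]) (rule pow_series_Suc_subset)

text \<open>Modulo a suitable \<open>N\<close> the term becomes a nontrivial cyclic group of order
  \<open>p\<close>, so its \<open>p\<close>-th powers all fall into \<open>N\<close> although the
  term itself does not.\<close>

lemma pow_series_Suc_psubset:
  assumes "pow_series k \<noteq> {\<one>}"
  shows "pow_series (Suc k) \<subset> pow_series k"
proof -
  have "\<not> pow_series k \<subseteq> {\<one>}" using assms pow_series_closed(4)[of k] by blast
  then obtain N z where N: "N \<lhd> G" "\<not> pow_series k \<subseteq> N" "z \<in> pow_series k" "z [^] p \<in> N"
    "\<And>a. a \<in> pow_series k \<Longrightarrow> \<exists>n\<in>N. \<exists>i::nat. a = n \<otimes> z [^] i"
    by (rule obtain_normal_avoiding[OF pow_series_normal one_is_normal]) blast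
  interpret N: normal N G by (fact N)
  interpret h: group_hom G "G Mod N" "\<lambda>x. N #> x" by (rule N.Mod_group_hom)
  have zc: "z \<in> carrier G" using N(3) by simp
  have "{x [^] p |x. x \<in> pow_series k} \<subseteq> N"
  proof clarify
    fix a assume "a \<in> pow_series k"
    then obtain n and i :: nat where n: "n \<in> N" "a = n \<otimes> z [^] i" using N(5) by blast
    have "N #> n = \<one>\<^bsub>G Mod N\<^esub>" using n N.coset_eq_one_iff by simp
    then have "N #> a = (N #> z) [^]\<^bsub>G Mod N\<^esub> i" using n zc by (simp add: h.hom_nat_pow)
    moreover have "(N #> z) [^]\<^bsub>G Mod N\<^esub> p = \<one>\<^bsub>G Mod N\<^esub>" using N(4) N.pow_mem_iff zc by simp
    ultimately have "(N #> a) [^]\<^bsub>G Mod N\<^esub> p = \<one>\<^bsub>G Mod N\<^esub>"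
      using zc by (simp add: h.H.nat_pow_pow h.H.pow_eq_one_dvd)
    moreover have "a \<in> carrier G" using n zc by simp
    ultimately show "a [^] p \<in> N" using N.pow_mem_iff by blast
  qed
  then have "pow_series (Suc k) \<subseteq> N"
    unfolding pow_series.simps by (rule generate_subgroup_incl) (rule N.is_subgroup)
  then show ?thesis using N(2) pow_series_Suc_subset by blast
qed

lemma pow_series_trivial: "\<exists>k. pow_series k = {\<one>}"
proof (rule ccontr)
  assume "\<not> ?thesis"
  then have ps: "pow_series (Suc k) \<subset> pow_series k" for k using pow_series_Suc_psubset by blast
  have "card (pow_series k) + k \<le> order G" for k
  proof (induction k)
    case (Suc k)
    have "card (pow_series (Suc k)) < card (pow_series k)"
      using ps subgroup_pow_series by (intro psubset_card_mono) auto
    then show ?case using Suc by linarith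
  qed (simp add: order_def)
  from this[of "Suc (order G)"] show False by simp
qed

lemma order_eq_card_coset: "N \<lhd> G \<Longrightarrow> order G = card N * order (G Mod N)"
  using normal.card_image_coset[OF _ fin subgroup_self subgroup.subset[OF normal_imp_subgroup], of N]
  by (simp add: order_def carrier_FactGroup)

lemma pow_series_Mod:
  assumes "N \<lhd> G"
  shows "p_group.pow_series (G Mod N) p k = (\<lambda>x. N #> x) ` pow_series k"
proof -
  interpret N: normal N G by (fact assms)
  interpret Q: p_group "G Mod N" p by (rule p_group_Mod[OF assms])
  interpret h: group_hom G "G Mod N" "\<lambda>x. N #> x" by (rule N.Mod_group_hom)
  show ?thesis
  proof (induction k)
    case (Suc k)
    have "{x [^]\<^bsub>G Mod N\<^esub> p |x. x \<in> (\<lambda>x. N #> x) ` pow_series k} = (\<lambda>x. N #> x) ` {x [^] p |x. x \<in> pow_series k}"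
      (is "?A = ?h ` ?B")
    proof (intro equalityI subsetI)
      show "u \<in> ?h ` ?B" if u: "u \<in> ?A" for u
      proof -
        obtain x where "x \<in> pow_series k" "u = ?h x [^]\<^bsub>G Mod N\<^esub> p" using u by blast
        then have "x [^] p \<in> ?B" "u = ?h (x [^] p)" by (auto simp: h.hom_nat_pow)
        then show ?thesis by blast
      qed
      show "u \<in> ?A" if u: "u \<in> ?h ` ?B" for u
      proof -
        obtain x where "x \<in> pow_series k" "u = ?h (x [^] p)" using u by blast
        then have "?h x \<in> ?h ` pow_series k" "u = ?h x [^]\<^bsub>G Mod N\<^esub> p" by (auto simp: h.hom_nat_pow)
        then show ?thesis by blast
      qed
    qed
    moreover have "{x [^] p |x. x \<in> pow_series k} \<subseteq> carrier G" by auto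
    ultimately show ?case using Suc h.generate_img by (simp add: pow_series.simps Q.pow_series.simps)
  qed (simp add: carrier_FactGroup)
qed

end

text \<open>The condition on single commutators is the one that passes directly to quotients;
  \<open>powerful_iff\<close> identifies it with \<open>powerful\<close>.\<close>

locale powerful_p_group = p_group +
  assumes p_ge_5: "p \<ge> 5"
    and commutator_in_pow_series_1: "x \<in> carrier G \<Longrightarrow> y \<in> carrier G \<Longrightarrow> commutator G x y \<in> pow_series 1"
begin

text \<open>Every term is powerfully embedded. Otherwise pass to a quotient where
  \<open>[P, G]\<close> is central, \<open>P\<close> being the term \<open>Suc k\<close>. For
  \<open>x\<close> in the term \<open>k\<close>, the factor \<open>c\<close> in
  \<open>g x g\<^sup>-1 = x c\<close> lies in \<open>P\<close>, so \<open>c\<^sup>p\<close> vanishes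
  and \<open>[c, x]\<close> is central there. Then \<open>g\<close> commutes with
  \<open>x\<^sup>p\<close>, and these powers generate \<open>P\<close>.\<close>

lemma commutator_pow_series:
  "x \<in> pow_series k \<Longrightarrow> g \<in> carrier G \<Longrightarrow> commutator G x g \<in> pow_series (Suc k)"
proof (induction k arbitrary: x g)
  case 0
  then show ?case using commutator_in_pow_series_1 by simp
next
  case (Suc k)
  let ?S = "{commutator G l g |l g. l \<in> pow_series (Suc k) \<and> g \<in> carrier G}"
  let ?A = "generate G ?S"
  have AS: "commutator G l g \<in> ?A" if "l \<in> pow_series (Suc k)" "g \<in> carrier G" for l g
    by (rule generate.incl) (use that in blast)
  show ?case
  proof (rule ccontr)
    assume "commutator G x g \<notin> pow_series (Suc (Suc k))"
    then have "\<not> ?A \<subseteq> pow_series (Suc (Suc k))" using AS Suc.prems by blast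
    then obtain N z where N: "N \<lhd> G" "pow_series (Suc (Suc k)) \<subseteq> N" "\<not> ?A \<subseteq> N"
      "\<And>a g. a \<in> ?A \<Longrightarrow> g \<in> carrier G \<Longrightarrow> commutator G a g \<in> N"
      by (rule obtain_normal_avoiding[OF commutators_with_normal[OF pow_series_normal] pow_series_normal]) blast
    interpret N: normal N G by (fact N)
    interpret Q: p_group "G Mod N" p by (rule p_group_Mod[OF N.normal_axioms])
    interpret h: group_hom G "G Mod N" "\<lambda>x. N #> x" by (rule N.Mod_group_hom)
    let ?h = "\<lambda>x. N #> x" and ?Q = "G Mod N"
    have gen: "?h (x [^] p) \<otimes>\<^bsub>?Q\<^esub> ?h g = ?h g \<otimes>\<^bsub>?Q\<^esub> ?h (x [^] p)"
      if x: "x \<in> pow_series k" and g: "g \<in> carrier G" for x g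
    proof -
      define c where "c = commutator G (inv x) g"
      define f where "f = commutator G (inv c) (inv x)"
      have c: "c \<in> pow_series (Suc k)" unfolding c_def using Suc.IH x g by simp
      have car: "x \<in> carrier G" "c \<in> carrier G" "f \<in> carrier G"
        using x c pow_series_closed(1)[of c "Suc k"] by (auto simp: f_def)
      have f: "f \<in> ?A" unfolding f_def using AS pow_series_closed(2)[OF c] car by simp
      have "(?h x \<otimes>\<^bsub>?Q\<^esub> ?h c) [^]\<^bsub>?Q\<^esub> p = ?h x [^]\<^bsub>?Q\<^esub> p"
      proof (rule Q.pow_mult_eq_pow(2)[OF p_ge_5, where f = "?h f"])
        have "c \<otimes> x = x \<otimes> c \<otimes> f" using car by (simp add: f_def commutator_def m_assoc)
        then show "?h c \<otimes>\<^bsub>?Q\<^esub> ?h x = ?h x \<otimes>\<^bsub>?Q\<^esub> ?h c \<otimes>\<^bsub>?Q\<^esub> ?h f"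
          using car by (metis h.hom_mult m_closed)
        show "?h f \<otimes>\<^bsub>?Q\<^esub> ?h x = ?h x \<otimes>\<^bsub>?Q\<^esub> ?h f" "?h f \<otimes>\<^bsub>?Q\<^esub> ?h c = ?h c \<otimes>\<^bsub>?Q\<^esub> ?h f"
          using N.commutator_mem_iff[of f] N(4)[OF f] car by blast+
        have "c [^] p \<in> N" using pow_in_pow_series[OF c] N(2) by blast
        then show "?h c [^]\<^bsub>?Q\<^esub> p = \<one>\<^bsub>?Q\<^esub>" using N.pow_mem_iff car by simp
      qed (use car in auto)
      moreover have "x \<otimes> c = g \<otimes> x \<otimes> inv g"
        using conj_eq_mult_commutator[of x g] car g by (simp add: c_def m_assoc)
      ultimately have "?h ((g \<otimes> x \<otimes> inv g) [^] p) = ?h (x [^] p)"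
        using car g by (metis h.hom_mult h.hom_nat_pow m_closed)
      then have "?h (g \<otimes> x [^] p \<otimes> inv g) = ?h (x [^] p)" using conj_pow car g by simp
      then have "?h g \<otimes>\<^bsub>?Q\<^esub> ?h (x [^] p) \<otimes>\<^bsub>?Q\<^esub> inv\<^bsub>?Q\<^esub> ?h g = ?h (x [^] p)"
        using car g by simp
      then show ?thesis
        using car g by (metis Q.inv_solve_right Q.m_closed h.hom_closed nat_pow_closed)
    qed
    let ?Z = "{x \<in> carrier G. \<forall>g\<in>carrier G. commutator G x g \<in> N}"
    note N.subgroup_central_mod
    moreover have "{x [^] p |x. x \<in> pow_series k} \<subseteq> ?Z"
      using gen N.commutator_mem_iff by auto
    ultimately have "pow_series (Suc k) \<subseteq> ?Z"
      unfolding pow_series.simps by (intro generate_subgroup_incl)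
    then have "?S \<subseteq> N" by blast
    then have "?A \<subseteq> N" by (rule generate_subgroup_incl) (rule N.is_subgroup)
    then show False using N(3) by blast
  qed
qed

text \<open>Modulo the term \<open>Suc (Suc j)\<close> the commutator of \<open>x\<close> and
  \<open>w\<close> is central with trivial \<open>p\<close>-th power, so the class 2 formula loses
  its correction.\<close>

lemma pow_mult_mod_pow_series:
  assumes x: "x \<in> carrier G" and w: "w \<in> pow_series j"
  obtains v where "v \<in> pow_series (Suc (Suc j))" "(x \<otimes> w) [^] p = x [^] p \<otimes> w [^] p \<otimes> v"
proof -
  let ?N = "pow_series (Suc (Suc j))"
  interpret N: normal ?N G by (rule pow_series_normal)
  interpret Q: p_group "G Mod ?N" p by (rule p_group_Mod[OF N.normal_axioms])
  interpret h: group_hom G "G Mod ?N" "\<lambda>x. ?N #> x" by (rule N.Mod_group_hom)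
  let ?h = "\<lambda>x. ?N #> x" and ?Q = "G Mod ?N"
  define c where "c = commutator G (inv w) (inv x)"
  have c: "c \<in> pow_series (Suc j)" unfolding c_def using commutator_pow_series x w by simp
  have car: "x \<in> carrier G" "w \<in> carrier G" "c \<in> carrier G"
    using x w pow_series_closed(1)[OF c] by auto
  have cent: "?h c \<otimes>\<^bsub>?Q\<^esub> ?h g = ?h g \<otimes>\<^bsub>?Q\<^esub> ?h c" if "g \<in> carrier G" for g
    using N.commutator_mem_iff[OF car(3) that] commutator_pow_series[OF c that] by blast
  have "w \<otimes> x = x \<otimes> w \<otimes> c" using car by (simp add: c_def commutator_def m_assoc)
  then have "?h w \<otimes>\<^bsub>?Q\<^esub> ?h x = ?h x \<otimes>\<^bsub>?Q\<^esub> ?h w \<otimes>\<^bsub>?Q\<^esub> ?h c"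
    using car by (metis h.hom_mult m_closed)
  then have "(?h x \<otimes>\<^bsub>?Q\<^esub> ?h w) [^]\<^bsub>?Q\<^esub> p
      = ?h x [^]\<^bsub>?Q\<^esub> p \<otimes>\<^bsub>?Q\<^esub> ?h w [^]\<^bsub>?Q\<^esub> p \<otimes>\<^bsub>?Q\<^esub> ?h c [^]\<^bsub>?Q\<^esub> (p choose 2)"
    using car cent by (intro Q.pow_mult_class2) auto
  moreover have "?h c [^]\<^bsub>?Q\<^esub> (p choose 2) = \<one>\<^bsub>?Q\<^esub>"
  proof (rule Q.pow_eq_one_dvd)
    show "?h c [^]\<^bsub>?Q\<^esub> p = \<one>\<^bsub>?Q\<^esub>"
      using N.pow_mem_iff[OF car(3)] pow_in_pow_series[OF c] by blast
    show "p dvd p choose 2" by (rule prime_dvd_choose_two_three[OF prime_p p_ge_5])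
  qed (use car in auto)
  ultimately have "?h (x [^] p \<otimes> w [^] p) = ?h ((x \<otimes> w) [^] p)"
    using car by (simp add: h.hom_nat_pow)
  then have "inv (x [^] p \<otimes> w [^] p) \<otimes> (x \<otimes> w) [^] p \<in> ?N"
    using car N.coset_eq_iff[of "x [^] p \<otimes> w [^] p" "(x \<otimes> w) [^] p"] by simp
  then show thesis
    by (rule that) (use car in simp)
qed

text \<open>The preceding congruence makes a product of \<open>p\<close>-th powers a
  \<open>p\<close>-th power up to an error two terms below \<open>w\<close>; induction over the
  generation of the subgroup collects the errors.\<close>

lemma pow_series_approx:
  assumes "z \<in> pow_series (Suc j)"
  shows "\<exists>w\<in>pow_series j. \<exists>v\<in>pow_series (Suc (Suc j)). z = w [^] p \<otimes> v"
  using assms unfolding pow_series.simps(2)[of j]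
proof (induction z rule: generate.induct)
  case one
  have "\<one> = \<one> [^] p \<otimes> \<one>" by simp
  then show ?case using pow_series_closed(4) by blast
next
  case (incl h)
  then obtain x where "x \<in> pow_series j" "h = x [^] p" by blast
  moreover from this have "h = x [^] p \<otimes> \<one>" by simp
  ultimately show ?case using pow_series_closed(4) by blast
next
  case (inv h)
  then obtain x where x: "x \<in> pow_series j" "h = x [^] p" by blast
  then have "inv h = (inv x) [^] p \<otimes> \<one>" by (simp add: nat_pow_inv)
  then show ?case using x pow_series_closed(2,4) by blast
next
  case (eng h1 h2)
  let ?N = "pow_series (Suc (Suc j))"
  interpret N: normal ?N G by (rule pow_series_normal)
  obtain w1 v1 w2 v2 where wv: "w1 \<in> pow_series j" "v1 \<in> ?N" "h1 = w1 [^] p \<otimes> v1"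
    "w2 \<in> pow_series j" "v2 \<in> ?N" "h2 = w2 [^] p \<otimes> v2" using eng.IH by blast
  have car: "w1 \<in> carrier G" "w2 \<in> carrier G" "v1 \<in> carrier G" "v2 \<in> carrier G"
    using wv(1,4) N.mem_carrier[OF wv(2)] N.mem_carrier[OF wv(5)] by auto
  obtain v where v: "v \<in> ?N" "(w1 \<otimes> w2) [^] p = w1 [^] p \<otimes> w2 [^] p \<otimes> v"
    using pow_mult_mod_pow_series[OF car(1) wv(4)] by blast
  have vc: "v \<in> carrier G" using N.mem_carrier[OF v(1)] .
  let ?u = "inv v \<otimes> (inv (w2 [^] p) \<otimes> v1 \<otimes> w2 [^] p) \<otimes> v2"
  have "h1 \<otimes> h2 = (w1 \<otimes> w2) [^] p \<otimes> ?u"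
    unfolding v(2) wv(3,6) using car vc by (simp add: m_assoc)
  moreover have "inv (w2 [^] p) \<otimes> v1 \<otimes> w2 [^] p \<in> ?N" using N.inv_op_closed1 car wv(2) by blast
  then have "?u \<in> ?N" using v(1) wv(5) by blast
  moreover have "w1 \<otimes> w2 \<in> pow_series j" using wv by blast
  ultimately show ?case by blast
qed

text \<open>Successive approximation as in Hensel's lemma: the error \<open>v\<close> is itself
  nearly a \<open>p\<close>-th power \<open>w [^] p\<close>, and replacing \<open>h\<close> by
  \<open>h \<otimes> w\<close> pushes it one term down, until the series is trivial.\<close>

lemma pow_series_Suc_imp_pow:
  assumes g: "g \<in> pow_series (Suc k)"
  obtains h where "h \<in> pow_series k" "g = h [^] p"
proof -
  have approx: "\<exists>h\<in>pow_series k. \<exists>v\<in>pow_series (Suc (k + n)). g = h [^] p \<otimes> v" for n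
  proof (induction n)
    case 0
    have "g = \<one> [^] p \<otimes> g" using pow_series_closed(1)[OF g] by simp
    then show ?case using g pow_series_closed(4)[of k] by (intro bexI[of _ \<one>] bexI[of _ g]) simp_all
  next
    case (Suc n)
    then obtain h v where hv: "h \<in> pow_series k" "v \<in> pow_series (Suc (k + n))" "g = h [^] p \<otimes> v" by blast
    obtain w v' where w: "w \<in> pow_series (k + n)" "v' \<in> pow_series (Suc (Suc (k + n)))" "v = w [^] p \<otimes> v'"
      using pow_series_approx[OF hv(2)] by blast
    have hc: "h \<in> carrier G" "w \<in> carrier G" "v' \<in> carrier G"
      using hv(1) w(1) pow_series_closed(1)[OF w(2)] by auto
    obtain u where u: "u \<in> pow_series (Suc (Suc (k + n)))" "(h \<otimes> w) [^] p = h [^] p \<otimes> w [^] p \<otimes> u"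
      using pow_mult_mod_pow_series[OF hc(1) w(1)] by blast
    have "u \<in> carrier G" using pow_series_closed(1)[OF u(1)] .
    then have "g = (h \<otimes> w) [^] p \<otimes> (inv u \<otimes> v')" unfolding hv(3) w(3) u(2) using hc by (simp add: m_assoc)
    moreover have "inv u \<otimes> v' \<in> pow_series (Suc (k + Suc n))"
      using pow_series_closed(3)[OF pow_series_closed(2)[OF u(1)] w(2)] by simp
    moreover have "w \<in> pow_series k" using w(1) pow_series_antimono[of k "k + n"] by auto
    then have "h \<otimes> w \<in> pow_series k" using hv(1) by simp
    ultimately show ?case by blast
  qed
  obtain m where m: "pow_series m = {\<one>}" using pow_series_trivial by blast
  obtain h v where hv: "h \<in> pow_series k" "v \<in> pow_series (Suc (k + m))" "g = h [^] p \<otimes> v"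
    using approx by blast
  have "v \<in> pow_series m" using pow_series_antimono[of m "Suc (k + m)"] hv(2) by auto
  then have "g = h [^] p" using m hv(1,3) by simp
  then show thesis using that hv(1) by blast
qed

end

section \<open>Elements of prime order in powerful groups\<close>

context p_group
begin

text \<open>The two clauses say that in \<open>G/N\<close> the elements of order dividing \<open>p\<close> form a subgroup, which commutes
  with its intersection with \<open>(G/N)\<^sup>p\<close>. They are phrased inside \<open>G\<close> because quotients change the type and
  thus do not admit a direct induction.\<close>

definition omega_regular_mod :: "'a set \<Rightarrow> bool" where
  "omega_regular_mod N \<longleftrightarrow>
     (\<forall>x\<in>carrier G. \<forall>y\<in>carrier G. x [^] p \<in> N \<longrightarrow> y [^] p \<in> N \<longrightarrow> (x \<otimes> y) [^] p \<in> N) \<and>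
     (\<forall>x\<in>pow_series 1. \<forall>y\<in>carrier G. x [^] p \<in> N \<longrightarrow> y [^] p \<in> N \<longrightarrow> commutator G x y \<in> N)"

lemma omega_regular_modD:
  assumes "omega_regular_mod N"
  shows "x \<in> carrier G \<Longrightarrow> y \<in> carrier G \<Longrightarrow> x [^] p \<in> N \<Longrightarrow> y [^] p \<in> N \<Longrightarrow> (x \<otimes> y) [^] p \<in> N"
    and "x \<in> pow_series 1 \<Longrightarrow> y \<in> carrier G \<Longrightarrow> x [^] p \<in> N \<Longrightarrow> y [^] p \<in> N \<Longrightarrow> commutator G x y \<in> N"
  using assms unfolding omega_regular_mod_def by blast+

end

context powerful_p_group
begin

text \<open>Here \<open>n\<close> is taken from the last nontrivial term of the series. As the next
  term is trivial, \<open>n\<close> is central with trivial \<open>p\<close>-th power; the root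
  \<open>s\<close> one term higher is kept for the later count of fibres.\<close>

lemma obtain_central_pow:
  assumes "pow_series 1 \<noteq> {\<one>}"
  obtains k s n where "s \<in> pow_series k" "pow_series (Suc (Suc k)) = {\<one>}"
    "n = s [^] p" "n \<noteq> \<one>" "n [^] p = \<one>" "n \<in> pow_series 1"
    "{n [^] (i::nat) |i. True} \<lhd> G" "card {n [^] (i::nat) |i. True} \<le> p" "{n [^] (i::nat) |i. True} \<subseteq> pow_series 1"
    "\<And>g. g \<in> carrier G \<Longrightarrow> n \<otimes> g = g \<otimes> n"
proof -
  define m where "m = (LEAST m. pow_series m = {\<one>})"
  have m: "pow_series m = {\<one>}" unfolding m_def by (rule LeastI_ex) (rule pow_series_trivial)
  have lm: "pow_series j \<noteq> {\<one>}" if "j < m" for j using that not_less_Least unfolding m_def by blast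
  have "m \<noteq> 1" using m assms by blast
  moreover have "m \<noteq> 0"
  proof
    assume "m = 0"
    then have "pow_series 1 \<subseteq> {\<one>}" using m pow_series_antimono[of 0 1] by simp
    then show False using assms pow_series_closed(4)[of 1] by blast
  qed
  ultimately obtain k where k: "m = Suc (Suc k)" by (metis One_nat_def not0_implies_Suc)
  then have "pow_series (Suc k) \<noteq> {\<one>}" using lm by simp
  then obtain n where n: "n \<in> pow_series (Suc k)" "n \<noteq> \<one>" using pow_series_closed(4)[of "Suc k"] by blast
  obtain s where s: "s \<in> pow_series k" "n = s [^] p" using n(1) by (rule pow_series_Suc_imp_pow)
  have nc: "n \<in> carrier G" using pow_series_closed(1)[OF n(1)] .
  have n1: "n \<in> pow_series 1" using n(1) pow_series_antimono[of 1 "Suc k"] by auto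
  have np: "n [^] p = \<one>" using pow_in_pow_series[OF n(1)] m k by simp
  have com: "commutator G n g \<in> {\<one>}" if "g \<in> carrier G" for g
    using commutator_pow_series[OF n(1) that] m k by simp
  have eq: "{a \<otimes> n [^] (i::nat) |a i. a \<in> {\<one>}} = {n [^] (i::nat) |i. True}" using nc by auto
  have norm: "n \<otimes> a \<otimes> inv n \<in> {\<one>}" if "a \<in> {\<one>}" for a using that nc by simp
  have 1: "{n [^] (i::nat) |i. True} \<lhd> G"
    using adjoin_central_normal[OF one_is_normal nc _ com] np unfolding eq by simp
  have 2: "card {n [^] (i::nat) |i. True} \<le> p"
    using adjoin_normalizing(2)[OF triv_subgroup nc _ p_pos norm] np unfolding eq by simp
  have 3: "{n [^] (i::nat) |i. True} \<subseteq> pow_series 1"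
    using subgroup_pow_closed[OF subgroup_pow_series n1] by blast
  have 4: "n \<otimes> g = g \<otimes> n" if "g \<in> carrier G" for g
    using com[OF that] commutator_eq_one_iff nc that by simp
  show thesis
    by (rule that[OF s(1) _ s(2) n(2) np n1 1 2 3 4]) (use m k in simp)
qed

text \<open>Regularity modulo the central subgroup \<open>?M\<close> of exponent \<open>p\<close>
  places \<open>d\<close> and \<open>e\<close> in \<open>?M\<close>. The collection formula then has
  harmless corrections, provided that \<open>c [^] p = \<one>\<close>.\<close>

lemma Omega_closed_step:
  assumes IH: "\<And>M. M \<lhd> G \<Longrightarrow> M \<noteq> {\<one>} \<Longrightarrow> omega_regular_mod M"
    and xy: "x \<in> carrier G" "y \<in> carrier G" "x [^] p = \<one>" "y [^] p = \<one>"
  shows "(x \<otimes> y) [^] p = \<one>"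
proof (cases "pow_series 1 = {\<one>}")
  case True
  then show ?thesis using xy pow_in_pow_series[of "x \<otimes> y" 0] by simp
next
  case False
  then obtain n where n: "n \<noteq> \<one>" "n [^] p = \<one>" "n \<in> pow_series 1" "{n [^] (i::nat) |i. True} \<lhd> G"
    "\<And>g. g \<in> carrier G \<Longrightarrow> n \<otimes> g = g \<otimes> n"
    by (rule obtain_central_pow) blast
  let ?M = "{n [^] (i::nat) |i. True}"
  have nc: "n \<in> carrier G" using n(3) by simp
  have "n [^] (1::nat) \<in> ?M" by blast
  then have "?M \<noteq> {\<one>}" using n(1) nc by auto
  note reg = omega_regular_modD[OF IH[OF n(4) this]]
  have M: "u \<in> carrier G" "u [^] p = \<one>" "u \<otimes> g = g \<otimes> u" if "u \<in> ?M" "g \<in> carrier G" for u g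
  proof -
    obtain i :: nat where i: "u = n [^] i" using \<open>u \<in> ?M\<close> by blast
    show "u \<in> carrier G" using i nc by simp
    show "u [^] p = \<one>" unfolding i using pow_eq_one_dvd[OF nc n(2)] nc by (simp add: nat_pow_pow)
    show "u \<otimes> g = g \<otimes> u" using i nc commute_pow[of g n i] n(5) \<open>g \<in> carrier G\<close> by simp
  qed
  have M1: "\<one> \<in> ?M" using subgroup.one_closed[OF normal_imp_subgroup[OF n(4)]] .
  define c where "c = commutator G (inv x) y"
  define d where "d = commutator G (inv c) y"
  define e where "e = commutator G (inv c) (inv x)"
  have c: "c \<in> pow_series 1" unfolding c_def using commutator_in_pow_series_1 xy by simp
  have car: "x \<in> carrier G" "y \<in> carrier G" "c \<in> carrier G" "d \<in> carrier G" "e \<in> carrier G"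
    using xy by (auto simp: c_def d_def e_def)
  have yx: "y \<otimes> x = x \<otimes> c \<otimes> y" unfolding c_def by (rule conj_eq_mult_commutator) (use car in auto)
  have yc: "y \<otimes> c = c \<otimes> d \<otimes> y" unfolding d_def by (rule conj_eq_mult_commutator) (use car in auto)
  have cx: "c \<otimes> x = x \<otimes> c \<otimes> e" using car by (simp add: e_def commutator_def m_assoc)
  have cc: "x \<otimes> c = y \<otimes> x \<otimes> inv y" using yx car by (simp add: m_assoc)
  have conj: "(y \<otimes> x \<otimes> inv y) [^] p = \<one>" using xy by (simp add: conj_pow)
  \<comment> \<open>A product of two elements with trivial \<open>p\<close>-th power, so regularity
    gives \<open>c [^] p \<in> ?M\<close>.\<close>
  have "c = inv x \<otimes> (y \<otimes> x \<otimes> inv y)" using cc car by (metis inv_mult_cancel(1))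
  then have cp: "c [^] p \<in> ?M"
    using reg(1)[of "inv x" "y \<otimes> x \<otimes> inv y"] xy conj M1 by (simp add: nat_pow_inv)
  then have "inv (c [^] p) \<in> ?M" by (rule subgroup.m_inv_closed[OF normal_imp_subgroup[OF n(4)]])
  then have icp: "(inv c) [^] p \<in> ?M" using car by (simp add: nat_pow_inv)
  have d: "d \<in> ?M" unfolding d_def using reg(2)[of "inv c" y] c icp xy M1 by simp
  have e: "e \<in> ?M" unfolding e_def using reg(2)[of "inv c" "inv x"] c icp xy M1 by (simp add: nat_pow_inv)
  note dvd = prime_dvd_choose_two_three[OF prime_p p_ge_5]
  have ep: "e [^] (p choose 2) = \<one>" using pow_eq_one_dvd[OF car(5) M(2)[OF e car(1)]] dvd by simp
  \<comment> \<open>The left side is the \<open>p\<close>-th power of a conjugate of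
    \<open>x\<close>, hence trivial. This improves \<open>c [^] p \<in> ?M\<close> to
    \<open>c [^] p = \<one>\<close>.\<close>
  have "(x \<otimes> c) [^] p = x [^] p \<otimes> c [^] p \<otimes> e [^] (p choose 2)"
    by (rule pow_mult_class2[OF car(1,3,5) cx M(3)[OF e car(1)] M(3)[OF e car(3)]])
  then have "c [^] p = \<one>" using conj ep car xy unfolding cc by simp
  then have c2: "c [^] (p choose 2) = \<one>" using pow_eq_one_dvd car dvd by simp
  have "d \<otimes> e \<in> ?M" using subgroup.m_closed[OF normal_imp_subgroup[OF n(4)] d e] .
  then have "(d \<otimes> e) [^] p = \<one>" by (rule M(2)[OF _ car(1)])
  then have "(d \<otimes> e) [^] (p choose 3) = \<one>" using pow_eq_one_dvd car dvd by simp
  moreover have "(x \<otimes> y) [^] p = x [^] p \<otimes> c [^] (p choose 2) \<otimes> (d \<otimes> e) [^] (p choose 3) \<otimes> y [^] p"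
    by (rule pow_mult_class3[OF car yx yc cx]) (rule M(3) d e car)+
  ultimately show ?thesis using c2 car xy by simp
qed

text \<open>By the preceding lemma the elements with trivial \<open>p\<close>-th power form a normal
  subgroup \<open>T\<close>, nontrivial because it contains \<open>n\<close>, so regularity modulo
  \<open>T\<close> is available. Elements of \<open>T\<close> deep in the power series are shown to
  commute with everything of order dividing \<open>p\<close> modulo \<open>T\<close>, working
  upwards from the trivial end.\<close>

lemma Omega_commute_step:
  assumes IH: "\<And>M. M \<lhd> G \<Longrightarrow> M \<noteq> {\<one>} \<Longrightarrow> omega_regular_mod M"
    and xy: "x \<in> pow_series 1" "y \<in> carrier G" "x [^] p = \<one>" "y [^] p = \<one>"
  shows "commutator G x y = \<one>"
proof (cases "pow_series 1 = {\<one>}")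
  case True
  then show ?thesis using xy by (simp add: commutator_def)
next
  case False
  then obtain n where n: "n \<noteq> \<one>" "n [^] p = \<one>" "n \<in> pow_series 1"
    by (rule obtain_central_pow) blast
  define T where "T = {x \<in> carrier G. x [^] p = \<one>}"
  have "subgroup T G" unfolding T_def
  proof (rule subgroupI)
    have "\<one> \<in> {x \<in> carrier G. x [^] p = \<one>}" by simp
    then show "{x \<in> carrier G. x [^] p = \<one>} \<noteq> {}" by blast
  qed (use Omega_closed_step[OF IH] in \<open>auto simp: nat_pow_inv\<close>)
  then have Tn: "T \<lhd> G"
    by (rule normal_invI) (auto simp: T_def conj_pow)
  interpret T: normal T G by (fact Tn)
  have "n \<in> T" unfolding T_def using n(2) pow_series_closed(1)[OF n(3)] by blast
  then have "T \<noteq> {\<one>}" using n(1) by blast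
  note reg = omega_regular_modD(2)[OF IH[OF Tn this]]
  have TI: "u \<in> T" if "u \<in> carrier G" "u [^] p = \<one>" for u using that unfolding T_def by blast
  have TD: "u [^] p = \<one>" if "u \<in> T" for u using that unfolding T_def by blast
  have Tp: "u [^] p \<in> T" if "u \<in> T" for u using TD[OF that] T.one_closed by simp
  \<comment> \<open>The conjugate of \<open>h\<close> by \<open>g\<close> is
    \<open>h \<otimes> u\<close> with \<open>u \<in> T\<close>; once
    \<open>[u\<^sup>-1, h\<^sup>-1]\<close> commutes with \<open>h\<close> and \<open>u\<close>, the
    \<open>p\<close>-th powers of both agree.\<close>
  have key: "h [^] p \<otimes> g = g \<otimes> h [^] p"
    if hg: "h \<in> carrier G" "g \<in> carrier G" and u: "u = commutator G (inv h) g" "u \<in> T"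
      and w: "\<And>v. v \<in> carrier G \<Longrightarrow> v [^] p \<in> T \<Longrightarrow>
        commutator G (inv u) (inv h) \<otimes> v = v \<otimes> commutator G (inv u) (inv h)"
      and hT: "h [^] p \<in> T" for h g u
  proof -
    let ?w = "commutator G (inv u) (inv h)"
    have uc: "u \<in> carrier G" using u(2) by simp
    have "(h \<otimes> u) [^] p = h [^] p"
    proof (rule pow_mult_eq_pow(2)[OF p_ge_5 hg(1) uc])
      show "?w \<in> carrier G" using hg uc by simp
      show "u \<otimes> h = h \<otimes> u \<otimes> ?w" using hg uc by (simp add: commutator_def m_assoc)
      show "?w \<otimes> h = h \<otimes> ?w" by (rule w[OF hg(1) hT])
      show "?w \<otimes> u = u \<otimes> ?w" by (rule w[OF uc Tp[OF u(2)]])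
      show "u [^] p = \<one>" by (rule TD[OF u(2)])
    qed
    moreover have "h \<otimes> u = g \<otimes> h \<otimes> inv g"
      using conj_eq_mult_commutator[OF hg] hg uc by (simp add: u(1) m_assoc)
    ultimately have "g \<otimes> h [^] p \<otimes> inv g = h [^] p" using conj_pow[OF hg, of p] by simp
    then show ?thesis using hg by (metis inv_solve_right m_closed nat_pow_closed)
  qed
  obtain K where K: "pow_series K = {\<one>}" using pow_series_trivial by blast
  \<comment> \<open>Descending induction on \<open>m\<close>, expressed through
    \<open>K \<le> m + i\<close>. The bound \<open>m \<ge> 2\<close> puts the root \<open>h\<close>
    of \<open>t\<close> into \<open>pow_series 1\<close>, as regularity demands; the new commutator
    lies one term deeper than \<open>t\<close>.\<close>
  have claim: "\<forall>m\<ge>2. K \<le> m + i \<longrightarrow> (\<forall>t\<in>T \<inter> pow_series m. \<forall>g\<in>carrier G. g [^] p \<in> T \<longrightarrow> t \<otimes> g = g \<otimes> t)" for i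
  proof (induction i)
    case 0
    show ?case
    proof (intro allI impI ballI)
      fix m t g assume "K \<le> m + 0" "t \<in> T \<inter> pow_series m" and g: "g \<in> carrier G"
      then have "t = \<one>" using K pow_series_antimono[of K m] by auto
      then show "t \<otimes> g = g \<otimes> t" using g by simp
    qed
  next
    case (Suc i)
    show ?case
    proof (intro allI impI ballI)
      fix m t g assume m: "2 \<le> m" "K \<le> m + Suc i" and t: "t \<in> T \<inter> pow_series m"
        and g: "g \<in> carrier G" "g [^] p \<in> T"
      obtain m' where m': "m = Suc m'" "1 \<le> m'" using m(1) by (cases m) auto
      have "t \<in> pow_series (Suc m')" using t m' by simp
      then obtain h where h: "h \<in> pow_series m'" "t = h [^] p" by (rule pow_series_Suc_imp_pow)
      have hc: "h \<in> carrier G" using h by simp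
      have h1: "h \<in> pow_series 1" using h(1) pow_series_antimono[OF m'(2)] by blast
      have hT: "h [^] p \<in> T" using t h by simp
      define u where "u = commutator G (inv h) g"
      have u: "u \<in> T" unfolding u_def using reg[of "inv h" g] h1 g hT hc by (simp add: nat_pow_inv)
      have um: "u \<in> pow_series m" unfolding u_def m'(1) using commutator_pow_series h g by simp
      let ?w = "commutator G (inv u) (inv h)"
      have "?w \<in> T" using commutator_in_normal[OF Tn] u hc by simp
      moreover have "?w \<in> pow_series (Suc m)" using commutator_pow_series um hc by simp
      ultimately have "?w \<otimes> v = v \<otimes> ?w" if "v \<in> carrier G" "v [^] p \<in> T" for v
        using Suc[rule_format, of "Suc m" ?w v] m that by simp
      then show "t \<otimes> g = g \<otimes> t" unfolding h(2) using key[OF hc g(1) u_def u _ hT] by blast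
    qed
  qed
  obtain g where "g \<in> pow_series 0" and g: "x = g [^] p"
    using xy(1) pow_series_Suc_imp_pow[of x 0] by auto
  then have gc: "g \<in> carrier G" by simp
  have xT: "x \<in> T" "y \<in> T" using xy by (auto intro: TI)
  define u where "u = commutator G (inv g) y"
  have u: "u \<in> T" unfolding u_def using commutator_in_normal[OF Tn] gc xT by simp
  have u1: "u \<in> pow_series 1" unfolding u_def using commutator_in_pow_series_1 gc xy by simp
  let ?w = "commutator G (inv u) (inv g)"
  have "?w \<in> T" using commutator_in_normal[OF Tn] u gc by simp
  moreover have "?w \<in> pow_series 2"
    using commutator_pow_series[of "inv u" 1 "inv g"] u1 gc by (simp add: numeral_2_eq_2)
  ultimately have "?w \<otimes> v = v \<otimes> ?w" if "v \<in> carrier G" "v [^] p \<in> T" for v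
    using claim[rule_format, of 2 K ?w v] that by simp
  then have "x \<otimes> y = y \<otimes> x" unfolding g using key[OF gc xy(2) u_def u] xT(1) g by blast
  then show ?thesis using commutator_eq_one_iff xy by simp
qed

lemma powerful_Mod:
  assumes "N \<lhd> G"
  shows "powerful_p_group (G Mod N) p"
proof -
  interpret N: normal N G by (fact assms)
  interpret Q: p_group "G Mod N" p by (rule p_group_Mod[OF assms])
  interpret h: group_hom G "G Mod N" "\<lambda>x. N #> x" by (rule N.Mod_group_hom)
  show ?thesis
  proof
    fix x y assume "x \<in> carrier (G Mod N)" "y \<in> carrier (G Mod N)"
    then obtain a b where "a \<in> carrier G" "b \<in> carrier G" "x = N #> a" "y = N #> b"
      by (auto simp: carrier_FactGroup)
    then show "commutator (G Mod N) x y \<in> Q.pow_series 1"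
      unfolding pow_series_Mod[OF assms] using commutator_in_pow_series_1 by (simp flip: h.hom_commutator)
  qed (rule p_ge_5)
qed

text \<open>Applied to \<open>G Mod N\<close>, the two step lemmas ask for regularity modulo
  nontrivial normal subgroups of the quotient. Their preimages in \<open>G\<close> are normal and
  larger than \<open>N\<close>, so the induction descends on \<open>order G - card N\<close> and
  never leaves \<open>G\<close>.\<close>

lemma all_omega_regular_mod: "N \<lhd> G \<Longrightarrow> omega_regular_mod N"
proof (induction "order G - card N" arbitrary: N rule: less_induct)
  case less
  interpret N: normal N G by (fact less.prems)
  interpret Q: powerful_p_group "G Mod N" p by (rule powerful_Mod[OF less.prems])
  interpret h: group_hom G "G Mod N" "\<lambda>x. N #> x" by (rule N.Mod_group_hom)
  let ?h = "\<lambda>x. N #> x" and ?Q = "G Mod N"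
  have IH: "Q.omega_regular_mod M" if M: "M \<lhd> ?Q" "M \<noteq> {\<one>\<^bsub>?Q\<^esub>}" for M
  proof -
    interpret M: normal M ?Q by (fact M)
    define M' where "M' = {x \<in> carrier G. ?h x \<in> M}"
    have M'n: "M' \<lhd> G"
      unfolding M'_def using N.factgroup_subgroup_union_normal[OF M(1)]
        N.factgroup_subgroup_union_char[OF M.is_subgroup] by simp
    have "card M' = card N * card M"
      unfolding M'_def using fin M.subset by (rule N.card_coset_preimage)
    moreover have "card N > 0" using subgroup.finite_imp_card_positive[OF N.is_subgroup fin] .
    moreover have "p \<le> card M"
      using Q.dvd_card_subgroup[OF M.is_subgroup M(2)] subgroup.finite_imp_card_positive[OF M.is_subgroup Q.fin]
      by (simp add: dvd_imp_le)
    then have "card M > 1" using p_ge_5 by simp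
    ultimately have "card N < card M'" by simp
    moreover have "card M' \<le> order G"
      unfolding M'_def order_def using fin by (intro card_mono) auto
    ultimately have "omega_regular_mod M'" by (intro less.hyps[OF _ M'n]) simp
    note reg = omega_regular_modD[OF this]
    have pw: "x [^] p \<in> M'" if "x \<in> carrier G" "?h x [^]\<^bsub>?Q\<^esub> p \<in> M" for x
      using that by (simp add: M'_def h.hom_nat_pow)
    show ?thesis unfolding Q.omega_regular_mod_def
    proof (intro conjI ballI impI)
      fix x y assume "x \<in> carrier ?Q" "y \<in> carrier ?Q" and xp: "x [^]\<^bsub>?Q\<^esub> p \<in> M" "y [^]\<^bsub>?Q\<^esub> p \<in> M"
      then obtain a b where ab: "a \<in> carrier G" "b \<in> carrier G" "x = ?h a" "y = ?h b"
        by (auto simp: carrier_FactGroup)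
      then have "(a \<otimes> b) [^] p \<in> M'" using reg(1) pw xp by simp
      then show "(x \<otimes>\<^bsub>?Q\<^esub> y) [^]\<^bsub>?Q\<^esub> p \<in> M" using ab by (simp add: M'_def h.hom_nat_pow)
    next
      fix x y assume "x \<in> Q.pow_series 1" "y \<in> carrier ?Q" and xp: "x [^]\<^bsub>?Q\<^esub> p \<in> M" "y [^]\<^bsub>?Q\<^esub> p \<in> M"
      then obtain a b where ab: "a \<in> pow_series 1" "b \<in> carrier G" "x = ?h a" "y = ?h b"
        unfolding pow_series_Mod[OF less.prems] by (auto simp: carrier_FactGroup)
      then have "commutator G a b \<in> M'" using reg(2)[OF ab(1,2)] pw[of a] pw[of b] xp by simp
      then show "commutator ?Q x y \<in> M" using ab by (simp add: M'_def h.hom_commutator)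
    qed
  qed
  show ?case unfolding omega_regular_mod_def
  proof (intro conjI ballI impI)
    fix x y assume xy: "x \<in> carrier G" "y \<in> carrier G" "x [^] p \<in> N" "y [^] p \<in> N"
    then have "(?h x \<otimes>\<^bsub>?Q\<^esub> ?h y) [^]\<^bsub>?Q\<^esub> p = \<one>\<^bsub>?Q\<^esub>"
      using N.pow_mem_iff by (intro Q.Omega_closed_step[OF IH]) auto
    then show "(x \<otimes> y) [^] p \<in> N" using N.pow_mem_iff[of "x \<otimes> y" p] xy by simp
  next
    fix x y assume xy: "x \<in> pow_series 1" "y \<in> carrier G" "x [^] p \<in> N" "y [^] p \<in> N"
    then have "?h x \<in> Q.pow_series 1" unfolding pow_series_Mod[OF less.prems] by blast
    then have "commutator ?Q (?h x) (?h y) = \<one>\<^bsub>?Q\<^esub>"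
      using N.pow_mem_iff xy by (intro Q.Omega_commute_step[OF IH]) auto
    then show "commutator G x y \<in> N"
      using N.coset_eq_one_iff[of "commutator G x y"] xy by (simp add: h.hom_commutator)
  qed
qed

text \<open>Take \<open>s\<close> in the last but one and \<open>s\<^sup>p \<noteq> 1\<close> in the last nontrivial term of the power series.
  Multiplication by \<open>s\<close> permutes cyclically the \<open>p\<close> fibres of \<open>x \<mapsto> x\<^sup>p\<close> over \<open>\<langle>s\<^sup>p\<rangle>\<close>.\<close>

lemma card_omega_step:
  assumes IH: "\<And>M. M \<lhd> G \<Longrightarrow> M \<noteq> {\<one>} \<Longrightarrow> M \<subseteq> pow_series 1 \<Longrightarrow>
    card {x \<in> carrier G. x [^] p \<in> M} * card (pow_series 1) \<le> order G * card M"
  shows "card {x \<in> carrier G. x [^] p = \<one>} * card (pow_series 1) \<le> order G"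
proof (cases "pow_series 1 = {\<one>}")
  case True
  then show ?thesis using fin by (simp add: order_def card_mono)
next
  case False
  then obtain k s n where n: "s \<in> pow_series k" "pow_series (Suc (Suc k)) = {\<one>}"
    "n = s [^] p" "n \<noteq> \<one>" "n [^] p = \<one>" "{n [^] (i::nat) |i. True} \<lhd> G"
    "card {n [^] (i::nat) |i. True} \<le> p" "{n [^] (i::nat) |i. True} \<subseteq> pow_series 1"
    by (rule obtain_central_pow) blast
  let ?M = "{n [^] (i::nat) |i. True}" and ?T = "{x \<in> carrier G. x [^] p = \<one>}"
  have sc: "s \<in> carrier G" using n(1) by simp
  have nc: "n \<in> carrier G" using n(3) sc by simp
  have "n [^] (1::nat) \<in> ?M" by blast
  then have "?M \<noteq> {\<one>}" using n(4) nc by auto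
  then have le: "card {x \<in> carrier G. x [^] p \<in> ?M} * card (pow_series 1) \<le> order G * card ?M"
    using IH[OF n(6) _ n(8)] by blast
  \<comment> \<open>The error in the product formula lies in the trivial term
    \<open>Suc (Suc k)\<close>, so the equation is exact.\<close>
  have tp: "(t \<otimes> s [^] i) [^] p = n [^] i" if "t \<in> ?T" for t and i :: nat
  proof -
    have si: "s [^] i \<in> pow_series k" using subgroup_pow_closed[OF subgroup_pow_series n(1)] .
    obtain v where "v \<in> pow_series (Suc (Suc k))" "(t \<otimes> s [^] i) [^] p = t [^] p \<otimes> (s [^] i) [^] p \<otimes> v"
      using pow_mult_mod_pow_series[OF _ si] \<open>t \<in> ?T\<close> by blast
    then show ?thesis using n(2,3) that sc by (simp add: nat_pow_pow mult.commute)
  qed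
  have "ord n dvd p" using n(5) pow_eq_id nc by blast
  then have ordn: "ord n = p" using n(4) nc ord_eq_1 prime_p by (metis prime_nat_iff)
  have inj: "inj_on (\<lambda>(t, i). t \<otimes> s [^] i) (?T \<times> {..<p})"
  proof (rule inj_onI)
    fix u v assume uv: "u \<in> ?T \<times> {..<p}" "v \<in> ?T \<times> {..<p}"
      and equ: "(\<lambda>(t, i). t \<otimes> s [^] i) u = (\<lambda>(t, i). t \<otimes> s [^] i) v"
    obtain t i t' j where tt: "u = (t, i)" "v = (t', j)" by (cases u, cases v)
    have t: "t \<in> carrier G" "t [^] p = \<one>" "t' \<in> carrier G" "t' [^] p = \<one>"
      and ij: "i \<in> {..<p}" "j \<in> {..<p}" and eq: "t \<otimes> s [^] i = t' \<otimes> s [^] j"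
      using uv equ unfolding tt by auto
    have "n [^] i = n [^] j" using tp[of t i] tp[of t' j] t eq by simp
    then have "i = j"
      using inj_onD[OF ord_inj[OF nc], of i j] ij unfolding ordn by auto
    then show "u = v" unfolding tt using eq t sc by simp
  qed
  have "(\<lambda>(t, i). t \<otimes> s [^] i) ` (?T \<times> {..<p}) \<subseteq> {x \<in> carrier G. x [^] p \<in> ?M}"
    using tp sc by auto
  then have "card (?T \<times> {..<p}) \<le> card {x \<in> carrier G. x [^] p \<in> ?M}"
    using inj fin by (intro card_inj_on_le) auto
  then have "card ?T * p * card (pow_series 1) \<le> card {x \<in> carrier G. x [^] p \<in> ?M} * card (pow_series 1)"
    by (simp add: card_cartesian_product)
  also have "\<dots> \<le> order G * p" using le n(7) by (meson le_trans mult_le_mono2)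
  finally have "(card ?T * card (pow_series 1)) * p \<le> order G * p" by (simp only: mult_ac)
  then show ?thesis by simp
qed

text \<open>The inequality of \<open>card_omega_step\<close> for \<open>G Mod N\<close>, with both
  sides multiplied by \<open>card N\<close> twice: one factor turns a set of cosets into its
  preimage, the other belongs to \<open>pow_series 1\<close>, which contains
  \<open>N\<close>.\<close>

lemma card_omega_mod:
  "N \<lhd> G \<Longrightarrow> N \<subseteq> pow_series 1 \<Longrightarrow>
    card {x \<in> carrier G. x [^] p \<in> N} * card (pow_series 1) \<le> order G * card N"
proof (induction "order G - card N" arbitrary: N rule: less_induct)
  case less
  interpret N: normal N G by (fact less.prems)
  interpret Q: powerful_p_group "G Mod N" p by (rule powerful_Mod[OF less.prems(1)])
  interpret h: group_hom G "G Mod N" "\<lambda>x. N #> x" by (rule N.Mod_group_hom)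
  let ?h = "\<lambda>x. N #> x" and ?Q = "G Mod N"
  have posN: "card N > 0" using subgroup.finite_imp_card_positive[OF N.is_subgroup fin] .
  have o: "order G = card N * order ?Q" by (rule order_eq_card_coset[OF less.prems(1)])
  have P: "card (pow_series 1) = card N * card (Q.pow_series 1)"
    unfolding pow_series_Mod[OF less.prems(1)]
    using fin subgroup_pow_series less.prems(2) by (rule N.card_image_coset)
  have pre: "card {x \<in> carrier G. ?h x [^]\<^bsub>?Q\<^esub> p \<in> U} = card N * card {x \<in> carrier ?Q. x [^]\<^bsub>?Q\<^esub> p \<in> U}" for U
  proof -
    have "{x \<in> carrier G. ?h x [^]\<^bsub>?Q\<^esub> p \<in> U} = {x \<in> carrier G. ?h x \<in> {x \<in> carrier ?Q. x [^]\<^bsub>?Q\<^esub> p \<in> U}}"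
      by auto
    then show ?thesis using N.card_coset_preimage[OF fin, of "{x \<in> carrier ?Q. x [^]\<^bsub>?Q\<^esub> p \<in> U}"] by auto
  qed
  have "card {x \<in> carrier ?Q. x [^]\<^bsub>?Q\<^esub> p \<in> M} * card (Q.pow_series 1) \<le> order ?Q * card M"
    if M: "M \<lhd> ?Q" "M \<noteq> {\<one>\<^bsub>?Q\<^esub>}" "M \<subseteq> Q.pow_series 1" for M
  proof -
    interpret M: normal M ?Q by (fact M)
    define M' where "M' = {x \<in> carrier G. ?h x \<in> M}"
    have M'n: "M' \<lhd> G"
      unfolding M'_def using N.factgroup_subgroup_union_normal[OF M(1)]
        N.factgroup_subgroup_union_char[OF M.is_subgroup] by simp
    have cM: "card M' = card N * card M"
      unfolding M'_def using fin M.subset by (rule N.card_coset_preimage)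
    have "p \<le> card M"
      using Q.dvd_card_subgroup[OF M.is_subgroup M(2)] subgroup.finite_imp_card_positive[OF M.is_subgroup Q.fin]
      by (simp add: dvd_imp_le)
    then have "card M > 1" using p_ge_5 by simp
    then have "card N < card M'" using cM posN by simp
    moreover have "card M' \<le> order G"
      unfolding M'_def order_def using fin by (intro card_mono) auto
    moreover have "M' \<subseteq> pow_series 1"
    proof
      fix x assume "x \<in> M'"
      then have x: "x \<in> carrier G" "?h x \<in> ?h ` pow_series 1"
        using M(3) unfolding pow_series_Mod[OF less.prems(1)] M'_def by auto
      then obtain y where y: "y \<in> pow_series 1" "?h y = ?h x" by auto
      then have "inv y \<otimes> x \<in> pow_series 1" using N.coset_eq_iff[of y x] x(1) less.prems(2) by auto
      then have "y \<otimes> (inv y \<otimes> x) \<in> pow_series 1" using y(1) by blast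
      then show "x \<in> pow_series 1" using y(1) x(1) by simp
    qed
    ultimately have "card {x \<in> carrier G. x [^] p \<in> M'} * card (pow_series 1) \<le> order G * card M'"
      by (intro less.hyps[OF _ M'n]) simp_all
    moreover have "{x \<in> carrier G. x [^] p \<in> M'} = {x \<in> carrier G. ?h x [^]\<^bsub>?Q\<^esub> p \<in> M}"
      unfolding M'_def by (auto simp: h.hom_nat_pow)
    ultimately have "(card N * card N) * (card {x \<in> carrier ?Q. x [^]\<^bsub>?Q\<^esub> p \<in> M} * card (Q.pow_series 1))
        \<le> (card N * card N) * (order ?Q * card M)"
      unfolding \<open>{x \<in> carrier G. x [^] p \<in> M'} = {x \<in> carrier G. ?h x [^]\<^bsub>?Q\<^esub> p \<in> M}\<close> pre o P cM
      by (simp only: mult_ac)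
    then show ?thesis using posN by simp
  qed
  then have "card {x \<in> carrier ?Q. x [^]\<^bsub>?Q\<^esub> p = \<one>\<^bsub>?Q\<^esub>} * card (Q.pow_series 1) \<le> order ?Q"
    by (rule Q.card_omega_step)
  moreover have "card {x \<in> carrier G. x [^] p \<in> N} = card N * card {x \<in> carrier ?Q. x [^]\<^bsub>?Q\<^esub> p = \<one>\<^bsub>?Q\<^esub>}"
    using pre[of "{\<one>\<^bsub>?Q\<^esub>}"] N.pow_mem_iff[of _ p] by (simp cong: conj_cong)
  ultimately show ?case unfolding o P by (simp add: mult_ac)
qed

theorem card_Omega_1_le: "card (Omega_1 p G) * card (pow_series 1) \<le> order G"
proof -
  let ?T = "{x \<in> carrier G. x [^] p = \<one>}"
  note reg = omega_regular_modD(1)[OF all_omega_regular_mod[OF one_is_normal]]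
  have T: "subgroup ?T G"
  proof (rule subgroupI)
    have "\<one> \<in> ?T" by simp
    then show "?T \<noteq> {}" by blast
  qed (use reg in \<open>auto simp: nat_pow_inv\<close>)
  have "{x \<in> carrier G. ord x = p} \<subseteq> ?T" using pow_ord_eq_1 by auto
  then have "Omega_1 p G \<subseteq> ?T" unfolding Omega_1_def using T by (rule generate_subgroup_incl)
  then have "card (Omega_1 p G) \<le> card ?T" using T by (intro card_mono) auto
  then have "card (Omega_1 p G) * card (pow_series 1) \<le> card ?T * card (pow_series 1)" by simp
  also have "\<dots> \<le> order G" using card_omega_mod[OF one_is_normal] pow_series_closed(4) by simp
  finally show ?thesis .
qed

end

section \<open>The equivalence\<close>

context p_group
begin

lemma powerful_iff: "powerful p G \<longleftrightarrow> (\<forall>x\<in>carrier G. \<forall>y\<in>carrier G. commutator G x y \<in> pow_series 1)"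
proof -
  have "power_subgroup p G = pow_series 1" by (simp add: power_subgroup_def pow_series.simps)
  moreover have "derived G (carrier G) \<subseteq> pow_series 1 \<longleftrightarrow> derived_set G (carrier G) \<subseteq> pow_series 1"
  proof
    show "derived_set G (carrier G) \<subseteq> pow_series 1" if "derived G (carrier G) \<subseteq> pow_series 1"
      using that unfolding derived_def by (meson generate.incl subset_iff)
    show "derived G (carrier G) \<subseteq> pow_series 1" if "derived_set G (carrier G) \<subseteq> pow_series 1"
      using that subgroup_pow_series unfolding derived_def by (rule generate_subgroup_incl)
  qed
  moreover have "derived_set G (carrier G) \<subseteq> pow_series 1 \<longleftrightarrow>
      (\<forall>x\<in>carrier G. \<forall>y\<in>carrier G. commutator G x y \<in> pow_series 1)"
    unfolding commutator_def by blast
  ultimately show ?thesis unfolding powerful_def by argo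
qed

lemma power_gamma3_subset_frattini: "power_gamma3 p G (carrier G) \<subseteq> frattini"
  by (rule power_gamma3_subset[OF subgroup_frattini])
     (auto intro: pow_p_in_frattini commutator_in_frattini)

text \<open>If some commutator lay outside \<open>G\<^sup>p\<close>, there would be a normal
  \<open>N\<close> above \<open>G\<^sup>p\<close>, not containing \<open>G'\<close>, with
  \<open>G'\<close> central modulo \<open>N\<close>. Then \<open>N\<close> contains
  \<open>G\<^sup>p\<close> and all triple commutators, hence \<open>frattini\<close> and hence
  \<open>G'\<close>.\<close>

lemma powerful_if_frattini_subset:
  assumes "frattini \<subseteq> power_gamma3 p G (carrier G)"
  shows "powerful p G"
proof (rule ccontr)
  let ?S = "{commutator G l g |l g. l \<in> carrier G \<and> g \<in> carrier G}"
  let ?D = "generate G ?S"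
  assume "\<not> powerful p G"
  then obtain x y where xy: "x \<in> carrier G" "y \<in> carrier G" "commutator G x y \<notin> pow_series 1"
    unfolding powerful_iff by blast
  have D: "commutator G x y \<in> ?D" if "x \<in> carrier G" "y \<in> carrier G" for x y
    by (rule generate.incl) (use that in blast)
  then have "\<not> ?D \<subseteq> pow_series 1" using xy by blast
  then obtain N z where N: "N \<lhd> G" "pow_series 1 \<subseteq> N" "\<not> ?D \<subseteq> N"
    "\<And>a g. a \<in> ?D \<Longrightarrow> g \<in> carrier G \<Longrightarrow> commutator G a g \<in> N"
    by (rule obtain_normal_avoiding[OF commutators_with_normal[OF normal_self] pow_series_normal]) blast
  interpret N: normal N G by (fact N)
  have "power_gamma3 p G (carrier G) \<subseteq> N"
    using N(2,4) D pow_in_pow_series[of _ 0] by (intro power_gamma3_subset[OF N.is_subgroup]) auto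
  then have "?S \<subseteq> N" using assms commutator_in_frattini by blast
  then have "?D \<subseteq> N" by (rule generate_subgroup_incl) (rule N.is_subgroup)
  then show False using N(3) by blast
qed

theorem powerful_iff_min_generators:
  assumes p5: "p \<ge> 5"
  shows "powerful p G \<longleftrightarrow> p ^ min_generators G = card (Omega_1 p G)"
proof
  have pos: "card frattini > 0" using subgroup.finite_imp_card_positive[OF subgroup_frattini fin] .
  have posO: "card (Omega_1 p G) > 0"
    unfolding Omega_1_def
    using subgroup.finite_imp_card_positive[OF generate_is_subgroup fin, of "{x \<in> carrier G. ord x = p}"] by blast
  note S = order_le_card_Omega_1[OF p5]
  {
    assume "powerful p G"
    then interpret powerful_p_group G p
      by unfold_locales (use p5 powerful_iff in auto)
    have "frattini \<subseteq> pow_series 1" unfolding frattini_def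
      using commutator_in_pow_series_1 pow_in_pow_series[of _ 0]
      by (intro generate_subgroup_incl[OF _ subgroup_pow_series]) auto
    moreover have "pow_series 1 \<subseteq> frattini"
      using generate_subgroup_incl[OF _ subgroup_frattini, of "{x [^] p |x. x \<in> carrier G}"] pow_p_in_frattini
      by (auto simp: pow_series.simps)
    ultimately have F: "pow_series 1 = frattini" by blast
    have "card (power_gamma3 p G (carrier G)) \<le> card frattini"
      using power_gamma3_subset_frattini subgroup_frattini by (intro card_mono) auto
    then have "order G \<le> card (Omega_1 p G) * card frattini" using S by (meson le_trans mult_le_mono2)
    then have "p ^ min_generators G * card frattini = card (Omega_1 p G) * card frattini"
      using card_Omega_1_le burnside_basis F by simp
    then show "p ^ min_generators G = card (Omega_1 p G)" using pos by simp
  }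
  assume "p ^ min_generators G = card (Omega_1 p G)"
  then have "card (Omega_1 p G) * card frattini \<le> card (Omega_1 p G) * card (power_gamma3 p G (carrier G))"
    using S burnside_basis by simp
  then have "card frattini \<le> card (power_gamma3 p G (carrier G))" using posO by simp
  then have "power_gamma3 p G (carrier G) = frattini"
    using power_gamma3_subset_frattini subgroup_frattini by (intro card_seteq) auto
  then show "powerful p G" by (intro powerful_if_frattini_subset) simp
qed

end

theorem theoremA:
  fixes p :: nat and G :: "('a, 'b) monoid_scheme"
  assumes "Factorial_Ring.prime p" and "p \<ge> 5" and "finite_p_group p G"
  shows "powerful p G \<longleftrightarrow>
         real (min_generators G) = log (real p) (real (card (Omega_1 p G)))"
proof -
  interpret p_group G p
    using assms by (intro p_group.intro p_group_axioms.intro) (auto simp: finite_p_group_def)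
  \<comment> \<open>Positivity keeps \<open>log\<close> away from its default value at
    \<open>0\<close>, so that it can be inverted by \<open>powr\<close>.\<close>
  have pos: "card (Omega_1 p G) > 0"
    unfolding Omega_1_def
    using subgroup.finite_imp_card_positive[OF generate_is_subgroup fin, of "{x \<in> carrier G. ord x = p}"] by blast
  have "p ^ min_generators G = card (Omega_1 p G) \<longleftrightarrow>
      real (min_generators G) = log (real p) (real (card (Omega_1 p G)))"
  proof
    assume "p ^ min_generators G = card (Omega_1 p G)"
    then have "real (card (Omega_1 p G)) = real p ^ min_generators G" by (metis of_nat_power)
    then show "real (min_generators G) = log (real p) (real (card (Omega_1 p G)))"
      using assms(2) by (simp add: log_pow_cancel)
  next
    assume "real (min_generators G) = log (real p) (real (card (Omega_1 p G)))"
    then have "real p powr real (min_generators G) = real (card (Omega_1 p G))"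
      using assms(2) pos by simp
    then have "real p ^ min_generators G = real (card (Omega_1 p G))"
      using assms(2) by (simp add: powr_realpow)
    then show "p ^ min_generators G = card (Omega_1 p G)" by (metis of_nat_eq_iff of_nat_power)
  qed
  then show ?thesis using powerful_iff_min_generators[OF assms(2)] by simp
qed

end
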